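(* Let $m\ge 1$ be an integer and let $\beta$ be real. (a) Let $V$ be the real vector space $\mathrm{Sym}(m,\mathbb{R})$ of real symmetric $m\times m$ matrices, and let $C\subset V$ be the cone $\Pi_m(\mathbb{R})$ of positive-definite matrices. Then the map $A\mapsto(\det A)^{-\beta}$ is completely monotone on $C$ if and only if $\beta\in\{0,\frac12,1,\frac32,\ldots\}\cup[(m-1)/2,\infty)$. Indeed, if $\beta\notin\{0,\frac12,1,\frac32,\ldots\}\cup[(m-1)/2,\infty)$, then the map $A\mapsto(\det A)^{-\beta}$ is not completely monotone on any nonempty open convex subcone $C'\subseteq C$. (b) Let $V$ be the real vector space $\mathrm{Herm}(m,\mathbb{C})$ of complex hermitian $m\times m$ matrices, and let $C\subset V$ be the cone $\Pi_m(\mathbb{C})$ of positive-definite matrices. Then the map $A\mapsto(\det A)^{-\beta}$ is completely monotone on $C$ if and only if $\beta\in\{0,1,2,3,\ldots\}\cup[m-1,\infty)$. Indeed, if $\beta\notin\{0,1,2,3,\ldots\}\cup[m-1,\infty)$, then the map $A\mapsto(\det A)^{-\beta}$ is not completely monotone on any nonempty open convex subcone $C'\subseteq C$. (c) Let $V$ be the real vector space $\mathrm{Herm}(m,\mathbb{H})$ of quaternionic hermitian $m\times m$ matrices, let $C\subset V$ be the cone $\Pi_m(\mathbb{H})$ of positive-definite matrices, and let $\det$ denote the Moore determinant. Then the map $A\mapsto(\det A)^{-\beta}$ is completely monotone on $C$ if and only if $\beta\in\{0,2,4,6,\ldots\}\cup[2m-2,\infty)$. Indeed, if $\beta\notin\{0,2,4,6,\ldots\}\cup[2m-2,\infty)$,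 then the map $A\mapsto(\det A)^{-\beta}$ is not completely monotone on any nonempty open convex subcone $C'\subseteq C$.
   Context: Let $C$ be an open convex cone in a finite-dimensional real vector space $V$. A $C^\infty$ function $f\colon C\to\mathbb{R}$ is completely monotone if for all $k\ge 0$, all $\mathbf{u}_1,\ldots,\mathbf{u}_k\in C$ and all $\mathbf{x}\in C$, one has $(-1)^kD_{\mathbf{u}_1}\cdots D_{\mathbf{u}_k}f(\mathbf{x})\ge 0$, where $D_{\mathbf{u}}$ is the directional derivative. Complete monotonicity on a subcone $C'\subseteq C$ refers to this definition applied to $C'$ (both the domain and the directions are $C'$). Quaternionic conventions: $\mathbb{H}$ denotes the real quaternions; $M\in\mathbb{H}^{m\times m}$ is hermitian if it equals its conjugate transpose $M^*$, and positive-definite if $v^*Mv>0$ for all nonzero $v\in\mathbb{H}^m$. Moore determinant: write $M=A+Bj$ with $A,B\in\mathbb{C}^{m\times m}$, put $\Psi(M)=\begin{pmatrix}A&B\\-\bar B&\bar A\end{pmatrix}$ and $J=\begin{pmatrix}0&I_m\\-I_m&0\end{pmatrix}$. For hermitian $M$ the matrix $J\Psi(M)$ is antisymmetric, and the Moore determinant of $M$ is $\mathrm{pf}(J\Psi(M))$, where the pfaffian $\mathrm{pf}$ is the polynomial on antisymmetric $2m\times 2m$ complex matrices uniquely determined by $(\mathrm{pf}\,Y)^2=\det Y$ and $\mathrm{pf}\,J=1$. It is real-valued. *)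

theory Defs
  imports "HOL-Analysis.Analysis"
begin

section \<open>Complete monotonicity on open convex cones\<close>

text \<open>The ambient vector space \<open>V\<close> is a linear subspace of a Euclidean space (a matrix type,
  in the applications), so ``open'' means relatively open in \<open>V\<close>. The library constants
  \<^const>\<open>cone\<close> and \<^const>\<open>conic\<close> force the apex 0 into a nonempty set and are therefore unsuitable
  for open cones; here only multiplication by strictly positive scalars is required.\<close>

definition open_convex_cone :: "'a::euclidean_space set \<Rightarrow> 'a set \<Rightarrow> bool" where
  "open_convex_cone V C \<longleftrightarrow>
     openin (top_of_set V) C \<and> convex C \<and> (\<forall>x\<in>C. \<forall>c>0. c *\<^sub>R x \<in> C)"

definition dir_deriv :: "'a::euclidean_space \<Rightarrow> ('a \<Rightarrow> real) \<Rightarrow> 'a \<Rightarrow> real" where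
  "dir_deriv u f x = deriv (\<lambda>t. f (x + t *\<^sub>R u)) 0"

text \<open>Smoothness in the sense that all mixed partial derivatives of all orders exist and are
  continuous. Partial derivatives are taken along vectors of \<open>V\<close> only, because \<open>V\<close> may be a proper
  subspace of the type; ``mixed'' is expressed by the list \<open>us\<close> of directions. Since \<open>C\<close> is open in \<open>V\<close>, everything depends only on the
  restriction of \<open>f\<close> to \<open>C\<close>.\<close>

definition smooth_on_open_of :: "'a::euclidean_space set \<Rightarrow> 'a set \<Rightarrow> ('a \<Rightarrow> real) \<Rightarrow> bool" where
  "smooth_on_open_of V C f \<longleftrightarrow>
     (\<forall>us. set us \<subseteq> V \<longrightarrow>
        continuous_on C (foldr dir_deriv us f) \<and>
        (\<forall>v\<in>V. \<forall>x\<in>C. (\<lambda>t::real. foldr dir_deriv us f (x + t *\<^sub>R v)) differentiable (at 0)))"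

definition completely_monotone :: "'a::euclidean_space set \<Rightarrow> 'a set \<Rightarrow> ('a \<Rightarrow> real) \<Rightarrow> bool" where
  "completely_monotone V C f \<longleftrightarrow>
     smooth_on_open_of V C f \<and>
     (\<forall>us. set us \<subseteq> C \<longrightarrow> (\<forall>x\<in>C. (-1) ^ length us * foldr dir_deriv us f x \<ge> 0))"


section \<open>Quaternions\<close>

text \<open>\<open>Quat a b c d\<close> is \<open>a + b i + c j + d k\<close>.\<close>

datatype quat = Quat (qRe: real) (qI: real) (qJ: real) (qK: real)

lemma quat_eq_iff: "p = q \<longleftrightarrow> qRe p = qRe q \<and> qI p = qI q \<and> qJ p = qJ q \<and> qK p = qK q"
  by (cases p; cases q) simp

instantiation quat :: ring_1
begin

definition "0 = Quat 0 0 0 0"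
definition "1 = Quat 1 0 0 0"
definition "p + q = Quat (qRe p + qRe q) (qI p + qI q) (qJ p + qJ q) (qK p + qK q)"
definition "- p = Quat (- qRe p) (- qI p) (- qJ p) (- qK p)"
definition "p - q = Quat (qRe p - qRe q) (qI p - qI q) (qJ p - qJ q) (qK p - qK q)"
definition "p * q = Quat
   (qRe p * qRe q - qI p * qI q - qJ p * qJ q - qK p * qK q)
   (qRe p * qI q + qI p * qRe q + qJ p * qK q - qK p * qJ q)
   (qRe p * qJ q - qI p * qK q + qJ p * qRe q + qK p * qI q)
   (qRe p * qK q + qI p * qJ q - qJ p * qI q + qK p * qRe q)"

instance
  by standard
     (simp_all add: zero_quat_def one_quat_def plus_quat_def uminus_quat_def minus_quat_def
       times_quat_def algebra_simps)

end

instantiation quat :: real_algebra_1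
begin

definition "r *\<^sub>R q = Quat (r * qRe q) (r * qI q) (r * qJ q) (r * qK q)"

instance
  by standard
     (simp_all add: scaleR_quat_def plus_quat_def times_quat_def quat_eq_iff algebra_simps)

end

lemma quat_sel [simp]:
  "qRe 0 = 0" "qI 0 = 0" "qJ 0 = 0" "qK 0 = 0"
  "qRe 1 = 1" "qI 1 = 0" "qJ 1 = 0" "qK 1 = 0"
  "qRe (p + q) = qRe p + qRe q" "qI (p + q) = qI p + qI q"
  "qJ (p + q) = qJ p + qJ q" "qK (p + q) = qK p + qK q"
  "qRe (- p) = - qRe p" "qI (- p) = - qI p" "qJ (- p) = - qJ p" "qK (- p) = - qK p"
  "qRe (p - q) = qRe p - qRe q" "qI (p - q) = qI p - qI q"
  "qJ (p - q) = qJ p - qJ q" "qK (p - q) = qK p - qK q"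
  "qRe (r *\<^sub>R q) = r * qRe q" "qI (r *\<^sub>R q) = r * qI q"
  "qJ (r *\<^sub>R q) = r * qJ q" "qK (r *\<^sub>R q) = r * qK q"
  by (simp_all add: zero_quat_def one_quat_def plus_quat_def uminus_quat_def minus_quat_def
       scaleR_quat_def)

instantiation quat :: real_inner
begin

definition "inner p q = qRe p * qRe q + qI p * qI q + qJ p * qJ q + qK p * qK q"
definition "norm (q :: quat) = sqrt (inner q q)"
definition "sgn (q :: quat) = inverse (norm q) *\<^sub>R q"
definition "dist (p :: quat) q = norm (p - q)"
definition "uniformity = (INF e\<in>{0 <..}. principal {(p :: quat, q). dist p q < e})"
definition "open (U :: quat set) \<longleftrightarrow>
   (\<forall>x\<in>U. eventually (\<lambda>(x', y). x' = x \<longrightarrow> y \<in> U) uniformity)"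

instance
proof
  fix p q s :: quat and r :: real
  show "inner p q = inner q p"
    by (simp add: inner_quat_def mult.commute)
  show "inner (p + q) s = inner p s + inner q s"
    by (simp add: inner_quat_def algebra_simps)
  show "inner (r *\<^sub>R p) q = r * inner p q"
    by (simp add: inner_quat_def algebra_simps)
  show "0 \<le> inner p p"
    by (simp add: inner_quat_def)
  show "inner p p = 0 \<longleftrightarrow> p = 0"
    by (simp add: inner_quat_def quat_eq_iff add_nonneg_eq_0_iff)
qed (fact norm_quat_def sgn_quat_def dist_quat_def uniformity_quat_def open_quat_def)+

end

instantiation quat :: euclidean_space
begin

definition "Basis = {Quat 1 0 0 0, Quat 0 1 0 0, Quat 0 0 1 0, Quat 0 0 0 1}"

instance
proof
  fix p q :: quat
  show "Basis \<noteq> ({} :: quat set)" "finite (Basis :: quat set)"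
    by (simp_all add: Basis_quat_def)
  show "inner p q = (if p = q then 1 else 0)" if "p \<in> Basis" "q \<in> Basis"
    using that unfolding Basis_quat_def inner_quat_def by (elim insertE emptyE) simp_all
  show "(\<forall>u\<in>Basis. inner p u = 0) \<longleftrightarrow> p = 0"
    by (simp add: Basis_quat_def inner_quat_def quat_eq_iff[of p 0])
qed

end

definition qcnj :: "quat \<Rightarrow> quat" where
  "qcnj q = Quat (qRe q) (- qI q) (- qJ q) (- qK q)"


section \<open>Cones of positive-definite matrices\<close>

text \<open>The index type has \<open>m\<close> elements.\<close>

definition Sym_real :: "(real^'m^'m) set" where
  "Sym_real = {M. transpose M = M}"

definition Pi_real :: "(real^'m^'m) set" where
  "Pi_real = {M \<in> Sym_real. \<forall>v. v \<noteq> 0 \<longrightarrow> v \<bullet> (M *v v) > 0}"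

definition Herm_complex :: "(complex^'m^'m) set" where
  "Herm_complex = {M. (\<chi> i j. cnj (M $ j $ i)) = M}"

definition Pi_complex :: "(complex^'m^'m) set" where
  "Pi_complex = {M \<in> Herm_complex. \<forall>v. v \<noteq> 0 \<longrightarrow>
     (\<exists>r>0. (\<Sum>i\<in>UNIV. \<Sum>j\<in>UNIV. cnj (v $ i) * M $ i $ j * v $ j) = of_real r)}"

definition Herm_quat :: "(quat^'m^'m) set" where
  "Herm_quat = {M. (\<chi> i j. qcnj (M $ j $ i)) = M}"

definition Pi_quat :: "(quat^'m^'m) set" where
  "Pi_quat = {M \<in> Herm_quat. \<forall>v. v \<noteq> 0 \<longrightarrow>
     (\<exists>r>0. (\<Sum>i\<in>UNIV. \<Sum>j\<in>UNIV. qcnj (v $ i) * M $ i $ j * v $ j) = of_real r)}"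


section \<open>Pfaffian and Moore determinant\<close>

text \<open>Square matrices of size \<open>2m\<close> are indexed by the sum type \<open>'m + 'm\<close>.\<close>

definition block_matrix ::
  "'a^'m^'m \<Rightarrow> 'a^'m^'m \<Rightarrow> 'a^'m^'m \<Rightarrow> 'a^'m^'m \<Rightarrow> 'a^('m + 'm)^('m + 'm)" where
  "block_matrix P Q R S = (\<chi> i j.
     case i of
       Inl a \<Rightarrow> (case j of Inl b \<Rightarrow> P $ a $ b | Inr b \<Rightarrow> Q $ a $ b)
     | Inr a \<Rightarrow> (case j of Inl b \<Rightarrow> R $ a $ b | Inr b \<Rightarrow> S $ a $ b))"

definition J_mat :: "complex^('m::finite + 'm)^('m + 'm)" where
  "J_mat = block_matrix 0 (mat 1) (- mat 1) 0"

inductive entry_polynomial :: "(complex^'k^'k \<Rightarrow> complex) \<Rightarrow> bool" where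
  "entry_polynomial (\<lambda>_. c)"
| "entry_polynomial (\<lambda>Y. Y $ i $ j)"
| "entry_polynomial p \<Longrightarrow> entry_polynomial q \<Longrightarrow> entry_polynomial (\<lambda>Y. p Y + q Y)"
| "entry_polynomial p \<Longrightarrow> entry_polynomial q \<Longrightarrow> entry_polynomial (\<lambda>Y. p Y * q Y)"

definition is_pfaffian :: "(complex^('m::finite + 'm)^('m + 'm) \<Rightarrow> complex) \<Rightarrow> bool" where
  "is_pfaffian p \<longleftrightarrow>
     entry_polynomial p \<and> (\<forall>Y. transpose Y = - Y \<longrightarrow> (p Y)\<^sup>2 = det Y) \<and> p J_mat = 1"

text \<open>The polynomial is unique only as a function on antisymmetric matrices (as a polynomial in all
  entries it is not), so the description ranges over its value at \<open>Y\<close>; it is meaningful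
  for antisymmetric \<open>Y\<close> only.\<close>

definition pf :: "complex^('m::finite + 'm)^('m + 'm) \<Rightarrow> complex" where
  "pf Y = (THE z. \<exists>p. is_pfaffian p \<and> z = p Y)"

text \<open>\<open>M = A + B j\<close> with \<open>A = cpart1 M\<close>, \<open>B = cpart2 M\<close>, using \<open>(c + d i) j = c j + d k\<close>.\<close>

definition cpart1 :: "quat^'m^'m \<Rightarrow> complex^'m^'m" where
  "cpart1 M = (\<chi> i j. Complex (qRe (M $ i $ j)) (qI (M $ i $ j)))"

definition cpart2 :: "quat^'m^'m \<Rightarrow> complex^'m^'m" where
  "cpart2 M = (\<chi> i j. Complex (qJ (M $ i $ j)) (qK (M $ i $ j)))"

definition Psi :: "quat^'m^'m \<Rightarrow> complex^('m::finite + 'm)^('m + 'm)" where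
  "Psi M = block_matrix (cpart1 M) (cpart2 M)
     (\<chi> i j. - cnj (cpart2 M $ i $ j)) (\<chi> i j. cnj (cpart1 M $ i $ j))"

text \<open>On hermitian matrices the pfaffian below is real-valued.\<close>

definition moore_det :: "quat^'m^'m \<Rightarrow> real" where
  "moore_det M = Re (pf (J_mat ** Psi M))"

end

theory Submission
  imports Defs "HOL-Computational_Algebra.Polynomial"
begin

text \<open>The three cases share one argument. Let \<open>h\<close> be half the real dimension of the division algebra.
  Block elimination writes the determinant as a product of pivots, and a Gaussian integral represents
  \<open>p powr (- s)\<close>, where \<open>p\<close> is a pivot, times the \<open>(- h)\<close>-th power of the remaining minor as the
  Laplace transform of a measure on matrices of rank one. If \<open>\<beta>\<close> belongs to the set in the theorem,
  convolution of such measures shows that \<open>det powr (- \<beta>)\<close> is a Laplace transform, hence completely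
  monotone.

  Conversely, for \<open>\<beta> < 0\<close> the function increases along rays. Otherwise let
  \<open>(k - 1) * h < \<beta> < k * h\<close> with \<open>k < m\<close>, and suppose that \<open>det powr (- \<beta>)\<close> is
  completely monotone on some open subcone, which after a congruence contains the identity. Its
  alternating differences are nonnegative, so by Bernstein polynomials the kernel
  \<open>f (x + y)\<close> is positive definite near half the identity. On matrices supported on \<open>k + 1\<close> indices,
  \<open>f\<close> is a positive power of a diagonal entry times the Laplace transform of a measure carried by
  matrices of rank at most \<open>k\<close>. Multiplying the kernel by \<open>exp (- s * (z \<bullet> e))\<close> and integrating over
  \<open>s\<close> removes that power and moves the measure along the ray spanned by \<open>e\<close>: the \<open>L\<^sup>2\<close> norm of an
  exponential sum along the rays is bounded by its norm for the original measure. The determinant of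
  the block, approximated by exponential sums, vanishes on rank \<open>k\<close> but not further along the rays,
  a contradiction.\<close>

section \<open>Alternating finite differences\<close>

text \<open>If f were the Laplace transform of a measure \<nu>, dividing by the power of the
  diagonal entry would convolve \<nu> with the Riesz measure \<open>s powr (\<kappa> - 1) ds\<close>
  on the ray through \<open>e\<close>, and uniqueness would identify the result with the low-rank
  measure \<mu>. A nonzero measure smeared along the ray cannot live on a variety which the ray
  leaves at once. But no such \<nu> is at hand: complete monotonicity on a small subcone gives only
  local information. The argument is therefore run on quadratic forms, where positivity of the
  kernel replaces \<nu> and exponents near zero suffice to approximate polynomials. The gap comes
  from counting pivots. Eliminating an index costs one Gaussian integral, which lowers the exponent
  of the remaining minor by h. So k pivots carry the exponents \<beta>, \<beta> - h, ..., \<beta> -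
  (k - 1) h, all positive when \<beta> > (k - 1) h, and the last diagonal entry keeps the power
  \<kappa> = k h - \<beta>, which has the wrong sign for a Laplace transform when \<beta> < k
  h.\<close>

fun alt_diff :: "'a::real_vector list \<Rightarrow> ('a \<Rightarrow> real) \<Rightarrow> 'a \<Rightarrow> real" where
  "alt_diff [] f x = f x"
| "alt_diff (h # hs) f x = alt_diff hs f x - alt_diff hs f (x + h)"

text \<open>Complete monotonicity without derivatives: \<open>alt_diff hs\<close> is the product of
  the operators 1 - T_h, with T_h the shift by h. It uses addition only and is carried directly
  along linear maps.\<close>

definition alternating :: "'a::real_vector set \<Rightarrow> ('a \<Rightarrow> real) \<Rightarrow> bool" where
  "alternating D f \<longleftrightarrow> (\<forall>hs x. set hs \<subseteq> D \<longrightarrow> x \<in> D \<longrightarrow> 0 \<le> alt_diff hs f x)"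

lemma alternatingD: "alternating D f \<Longrightarrow> set hs \<subseteq> D \<Longrightarrow> x \<in> D \<Longrightarrow> 0 \<le> alt_diff hs f x"
  by (auto simp: alternating_def)

lemma alternating_nonneg: "alternating D f \<Longrightarrow> x \<in> D \<Longrightarrow> 0 \<le> f x"
  using alternatingD[of D f "[]" x] by simp

lemma alt_diff_shift: "alt_diff hs (\<lambda>x. f (x + a)) x = alt_diff hs f (x + a)"
  by (induction hs arbitrary: x) (auto simp: algebra_simps)

lemma alt_diff_diff: "alt_diff hs (\<lambda>x. f x - g x) x = alt_diff hs f x - alt_diff hs g x"
  by (induction hs arbitrary: x) auto

lemma alt_diff_cmult: "alt_diff hs (\<lambda>x. c * f x) x = c * alt_diff hs f x"
  by (induction hs arbitrary: x) (auto simp: algebra_simps)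

lemma alt_diff_linear_comp:
  assumes "linear L"
  shows "alt_diff hs (\<lambda>x. f (L x)) x = alt_diff (map L hs) f (L x)"
  by (induction hs arbitrary: x) (auto simp: linear_add[OF assms])

lemma alt_diff_cong:
  assumes "\<And>x y. x \<in> D \<Longrightarrow> y \<in> D \<Longrightarrow> x + y \<in> D" "\<And>x. x \<in> D \<Longrightarrow> f x = g x" "set hs \<subseteq> D" "x \<in> D"
  shows "alt_diff hs f x = alt_diff hs g x"
  using assms(3,4) by (induction hs arbitrary: x) (auto simp: assms(1,2))

lemma alternating_cong:
  assumes "\<And>x y. x \<in> D \<Longrightarrow> y \<in> D \<Longrightarrow> x + y \<in> D" "\<And>x. x \<in> D \<Longrightarrow> f x = g x"
  shows "alternating D f \<longleftrightarrow> alternating D g"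
  unfolding alternating_def using alt_diff_cong[where D = D and f = f and g = g, OF assms]
  by (metis (no_types, lifting))

lemma alternating_shift:
  assumes "\<And>x y. x \<in> D \<Longrightarrow> y \<in> D \<Longrightarrow> x + y \<in> D" "alternating D f" "a \<in> D"
  shows "alternating D (\<lambda>x. f (x + a))"
  using assms unfolding alternating_def alt_diff_shift by blast

lemma alternating_diff_shift:
  assumes "alternating D f" "a \<in> D"
  shows "alternating D (\<lambda>x. f x - f (x + a))"
  unfolding alternating_def
proof (intro allI impI)
  fix hs x assume "set hs \<subseteq> D" "x \<in> D"
  then have "0 \<le> alt_diff (a # hs) f x"
    using assms by (intro alternatingD) auto
  then show "0 \<le> alt_diff hs (\<lambda>x. f x - f (x + a)) x"
    by (simp add: alt_diff_diff alt_diff_shift)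
qed

lemma alternating_cmult: "alternating D f \<Longrightarrow> 0 \<le> c \<Longrightarrow> alternating D (\<lambda>x. c * f x)"
  by (auto simp: alternating_def alt_diff_cmult)

section \<open>Alternating differences and directional derivatives\<close>

lemma open_convex_cone_add:
  assumes "open_convex_cone V C" "x \<in> C" "y \<in> C"
  shows "x + y \<in> C"
proof -
  have "(1/2) *\<^sub>R x + (1/2) *\<^sub>R y \<in> C"
    using assms convexD[of C x y "1/2" "1/2"] by (auto simp: open_convex_cone_def)
  then have "2 *\<^sub>R ((1/2) *\<^sub>R x + (1/2) *\<^sub>R y) \<in> C"
    using assms(1) unfolding open_convex_cone_def by fastforce
  then show ?thesis by (simp add: scaleR_add_right)
qed

lemma open_convex_cone_scale:
  "open_convex_cone V C \<Longrightarrow> x \<in> C \<Longrightarrow> c > 0 \<Longrightarrow> c *\<^sub>R x \<in> C"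
  by (auto simp: open_convex_cone_def)

lemma open_convex_cone_subset: "open_convex_cone V C \<Longrightarrow> C \<subseteq> V"
  by (auto simp: open_convex_cone_def openin_subtopology)

lemma alt_diff_has_derivative:
  assumes "\<And>x y. x \<in> D \<Longrightarrow> y \<in> D \<Longrightarrow> x + y \<in> D"
    and "\<And>x. x \<in> D \<Longrightarrow> ((\<lambda>s. g (x + s *\<^sub>R u)) has_real_derivative g' x) (at 0)"
    and "set hs \<subseteq> D" "x \<in> D"
  shows "((\<lambda>s. alt_diff hs g (x + s *\<^sub>R u)) has_real_derivative alt_diff hs g' x) (at 0)"
  using assms(3,4)
proof (induction hs arbitrary: x)
  case Nil
  then show ?case using assms(2) by simp
next
  case (Cons h hs)
  have "((\<lambda>s. alt_diff hs g (x + s *\<^sub>R u) - alt_diff hs g (x + h + s *\<^sub>R u))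
      has_real_derivative alt_diff hs g' x - alt_diff hs g' (x + h)) (at 0)"
    using Cons assms(1) by (intro DERIV_diff Cons.IH) auto
  then show ?case by (simp add: algebra_simps)
qed

text \<open>Derivatives \<open>us\<close> and differences \<open>hs\<close> are mixed in one
  statement. A difference in direction h is nonnegative as soon as the derivative along h has the
  right sign on the segment from x to x + h, so the induction moves h from \<open>hs\<close> to
  \<open>us\<close>.\<close>

lemma completely_monotone_imp_alternating:
  assumes C: "open_convex_cone V C" and cm: "completely_monotone V C f"
  shows "alternating C f"
proof -
  note add = open_convex_cone_add[OF C]
  have CV: "C \<subseteq> V" by (rule open_convex_cone_subset[OF C])
  have der: "((\<lambda>s. foldr dir_deriv us f (x + s *\<^sub>R u)) has_real_derivative
      foldr dir_deriv (u # us) f x) (at 0)" if "set us \<subseteq> C" "u \<in> C" "x \<in> C" for us u x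
  proof -
    have "(\<lambda>t::real. foldr dir_deriv us f (x + t *\<^sub>R u)) differentiable (at 0)"
      using cm that CV unfolding completely_monotone_def smooth_on_open_of_def by blast
    then show ?thesis
      by (simp add: dir_deriv_def DERIV_deriv_iff_real_differentiable)
  qed
  have "0 \<le> (-1) ^ length us * alt_diff hs (foldr dir_deriv us f) x"
    if "set us \<subseteq> C" "set hs \<subseteq> C" "x \<in> C" for us hs x
    using that
  proof (induction hs arbitrary: us x)
    case Nil
    then show ?case using cm by (auto simp: completely_monotone_def)
  next
    case (Cons h hs)
    let ?g = "foldr dir_deriv us f"
    have h: "h \<in> C" and hs: "set hs \<subseteq> C" using Cons.prems by auto
    have inC: "x + s *\<^sub>R h \<in> C" if "s \<ge> 0" for s
    proof (cases "s = 0")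
      case False
      then show ?thesis using that add Cons.prems(3) open_convex_cone_scale[OF C h, of s] by auto
    qed (use Cons.prems in auto)
    have d: "((\<lambda>t. (-1) ^ length us * alt_diff hs ?g (x + t *\<^sub>R h)) has_real_derivative
        (-1) ^ length us * alt_diff hs (dir_deriv h ?g) (x + s *\<^sub>R h)) (at s)"
      if "s \<ge> 0" for s
    proof -
      have "((\<lambda>t. alt_diff hs ?g (x + s *\<^sub>R h + t *\<^sub>R h)) has_real_derivative
        alt_diff hs (dir_deriv h ?g) (x + s *\<^sub>R h)) (at 0)"
        by (rule alt_diff_has_derivative[where D = C])
           (use add der[OF Cons.prems(1) h] hs inC[OF that] in auto)
      then have "((\<lambda>t. alt_diff hs ?g (x + t *\<^sub>R h)) has_real_derivative
        alt_diff hs (dir_deriv h ?g) (x + s *\<^sub>R h)) (at (0 + s))"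
        by (subst DERIV_shift) (simp add: algebra_simps)
      then show ?thesis using DERIV_cmult by simp
    qed
    have le: "(-1) ^ length us * alt_diff hs (dir_deriv h ?g) (x + s *\<^sub>R h) \<le> 0" if "s \<ge> 0" for s
      using Cons.IH[of "h # us" "x + s *\<^sub>R h"] Cons.prems(1) h hs inC[OF that] by simp
    have "(-1) ^ length us * alt_diff hs ?g (x + 1 *\<^sub>R h)
        \<le> (-1) ^ length us * alt_diff hs ?g (x + 0 *\<^sub>R h)"
      by (rule DERIV_nonpos_imp_nonincreasing[of 0 1]) (use d le in auto)
    then show ?case by (simp add: algebra_simps)
  qed
  from this[of "[]"] show ?thesis by (auto simp: alternating_def)
qed

text \<open>For s > 0 the vector s u is itself an admissible increment, so
  \<open>alt_diff hs g\<close> does not rise above its initial value along u, and its derivative at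
  0 cannot be positive.\<close>

lemma alternating_derivative:
  assumes add: "\<And>x y. x \<in> D \<Longrightarrow> y \<in> D \<Longrightarrow> x + y \<in> D"
    and sc: "\<And>x c. x \<in> D \<Longrightarrow> c > 0 \<Longrightarrow> c *\<^sub>R x \<in> D"
    and g: "alternating D g" and u: "u \<in> D"
    and der: "\<And>x. x \<in> D \<Longrightarrow> ((\<lambda>s. g (x + s *\<^sub>R u)) has_real_derivative g' x) (at 0)"
  shows "alternating D (\<lambda>x. - g' x)"
  unfolding alternating_def
proof (intro allI impI)
  fix hs x assume hs: "set hs \<subseteq> D" and x: "x \<in> D"
  let ?\<phi> = "\<lambda>s. alt_diff hs g (x + s *\<^sub>R u)"
  have d: "(?\<phi> has_real_derivative alt_diff hs g' x) (at 0)"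
    by (rule alt_diff_has_derivative[where D = D]) (use add der hs x in auto)
  have le: "?\<phi> s \<le> ?\<phi> 0" if "s > 0" for s
    using alternatingD[OF g, of "(s *\<^sub>R u) # hs" x] sc[OF u that] hs x by simp
  have "alt_diff hs g' x \<le> 0"
  proof (rule ccontr)
    assume "\<not> ?thesis"
    then obtain e where "e > 0" "\<And>h. h > 0 \<Longrightarrow> h < e \<Longrightarrow> ?\<phi> 0 < ?\<phi> (0 + h)"
      using DERIV_pos_inc_right[OF d] by auto
    then show False using le[of "e / 2"] by (metis add_0 field_sum_of_halves half_gt_zero
      less_add_same_cancel1 linorder_not_le)
  qed
  then show "0 \<le> alt_diff hs (\<lambda>x. - g' x) x"
    using alt_diff_cmult[of hs "-1" g' x] by simp
qed

lemma alternating_imp_completely_monotone: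
  assumes C: "open_convex_cone V C" and sm: "smooth_on_open_of V C f" and al: "alternating C f"
  shows "completely_monotone V C f"
proof -
  note add = open_convex_cone_add[OF C]
  have CV: "C \<subseteq> V" by (rule open_convex_cone_subset[OF C])
  have "alternating C (\<lambda>x. (-1) ^ length us * foldr dir_deriv us f x)" if "set us \<subseteq> C" for us
    using that
  proof (induction us)
    case Nil
    then show ?case using al by simp
  next
    case (Cons u us)
    let ?g = "foldr dir_deriv us f"
    have u: "u \<in> C" and us: "set us \<subseteq> C" using Cons.prems by auto
    have der: "((\<lambda>s. (-1) ^ length us * ?g (x + s *\<^sub>R u)) has_real_derivative
      (-1) ^ length us * dir_deriv u ?g x) (at 0)" if "x \<in> C" for x
    proof -
      have "(\<lambda>t::real. ?g (x + t *\<^sub>R u)) differentiable (at 0)"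
        using sm that u us CV unfolding smooth_on_open_of_def by blast
      then show ?thesis
        by (intro DERIV_cmult) (simp add: dir_deriv_def DERIV_deriv_iff_real_differentiable)
    qed
    show ?case
      using alternating_derivative[OF add open_convex_cone_scale[OF C] Cons.IH[OF us] u der]
      by simp
  qed
  then show ?thesis
    using sm alternating_nonneg unfolding completely_monotone_def by blast
qed

section \<open>Positive definiteness\<close>

text \<open>Writing \<open>y = T_h\<close> for the shift by \<open>h\<close>, this is the expansion of
  \<open>y ^ k = y ^ k * (y + (1 - y)) ^ (N - k)\<close> in the Bernstein basis.\<close>

definition bernstein_diff :: "nat \<Rightarrow> nat \<Rightarrow> 'a::real_vector \<Rightarrow> ('a \<Rightarrow> real) \<Rightarrow> 'a \<Rightarrow> real" where
  "bernstein_diff N l h f x =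
     real (N choose l) * alt_diff (replicate (N - l) h) f (x + real l *\<^sub>R h)"

text \<open>A Bernstein difference in one direction can thus be expanded in the next one, which
  drives the induction over coordinates in \<open>alternating_polynomial_nonneg\<close>.\<close>

lemma alternating_bernstein_diff:
  assumes add: "\<And>x y. x \<in> D \<Longrightarrow> y \<in> D \<Longrightarrow> x + y \<in> D" and f: "alternating D f" and h: "h \<in> D"
  shows "alternating D (bernstein_diff N l h f)"
proof -
  have 1: "alternating D (\<lambda>x. f (x + real l *\<^sub>R h))"
  proof (induction l)
    case (Suc l)
    have "alternating D (\<lambda>x. f (x + h + real l *\<^sub>R h))"
      by (rule alternating_shift[OF add Suc h]) 
    then show ?case by (simp add: algebra_simps)
  qed (use f in auto)
  have 2: "alternating D (alt_diff (replicate n h) g)" if "alternating D g" for n g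
    using that
  proof (induction n arbitrary: g)
    case (Suc n)
    have "alternating D (\<lambda>x. alt_diff (replicate n h) g x - alt_diff (replicate n h) g (x + h))"
      by (intro alternating_diff_shift Suc h)
    moreover have "alt_diff (replicate (Suc n) h) g =
        (\<lambda>x. alt_diff (replicate n h) g x - alt_diff (replicate n h) g (x + h))"
      by auto
    ultimately show ?case by metis
  next
    case 0
    have "alt_diff (replicate 0 h) g = g" by auto
    with 0 show ?case by simp
  qed
  have "alternating D (\<lambda>x. alt_diff (replicate (N - l) h) f (x + real l *\<^sub>R h))"
    using 2[OF 1, of "N - l"] by (simp add: alt_diff_shift[abs_def])
  then have "alternating D (\<lambda>x. real (N choose l) * alt_diff (replicate (N - l) h) f (x + real l *\<^sub>R h))"
    by (rule alternating_cmult) auto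
  moreover have "bernstein_diff N l h f =
      (\<lambda>x. real (N choose l) * alt_diff (replicate (N - l) h) f (x + real l *\<^sub>R h))"
    by (auto simp: bernstein_diff_def)
  ultimately show ?thesis by simp
qed

text \<open>Expansion of 1 = (y + (1 - y)) ^ n, where y stands for the shift by h.\<close>

lemma sum_binomial_alt_diff:
  "f x = (\<Sum>l\<le>n. real (n choose l) * alt_diff (replicate (n - l) h) f (x + real l *\<^sub>R h))"
proof (induction n arbitrary: x)
  case (Suc n)
  let ?a = "\<lambda>n l x. alt_diff (replicate (n - l) h) f (x + real l *\<^sub>R h)"
  have "f x = (f x - f (x + h)) + f (x + h)" by simp
  have *: "?a n l x = ?a (Suc n) l x + ?a (Suc n) (Suc l) x" if "l \<le> n" for l
  proof -
    have "Suc n - l = Suc (n - l)" using that by simp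
    then show ?thesis by (simp add: algebra_simps)
  qed
  have "f x = (\<Sum>l\<le>n. real (n choose l) * ?a n l x)" by (rule Suc)
  also have "\<dots> = (\<Sum>l\<le>n. real (n choose l) * ?a (Suc n) l x)
      + (\<Sum>l\<le>n. real (n choose l) * ?a (Suc n) (Suc l) x)"
    using * by (simp add: sum.distrib[symmetric] distrib_left)
  also have "(\<Sum>l\<le>n. real (n choose l) * ?a (Suc n) l x)
      = ?a (Suc n) 0 x + (\<Sum>l\<le>n. real (n choose Suc l) * ?a (Suc n) (Suc l) x)"
  proof -
    have "(\<Sum>l\<le>n. real (n choose l) * ?a (Suc n) l x)
        = (\<Sum>l\<le>Suc n. real (n choose l) * ?a (Suc n) l x)"
      by simp
    also have "\<dots> = ?a (Suc n) 0 x + (\<Sum>l\<le>n. real (n choose Suc l) * ?a (Suc n) (Suc l) x)"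
      by (subst sum.atMost_Suc_shift) simp
    finally show ?thesis .
  qed
  also have "\<dots> + (\<Sum>l\<le>n. real (n choose l) * ?a (Suc n) (Suc l) x)
      = (\<Sum>l\<le>Suc n. real (Suc n choose l) * ?a (Suc n) l x)"
    by (subst sum.atMost_Suc_shift) (simp add: sum.distrib[symmetric] algebra_simps)
  finally show ?case .
qed auto

lemma bernstein_diff_sum:
  assumes "k \<le> N"
  shows "f (x + real k *\<^sub>R h) =
    (\<Sum>l\<le>N. (\<Prod>i<k. (real l - real i) / (real N - real i)) * bernstein_diff N l h f x)"
proof -
  let ?r = "\<lambda>l. (\<Prod>i<k. (real l - real i) / (real N - real i))"
  \<comment> \<open>At index k + l the product is (k + l choose k) / (N choose k). The identity (N
    choose k + l)(k + l choose k) = (N choose k)(N - k choose l) turns the weights of degree N into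
    those of degree N - k.\<close>
  have r: "?r (k + l) * real (N choose (k + l)) = real ((N - k) choose l)" if "l \<le> N - k" for l
  proof -
    have 1: "?r (k + l) = real ((k + l) choose k) / real (N choose k)"
    proof -
      have "real ((k + l) choose k) = (\<Prod>i<k. (real (k + l) - real i)) / fact k"
        by (simp add: binomial_gbinomial gbinomial_prod_rev atLeast0LessThan)
      moreover have "real (N choose k) = (\<Prod>i<k. (real N - real i)) / fact k"
        by (simp add: binomial_gbinomial gbinomial_prod_rev atLeast0LessThan)
      ultimately show ?thesis by (simp add: prod_dividef)
    qed
    have "(N choose (k + l)) * ((k + l) choose k) = (N choose k) * ((N - k) choose l)"
      using choose_mult[of k "k + l" N] that assms by simp
    then have "real (N choose (k + l)) * real ((k + l) choose k) = real (N choose k) * real ((N - k) choose l)"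
      by (metis of_nat_mult)
    moreover have "real (N choose k) > 0" using assms by (simp add: zero_less_binomial)
    ultimately show ?thesis unfolding 1 by (simp add: field_simps)
  qed
  have 0: "?r l = 0" if "l < k" for l
    using that by (intro prod_zero) auto
  have "f (x + real k *\<^sub>R h) = (\<Sum>l\<le>N - k. real ((N - k) choose l) *
      alt_diff (replicate (N - k - l) h) f (x + real k *\<^sub>R h + real l *\<^sub>R h))"
    by (rule sum_binomial_alt_diff)
  also have "\<dots> = (\<Sum>l\<le>N - k. ?r (k + l) * bernstein_diff N (k + l) h f x)"
    using r by (intro sum.cong) (auto simp: bernstein_diff_def algebra_simps simp flip: r)
  also have "\<dots> = (\<Sum>l\<in>{k..N}. ?r l * bernstein_diff N l h f x)"
    by (rule sum.reindex_bij_witness[where i = "\<lambda>l. l - k" and j = "\<lambda>l. k + l"]) (use assms in auto)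
  also have "\<dots> = (\<Sum>l\<le>N. ?r l * bernstein_diff N l h f x)"
    by (rule sum.mono_neutral_left) (use 0 in \<open>auto simp: not_le\<close>)
  finally show ?thesis .
qed

text \<open>The Bernstein coefficients of y ^ k tend to the values at the grid points l / N,
  uniformly in l. The two products are compared factor by factor, all factors having modulus at most
  1; for small l this uses 2 * k < N.\<close>

lemma falling_ratio_bound:
  assumes "2 * k < N" "l \<le> N"
  shows "\<bar>(\<Prod>i<k. (real l - real i) / (real N - real i)) - (real l / real N) ^ k\<bar>
    \<le> real k * (real k / (real N - real k))"
proof -
  have a: "\<bar>(real l - real i) / (real N - real i)\<bar> \<le> 1" if "i < k" for i
    using assms that by (simp add: divide_simps abs_le_iff)
  have b: "\<bar>(real l - real i) / (real N - real i) - real l / real N\<bar> \<le> real k / (real N - real k)"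
    if "i < k" for i
  proof -
    have pos: "real N - real i > 0" "real N > 0" "real N - real k > 0" using assms that by auto
    have "(real l - real i) / (real N - real i) - real l / real N
        = - (real i / (real N - real i)) * ((real N - real l) / real N)"
      using pos by (simp add: field_simps)
    then have "\<bar>(real l - real i) / (real N - real i) - real l / real N\<bar>
        = (real i / (real N - real i)) * ((real N - real l) / real N)"
      using pos assms by (simp add: abs_mult)
    also have "\<dots> \<le> real i / (real N - real i) * 1"
      using pos assms by (intro mult_left_mono) (auto simp: field_simps)
    also have "\<dots> \<le> real k / (real N - real k)"
      using pos that by (simp, intro frac_le) auto
    finally show ?thesis .
  qed
  have "\<bar>(\<Prod>i<k. (real l - real i) / (real N - real i)) - (\<Prod>i<k. real l / real N)\<bar>
      \<le> (\<Sum>i<k. \<bar>(real l - real i) / (real N - real i) - real l / real N\<bar>)"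
    using norm_prod_diff[of "{..<k}" "\<lambda>i. (real l - real i) / (real N - real i)" "\<lambda>i. real l / real N"]
      a assms by auto
  also have "\<dots> \<le> (\<Sum>i<k. real k / (real N - real k))"
    using b by (intro sum_mono) auto
  finally show ?thesis by simp
qed

text \<open>The solution of the multidimensional Hausdorff moment problem, at the level of functionals.\<close>

lemma alternating_polynomial_nonneg:
  fixes h :: "nat \<Rightarrow> 'a::real_vector" and c :: "'j \<Rightarrow> real" and \<alpha> :: "'j \<Rightarrow> nat \<Rightarrow> nat"
  assumes add: "\<And>x y. x \<in> D \<Longrightarrow> y \<in> D \<Longrightarrow> x + y \<in> D" and J: "finite J"
    and "alternating D f" "\<And>i. i < n \<Longrightarrow> h i \<in> D" "x \<in> D"
    and "\<And>y. (\<And>i. i < n \<Longrightarrow> 0 \<le> y i \<and> y i \<le> 1) \<Longrightarrow> 0 \<le> (\<Sum>j\<in>J. c j * (\<Prod>i<n. y i ^ \<alpha> j i))"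
  shows "0 \<le> (\<Sum>j\<in>J. c j * f (x + (\<Sum>i<n. real (\<alpha> j i) *\<^sub>R h i)))"
  using assms(3-)
proof (induction n arbitrary: f c)
  case 0
  then have "0 \<le> (\<Sum>j\<in>J. c j)" "0 \<le> f x"
    using 0(4)[of "\<lambda>_. 0"] alternating_nonneg by auto
  then show ?case by (simp flip: sum_distrib_right)
next
  case (Suc n)
  define X where "X j = x + (\<Sum>i<n. real (\<alpha> j i) *\<^sub>R h i)" for j
  \<comment> \<open>The sum in question with the Bernstein coefficients of the last direction
    replaced by the grid values (l / N) ^ \<alpha>. For fixed l the last variable is frozen at l /
    N, and the induction hypothesis applies to \<open>bernstein_diff N l (h n) f\<close>.\<close>
  define A where "A N = (\<Sum>l\<le>N. \<Sum>j\<in>J. c j * (real l / real N) ^ \<alpha> j n * bernstein_diff N l (h n) f (X j))" for N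
  define K where "K = Max (insert 1 ((\<lambda>j. \<alpha> j n) ` J))"
  have K: "\<alpha> j n \<le> K" if "j \<in> J" for j
    using J that by (auto simp: K_def)
  have XD: "X j \<in> D" for j
  proof -
    have "x + real m *\<^sub>R v \<in> D" if "x \<in> D" "v \<in> D" for m x v
      using that(1)
    proof (induction m arbitrary: x)
      case (Suc m)
      have "x + v + real m *\<^sub>R v \<in> D" by (rule Suc.IH) (use add Suc.prems that(2) in auto)
      then show ?case by (simp add: algebra_simps)
    qed auto
    then have *: "x + (\<Sum>i<k. real (\<alpha> j i) *\<^sub>R h i) \<in> D" if "k \<le> n" for k
      using that Suc.prems(2,3)
      by (induction k) (auto simp flip: add.assoc)
    show ?thesis unfolding X_def by (rule *) simp
  qed
  have A: "0 \<le> A N" for N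
    unfolding A_def
  proof (rule sum_nonneg)
    fix l assume l: "l \<in> {..N}"
    have "0 \<le> (\<Sum>j\<in>J. (c j * (real l / real N) ^ \<alpha> j n) *
        bernstein_diff N l (h n) f (x + (\<Sum>i<n. real (\<alpha> j i) *\<^sub>R h i)))"
    proof (rule Suc.IH)
      show "alternating D (bernstein_diff N l (h n) f)"
        by (intro alternating_bernstein_diff add Suc.prems) auto
      fix y :: "nat \<Rightarrow> real" assume y: "\<And>i. i < n \<Longrightarrow> 0 \<le> y i \<and> y i \<le> 1"
      have "0 \<le> (\<Sum>j\<in>J. c j * (\<Prod>i<Suc n. (y(n := real l / real N)) i ^ \<alpha> j i))"
        by (rule Suc.prems(4)) (use y l in \<open>auto simp: less_Suc_eq divide_simps\<close>)
      then show "0 \<le> (\<Sum>j\<in>J. c j * (real l / real N) ^ \<alpha> j n * (\<Prod>i<n. y i ^ \<alpha> j i))"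
        by (simp add: algebra_simps)
    qed (use Suc.prems in auto)
    then show "0 \<le> (\<Sum>j\<in>J. c j * (real l / real N) ^ \<alpha> j n * bernstein_diff N l (h n) f (X j))"
      by (simp add: X_def)
  qed
  define S where "S = (\<Sum>j\<in>J. c j * f (x + (\<Sum>i<Suc n. real (\<alpha> j i) *\<^sub>R h i)))"
  have S_eq: "S = (\<Sum>j\<in>J. c j * f (X j + real (\<alpha> j n) *\<^sub>R h n))"
    by (simp add: S_def X_def add.assoc)
  define E where "E N = (\<Sum>j\<in>J. \<bar>c j\<bar> * f (X j)) * (real K * (real K / (real N - real K)))" for N
  \<comment> \<open>The weights \<open>?b j l\<close> are nonnegative with sum
    \<open>f (X j)\<close>, so a coefficient error uniform in l gives an error of the same order for
    the sum.\<close>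
  have bound: "\<bar>S - A N\<bar> \<le> E N" if N: "2 * K < N" for N
  proof -
    let ?b = "\<lambda>j l. bernstein_diff N l (h n) f (X j)"
    let ?r = "\<lambda>j l. (\<Prod>i<\<alpha> j n. (real l - real i) / (real N - real i))"
    have b0: "0 \<le> ?b j l" for j l
      by (rule alternating_nonneg[OF alternating_bernstein_diff[where D = D]]) (use add Suc.prems XD in auto)
    have bs: "(\<Sum>l\<le>N. ?b j l) = f (X j)" for j
      using bernstein_diff_sum[of 0 N f "X j" "h n"] by simp
    have SA: "S - A N = (\<Sum>j\<in>J. \<Sum>l\<le>N. c j * (?r j l - (real l / real N) ^ \<alpha> j n) * ?b j l)"
    proof -
      have "S = (\<Sum>j\<in>J. \<Sum>l\<le>N. c j * ?r j l * ?b j l)"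
        unfolding S_eq
      proof (intro sum.cong refl)
        fix j assume "j \<in> J"
        then have "\<alpha> j n \<le> N" using K N by fastforce
        then show "c j * f (X j + real (\<alpha> j n) *\<^sub>R h n) = (\<Sum>l\<le>N. c j * ?r j l * ?b j l)"
          by (subst bernstein_diff_sum[of "\<alpha> j n" N]) (auto simp: sum_distrib_left mult.assoc)
      qed
      moreover have "A N = (\<Sum>j\<in>J. \<Sum>l\<le>N. c j * (real l / real N) ^ \<alpha> j n * ?b j l)"
        unfolding A_def by (rule sum.swap)
      ultimately show ?thesis
        by (simp only: sum_subtractf right_diff_distrib left_diff_distrib)
    qed
    have "\<bar>S - A N\<bar> \<le> (\<Sum>j\<in>J. \<Sum>l\<le>N. \<bar>c j\<bar> * (real K * (real K / (real N - real K))) * ?b j l)"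
      unfolding SA
    proof (rule order_trans[OF sum_abs], rule sum_mono)
      fix j assume j: "j \<in> J"
      show "\<bar>\<Sum>l\<le>N. c j * (?r j l - (real l / real N) ^ \<alpha> j n) * ?b j l\<bar>
        \<le> (\<Sum>l\<le>N. \<bar>c j\<bar> * (real K * (real K / (real N - real K))) * ?b j l)"
      proof (rule order_trans[OF sum_abs], rule sum_mono)
        fix l assume l: "l \<in> {..N}"
        have k: "\<alpha> j n \<le> K" by (rule K[OF j])
        have "\<bar>?r j l - (real l / real N) ^ \<alpha> j n\<bar>
            \<le> real (\<alpha> j n) * (real (\<alpha> j n) / (real N - real (\<alpha> j n)))"
          using k N l by (intro falling_ratio_bound) auto
        also have "\<dots> \<le> real K * (real K / (real N - real K))"
          using k N by (intro mult_mono frac_le) auto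
        finally have "\<bar>c j\<bar> * \<bar>?r j l - (real l / real N) ^ \<alpha> j n\<bar> * ?b j l
            \<le> \<bar>c j\<bar> * (real K * (real K / (real N - real K))) * ?b j l"
          by (intro mult_right_mono mult_left_mono b0) auto
        then show "\<bar>c j * (?r j l - (real l / real N) ^ \<alpha> j n) * ?b j l\<bar>
          \<le> \<bar>c j\<bar> * (real K * (real K / (real N - real K))) * ?b j l"
          unfolding abs_mult abs_of_nonneg[OF b0] .
      qed
    qed
    also have "\<dots> = (\<Sum>j\<in>J. (\<bar>c j\<bar> * f (X j)) * (real K * (real K / (real N - real K))))"
    proof (rule sum.cong[OF refl])
      fix j
      have "(\<Sum>l\<le>N. a * ?b j l) = f (X j) * a" for a
        using sum_distrib_left[of a "?b j" "{..N}"] bs[of j] by (metis mult.commute)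
      from this[of "\<bar>c j\<bar> * (real K * (real K / (real N - real K)))"]
      show "(\<Sum>l\<le>N. \<bar>c j\<bar> * (real K * (real K / (real N - real K))) * ?b j l)
          = (\<bar>c j\<bar> * f (X j)) * (real K * (real K / (real N - real K)))"
        by (simp only: ac_simps)
    qed
    also have "\<dots> = E N"
      unfolding E_def by (rule sum_distrib_right[symmetric])
    finally show ?thesis .
  qed
  have "E \<longlonglongrightarrow> 0"
  proof -
    have "(\<lambda>N. real K / (real N - real K)) \<longlonglongrightarrow> 0"
      using filterlim_tendsto_add_at_top[OF tendsto_const filterlim_real_sequentially, of "- real K"]
      by (intro tendsto_divide_0[OF tendsto_const] filterlim_at_top_imp_at_infinity) simp
    then show ?thesis unfolding E_def by (intro tendsto_mult_right_zero)
  qed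
  then have lim: "(\<lambda>N. - E N) \<longlonglongrightarrow> - 0" by (rule tendsto_minus)
  have ev: "\<exists>M. \<forall>N\<ge>M. - E N \<le> S"
  proof (intro exI[of _ "Suc (2 * K)"] allI impI)
    fix N assume "Suc (2 * K) \<le> N"
    then show "- E N \<le> S" using bound[of N] A[of N] by linarith
  qed
  have "- 0 \<le> S" by (rule LIMSEQ_le_const2[OF lim ev])
  then have "0 \<le> S" by simp
  then show ?case by (simp add: S_def)
qed

text \<open>The case of the square of the linear form with coefficients c: the monomial y_i y_j
  becomes the shift by z_i + z_j.\<close>

lemma alternating_positive_definite:
  fixes z :: "nat \<Rightarrow> 'a::real_vector"
  assumes add: "\<And>x y. x \<in> D \<Longrightarrow> y \<in> D \<Longrightarrow> x + y \<in> D"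
    and "alternating D f" "\<And>i. i < n \<Longrightarrow> z i \<in> D" "x \<in> D"
  shows "0 \<le> (\<Sum>i<n. \<Sum>j<n. c i * c j * f (x + z i + z j))"
proof -
  define \<alpha> where "\<alpha> = (\<lambda>(i::nat, j::nat) k::nat. (if k = i then 1 else 0) + (if k = j then 1 else (0::nat)))"
  have "0 \<le> (\<Sum>p\<in>{..<n}\<times>{..<n}. (case p of (i, j) \<Rightarrow> c i * c j) * f (x + (\<Sum>k<n. real (\<alpha> p k) *\<^sub>R z k)))"
  proof (rule alternating_polynomial_nonneg[where D = D])
    fix y :: "nat \<Rightarrow> real"
    have "(\<Prod>k<n. y k ^ \<alpha> (i, j) k) = y i * y j" if "i < n" "j < n" for i j
      using that by (simp add: \<alpha>_def power_add prod.distrib if_distrib[of "\<lambda>m. _ ^ m"] prod.delta cong: if_cong)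
    then have "(\<Sum>p\<in>{..<n}\<times>{..<n}. (case p of (i, j) \<Rightarrow> c i * c j) * (\<Prod>k<n. y k ^ \<alpha> p k))
        = (\<Sum>i<n. \<Sum>j<n. c i * c j * (y i * y j))"
      by (auto simp: sum.cartesian_product intro!: sum.cong)
    also have "\<dots> = (\<Sum>i<n. c i * y i)\<^sup>2"
      by (simp add: power2_eq_square sum_product algebra_simps)
    finally show "0 \<le> (\<Sum>p\<in>{..<n}\<times>{..<n}. (case p of (i, j) \<Rightarrow> c i * c j) * (\<Prod>k<n. y k ^ \<alpha> p k))"
      by simp
  qed (use assms in auto)
  also have "\<dots> = (\<Sum>i<n. \<Sum>j<n. c i * c j * f (x + z i + z j))"
  proof -
    have "(\<Sum>k<n. real (\<alpha> (i, j) k) *\<^sub>R z k) = z i + z j" if "i < n" "j < n" for i j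
      using that by (simp add: \<alpha>_def scaleR_add_left sum.distrib if_distrib[of "\<lambda>a. real a *\<^sub>R _"] cong: if_cong)
    then show ?thesis by (auto simp: sum.cartesian_product add.assoc intro!: sum.cong)
  qed
  finally show ?thesis .
qed

section \<open>Powers of positive polynomials\<close>

lemma real_polynomial_function_deriv:
  fixes p :: "'a::real_normed_vector \<Rightarrow> real"
  assumes "real_polynomial_function p"
  obtains p' where "real_polynomial_function p'"
    "\<And>x. ((\<lambda>s. p (x + s *\<^sub>R u)) has_real_derivative p' x) (at 0)"
proof -
  from assms have "\<exists>p'. real_polynomial_function p' \<and>
      (\<forall>x. ((\<lambda>s. p (x + s *\<^sub>R u)) has_real_derivative p' x) (at 0))"
  proof (induction rule: real_polynomial_function.induct)
    case (linear f)
    interpret bounded_linear f by fact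
    have "((\<lambda>s. f x + s * f u) has_real_derivative f u) (at 0)" for x
      by (auto intro!: derivative_eq_intros)
    then show ?case
      by (intro exI[of _ "\<lambda>_. f u"]) (auto simp: add scaleR)
  next
    case (const c)
    show ?case by (intro exI[of _ "\<lambda>_. 0"]) auto
  next
    case (add f g)
    then obtain f' g' where *: "real_polynomial_function f'" "real_polynomial_function g'"
      "\<And>x. ((\<lambda>s. f (x + s *\<^sub>R u)) has_real_derivative f' x) (at 0)"
      "\<And>x. ((\<lambda>s. g (x + s *\<^sub>R u)) has_real_derivative g' x) (at 0)"
      by blast
    show ?case
      by (rule exI[of _ "\<lambda>x. f' x + g' x"]) (use * in \<open>auto intro: DERIV_add\<close>)
  next
    case (mult f g)
    then obtain f' g' where *: "real_polynomial_function f'" "real_polynomial_function g'"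
      "\<And>x. ((\<lambda>s. f (x + s *\<^sub>R u)) has_real_derivative f' x) (at 0)"
      "\<And>x. ((\<lambda>s. g (x + s *\<^sub>R u)) has_real_derivative g' x) (at 0)"
      by blast
    have "((\<lambda>s. f (x + s *\<^sub>R u) * g (x + s *\<^sub>R u)) has_real_derivative f' x * g x + g' x * f x) (at 0)" for x
      using DERIV_mult[OF *(3)[of x] *(4)[of x]] by simp
    then show ?case
      by (intro exI[of _ "\<lambda>x. f' x * g x + g' x * f x"]) (use * mult in auto)
  qed
  with that show ?thesis by blast
qed

text \<open>The functions \<open>p x * P x powr (a - n)\<close> with p polynomial are closed under
  directional derivatives. The formula for f holds on C only, which suffices because x + s u stays
  in C for small s.\<close>

lemma smooth_on_open_of_powr:
  fixes P :: "'a::euclidean_space \<Rightarrow> real"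
  assumes V: "subspace V" and C: "openin (top_of_set V) C"
    and P: "real_polynomial_function P" and pos: "\<And>x. x \<in> C \<Longrightarrow> P x > 0"
    and f: "\<And>x. x \<in> C \<Longrightarrow> f x = P x powr a"
  shows "smooth_on_open_of V C f"
proof -
  obtain T where T: "open T" "C = V \<inter> T"
    using C by (auto simp: openin_open)
  have ev: "\<forall>\<^sub>F s in at 0. x + s *\<^sub>R u \<in> C" if "x \<in> C" "u \<in> V" for x u
  proof -
    have "((\<lambda>s::real. x + s *\<^sub>R u) \<longlongrightarrow> x + 0 *\<^sub>R u) (at 0)"
      by (intro tendsto_intros)
    then have "\<forall>\<^sub>F s in at 0. x + s *\<^sub>R u \<in> T"
      by (rule topological_tendstoD[OF _ T(1)]) (use that T in auto)
    then show ?thesis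
      by eventually_elim (use that T V in \<open>auto intro: subspace_add subspace_scale\<close>)
  qed
  have der: "((\<lambda>s. g (x + s *\<^sub>R u)) has_real_derivative
        (p' x * P x - (real n - a) * p x * P' x) * P x powr (a - real (Suc n))) (at 0)"
    if g: "\<And>x. x \<in> C \<Longrightarrow> g x = p x * P x powr (a - real n)"
      and p': "\<And>x. ((\<lambda>s. p (x + s *\<^sub>R u)) has_real_derivative p' x) (at 0)"
      and P': "\<And>x. ((\<lambda>s. P (x + s *\<^sub>R u)) has_real_derivative P' x) (at 0)"
      and x: "x \<in> C" and u: "u \<in> V" for g p n p' P' x u
  proof -
    have Px: "P x > 0" by (rule pos[OF x])
    have "((\<lambda>s. P (x + s *\<^sub>R u) powr (a - real n)) has_real_derivative
        (a - real n) * P x powr (a - real n - 1) * P' x) (at 0)"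
      by (rule derivative_eq_intros P' | use Px in simp)+
    then have "((\<lambda>s. p (x + s *\<^sub>R u) * P (x + s *\<^sub>R u) powr (a - real n)) has_real_derivative
        p' x * P x powr (a - real n) + (a - real n) * P x powr (a - real n - 1) * P' x * p x) (at 0)"
      using DERIV_mult[OF p'[of x]] by fastforce
    also have "P x powr (a - real n) = P x * P x powr (a - real (Suc n))"
      using Px by (simp add: powr_mult_base algebra_simps)
    also have "p' x * (P x * P x powr (a - real (Suc n))) + (a - real n) * P x powr (a - real n - 1) * P' x * p x
      = (p' x * P x - (real n - a) * p x * P' x) * P x powr (a - real (Suc n))"
      by (simp add: algebra_simps)
    finally show ?thesis
    proof (rule DERIV_cong_ev[THEN iffD1, rotated -1, OF _ refl])
      show "\<forall>\<^sub>F s in nhds 0. p (x + s *\<^sub>R u) * P (x + s *\<^sub>R u) powr (a - real n) = g (x + s *\<^sub>R u)"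
        using ev[OF x u] x unfolding eventually_nhds_conv_at by (auto elim!: eventually_mono simp: g)
    qed simp
  qed
  have key: "\<exists>p n. real_polynomial_function p \<and> (\<forall>x\<in>C. foldr dir_deriv us f x = p x * P x powr (a - real n))"
    if "set us \<subseteq> V" for us
    using that
  proof (induction us)
    case Nil
    show ?case by (intro exI[of _ "\<lambda>_. 1"] exI[of _ 0]) (auto simp: f)
  next
    case (Cons u us)
    then obtain p n where p: "real_polynomial_function p"
      and g: "\<And>x. x \<in> C \<Longrightarrow> foldr dir_deriv us f x = p x * P x powr (a - real n)" by auto
    obtain p' where p': "real_polynomial_function p'"
      "\<And>x. ((\<lambda>s. p (x + s *\<^sub>R u)) has_real_derivative p' x) (at 0)"
      using real_polynomial_function_deriv[OF p] by blast
    obtain P' where P': "real_polynomial_function P'"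
      "\<And>x. ((\<lambda>s. P (x + s *\<^sub>R u)) has_real_derivative P' x) (at 0)"
      using real_polynomial_function_deriv[OF P] by blast
    let ?q = "\<lambda>x. p' x * P x - (real n - a) * p x * P' x"
    have "real_polynomial_function ?q"
      using p p' P P' by (intro real_polynomial_function_diff real_polynomial_function.intros(4)
          real_polynomial_function.intros(2))
    moreover have "dir_deriv u (foldr dir_deriv us f) x = ?q x * P x powr (a - real (Suc n))" if "x \<in> C" for x
    proof -
      have "u \<in> V" using Cons.prems by simp
      from DERIV_imp_deriv[OF der[OF g p'(2) P'(2) that this]] show ?thesis
        by (simp add: dir_deriv_def)
    qed
    ultimately have "real_polynomial_function ?q \<and>
        (\<forall>x\<in>C. foldr dir_deriv (u # us) f x = ?q x * P x powr (a - real (Suc n)))"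
      by (simp only: foldr.simps o_apply) blast
    then have "\<exists>k. real_polynomial_function ?q \<and>
        (\<forall>x\<in>C. foldr dir_deriv (u # us) f x = ?q x * P x powr (a - real k))"
      by (rule exI[of _ "Suc n"])
    then show ?case by (rule exI[of _ ?q])
  qed
  show ?thesis
    unfolding smooth_on_open_of_def
  proof (intro allI impI conjI ballI)
    fix us assume us: "set us \<subseteq> V"
    from key[OF us] obtain p n where pn: "real_polynomial_function p \<and>
        (\<forall>x\<in>C. foldr dir_deriv us f x = p x * P x powr (a - real n))"
      by (elim exE)
    have p: "real_polynomial_function p" using pn by (rule conjunct1)
    have g: "foldr dir_deriv us f x = p x * P x powr (a - real n)" if "x \<in> C" for x
      using conjunct2[OF pn] that by (rule bspec)
    have cont: "continuous_on C q" if "real_polynomial_function q" for q :: "'a \<Rightarrow> real"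
      using that by (simp add: continuous_on_polymonial_function real_polynomial_function_eq)
    have "continuous_on C (\<lambda>x. p x * P x powr (a - real n))"
      by (intro continuous_on_mult continuous_on_powr continuous_on_const cont p P)
         (use pos in force)
    then show "continuous_on C (foldr dir_deriv us f)"
      by (rule continuous_on_eq) (simp only: g)
    fix v x assume v: "v \<in> V" and x: "x \<in> C"
    obtain p' where p': "\<And>x. ((\<lambda>s. p (x + s *\<^sub>R v)) has_real_derivative p' x) (at 0)"
      using real_polynomial_function_deriv[OF p] by blast
    obtain P' where P': "\<And>x. ((\<lambda>s. P (x + s *\<^sub>R v)) has_real_derivative P' x) (at 0)"
      using real_polynomial_function_deriv[OF P] by blast
    show "(\<lambda>t::real. foldr dir_deriv us f (x + t *\<^sub>R v)) differentiable (at 0)"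
      unfolding real_differentiable_def by (rule exI, rule der[OF g p' P' x v])
  qed
qed

section \<open>Approximating polynomials by exponential sums\<close>

definition exp_sum :: "(real \<times> 'a::real_inner) list \<Rightarrow> 'a \<Rightarrow> real" where
  "exp_sum xs B = (\<Sum>(c, a)\<leftarrow>xs. c * exp (- (a \<bullet> B)))"

text \<open>Small exponents a keep the points E / 2 + a in the neighbourhood of E / 2 where the
  kernel is known to be positive definite.\<close>

definition exponents_in :: "'a::real_inner set \<Rightarrow> real \<Rightarrow> (real \<times> 'a) list \<Rightarrow> bool" where
  "exponents_in U e xs \<longleftrightarrow> (\<forall>(c, a)\<in>set xs. a \<in> U \<and> norm a < e)"

lemma exp_sum_append: "exp_sum (xs @ ys) B = exp_sum xs B + exp_sum ys B"
  by (simp add: exp_sum_def)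

lemma exp_sum_mult:
  "exp_sum (concat (map (\<lambda>(c, a). map (\<lambda>(d, b). (c * d, a + b)) ys) xs)) B = exp_sum xs B * exp_sum ys B"
proof (induction xs)
  case (Cons x xs)
  obtain c a where x: "x = (c, a)" by force
  have "exp_sum (map (\<lambda>(d, b). (c * d, a + b)) ys) B = c * exp (- (a \<bullet> B)) * exp_sum ys B"
    by (induction ys) (auto simp: exp_sum_def inner_add_left exp_add exp_diff exp_minus field_simps)
  then show ?case using Cons by (simp add: x exp_sum_append) (simp add: exp_sum_def algebra_simps)
qed (simp add: exp_sum_def)

text \<open>Shrinking exponents keep the argument local, convergence on U identifies the limit, and
  growth of arbitrarily small exponential rate yields a dominating function.\<close>

definition exp_sums_approximate ::
    "'a::real_inner set \<Rightarrow> ('a \<Rightarrow> real) \<Rightarrow> (nat \<Rightarrow> (real \<times> 'a) list) \<Rightarrow> bool" where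
  "exp_sums_approximate U P X \<longleftrightarrow>
     (\<forall>e>0. \<forall>\<^sub>F n in sequentially. exponents_in U e (X n)) \<and>
     (\<forall>B\<in>U. (\<lambda>n. exp_sum (X n) B) \<longlonglongrightarrow> P B) \<and>
     (\<forall>\<delta>>0. \<exists>K>0. \<forall>\<^sub>F n in sequentially. \<forall>B\<in>U. \<bar>exp_sum (X n) B\<bar> \<le> K * exp (\<delta> * norm B))"

lemma exp_sums_approximateD:
  assumes "exp_sums_approximate U P X"
  shows "e > 0 \<Longrightarrow> \<forall>\<^sub>F n in sequentially. exponents_in U e (X n)"
    "B \<in> U \<Longrightarrow> (\<lambda>n. exp_sum (X n) B) \<longlonglongrightarrow> P B"
    "\<delta> > 0 \<Longrightarrow> \<exists>K>0. \<forall>\<^sub>F n in sequentially. \<forall>B\<in>U. \<bar>exp_sum (X n) B\<bar> \<le> K * exp (\<delta> * norm B)"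
  using assms by (simp_all only: exp_sums_approximate_def)

lemma abs_one_minus_exp_le: "\<bar>1 - exp (- x)\<bar> \<le> \<bar>x\<bar> * exp \<bar>x\<bar>" for x :: real
proof (cases "x \<ge> 0")
  case True
  have "1 - exp (-x) \<le> x" using exp_ge_add_one_self[of "-x"] by simp
  also have "x \<le> x * exp x" using True by (simp add: mult_le_cancel_left1)
  finally show ?thesis using True by simp
next
  case False
  have "(1 + x) * exp (- x) \<le> exp x * exp (- x)"
    by (intro mult_right_mono exp_ge_add_one_self) auto
  then have "exp (- x) - 1 \<le> (- x) * exp (- x)"
    by (simp add: algebra_simps flip: exp_add)
  then show ?thesis using False by simp
qed

text \<open>A linear form u \<bullet> B is the limit of n (1 - exp (- (u \<bullet> B) / n)), and the
  three requirements survive sums and products. In a product exponents and growth rates add, hence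
  the halves of e and \<delta>.\<close>

lemma polynomial_exp_sums_approximate:
  fixes P :: "'a::euclidean_space \<Rightarrow> real"
  assumes "real_polynomial_function P" and U: "subspace U"
  shows "\<exists>X. exp_sums_approximate U P X"
  using assms(1)
proof (induction rule: real_polynomial_function.induct)
  case (linear f)
  interpret bounded_linear f by fact
  have f_eq: "f B = adjoint f 1 \<bullet> B" for B
    using adjoint_works[of f B "1::real"] linear_axioms by (simp add: inner_commute)
  \<comment> \<open>Exponents must lie in U, so the vector representing f is replaced by its
    orthogonal projection to U, which gives the same values on U.\<close>
  obtain u w where u: "u \<in> span U" and w: "\<And>v. v \<in> span U \<Longrightarrow> orthogonal w v"
    and uw: "adjoint f 1 = u + w"
    using orthogonal_subspace_decomp_exists by blast
  have uU: "u \<in> U" using u U by (metis span_eq_iff)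
  have fU: "f B = u \<bullet> B" if "B \<in> U" for B
    using w[of B] that by (simp add: f_eq uw inner_add_left orthogonal_def span_base)
  define X where "X n = [(real (Suc n), 0::'a), (- real (Suc n), (1 / real (Suc n)) *\<^sub>R u)]" for n
  have X: "exp_sum (X n) B = real (Suc n) * (1 - exp (- ((1 / real (Suc n)) * (u \<bullet> B))))" for n B
    by (simp add: exp_sum_def X_def algebra_simps)
  have h0: "(\<lambda>n. 1 / real (Suc n)) \<longlonglongrightarrow> 0"
    using LIMSEQ_inverse_real_of_nat by (simp add: inverse_eq_divide)
  have small: "\<forall>\<^sub>F n in sequentially. norm ((1 / real (Suc n)) *\<^sub>R u) < e" if "e > 0" for e
  proof -
    have "(\<lambda>n. norm ((1 / real (Suc n)) *\<^sub>R u)) \<longlonglongrightarrow> norm (0 *\<^sub>R u)"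
      by (intro tendsto_intros h0)
    then show ?thesis using that by (simp add: order_tendstoD)
  qed
  show ?case
    unfolding exp_sums_approximate_def
  proof (intro exI[of _ X] conjI allI impI ballI)
    fix e :: real assume "e > 0"
    with small[OF this] show "\<forall>\<^sub>F n in sequentially. exponents_in U e (X n)"
      by (auto elim!: eventually_mono simp: exponents_in_def X_def uU U subspace_0 subspace_scale)
  next
    fix B assume B: "B \<in> U"
    have "((\<lambda>h. 1 - exp (- (h * (u \<bullet> B)))) has_real_derivative u \<bullet> B) (at 0)"
      by (auto intro!: derivative_eq_intros)
    then have "(\<lambda>h. (1 - exp (- (h * (u \<bullet> B)))) / h) \<midarrow>0\<rightarrow> u \<bullet> B"
      by (simp add: DERIV_def)
    moreover have "filterlim (\<lambda>n. 1 / real (Suc n)) (at 0) sequentially"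
      using h0 by (auto simp: filterlim_at)
    ultimately have "(\<lambda>n. (1 - exp (- ((1 / real (Suc n)) * (u \<bullet> B)))) / (1 / real (Suc n))) \<longlonglongrightarrow> u \<bullet> B"
      by (rule filterlim_compose)
    then show "(\<lambda>n. exp_sum (X n) B) \<longlonglongrightarrow> f B"
      by (simp add: X fU[OF B] mult.commute)
  next
    fix \<delta> :: real assume \<delta>: "\<delta> > 0"
    \<comment> \<open>With x = \<delta> / 2 * norm B, norm u * norm B is (2 * norm u / \<delta>) *
      x, and x \<le> exp x. The summand 1 keeps K positive when u = 0.\<close>
    define K where "K = 1 + 2 * norm u / \<delta>"
    have "K > 0" using \<delta> by (simp add: K_def add_pos_nonneg)
    moreover have "\<forall>\<^sub>F n in sequentially. \<forall>B\<in>U. \<bar>exp_sum (X n) B\<bar> \<le> K * exp (\<delta> * norm B)"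
      using small[OF half_gt_zero[OF \<delta>]]
    proof (rule eventually_mono, intro ballI)
      fix n B assume "norm ((1 / real (Suc n)) *\<^sub>R u) < \<delta> / 2" "B \<in> U"
      then have n: "norm u / (1 + real n) < \<delta> / 2" by simp
      let ?h = "1 / real (Suc n)" let ?x = "?h * (u \<bullet> B)"
      have "\<bar>?x\<bar> \<le> ?h * (norm u * norm B)"
        by (simp add: abs_mult Cauchy_Schwarz_ineq2 divide_right_mono)
      also have "\<dots> = norm u / (1 + real n) * norm B" by simp
      also have "\<dots> \<le> \<delta> / 2 * norm B" using n by (intro mult_right_mono) auto
      finally have x: "\<bar>?x\<bar> \<le> \<delta> / 2 * norm B" .
      have "\<bar>exp_sum (X n) B\<bar> = real (Suc n) * \<bar>1 - exp (- ?x)\<bar>"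
        by (simp only: X abs_mult abs_of_nat)
      also have "\<dots> \<le> real (Suc n) * (\<bar>?x\<bar> * exp \<bar>?x\<bar>)"
        by (intro mult_left_mono abs_one_minus_exp_le) auto
      also have "\<dots> = \<bar>u \<bullet> B\<bar> * exp \<bar>?x\<bar>" by (simp add: abs_mult)
      also have "\<dots> \<le> (norm u * norm B) * exp (\<delta> / 2 * norm B)"
        using x by (intro mult_mono) (auto simp: Cauchy_Schwarz_ineq2)
      finally have 1: "\<bar>exp_sum (X n) B\<bar> \<le> (norm u * norm B) * exp (\<delta> / 2 * norm B)" .
      have "norm u * norm B = (2 * norm u / \<delta>) * (\<delta> / 2 * norm B)"
        using \<delta> by simp
      also have "\<dots> \<le> K * exp (\<delta> / 2 * norm B)"
      proof (intro mult_mono)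
        show "\<delta> / 2 * norm B \<le> exp (\<delta> / 2 * norm B)"
          using exp_ge_add_one_self[of "\<delta> / 2 * norm B"] by linarith
      qed (use \<delta> in \<open>simp_all add: K_def\<close>)
      finally have "norm u * norm B * exp (\<delta> / 2 * norm B)
          \<le> K * exp (\<delta> / 2 * norm B) * exp (\<delta> / 2 * norm B)"
        by (intro mult_right_mono) auto
      then have "norm u * norm B * exp (\<delta> / 2 * norm B) \<le> K * exp (\<delta> * norm B)"
        by (simp add: mult.assoc flip: exp_add)
      with 1 show "\<bar>exp_sum (X n) B\<bar> \<le> K * exp (\<delta> * norm B)" by linarith
    qed
    ultimately show "\<exists>K>0. \<forall>\<^sub>F n in sequentially. \<forall>B\<in>U. \<bar>exp_sum (X n) B\<bar> \<le> K * exp (\<delta> * norm B)"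
      by blast
  qed
next
  case (const c)
  show ?case
    unfolding exp_sums_approximate_def
  proof (intro exI[of _ "\<lambda>_. [(c, 0)]"] conjI allI impI ballI)
    fix \<delta> :: real assume \<delta>: "\<delta> > 0"
    have "\<bar>exp_sum [(c, 0)] B\<bar> \<le> (1 + \<bar>c\<bar>) * exp (\<delta> * norm B)" for B
    proof -
      have "\<bar>c\<bar> * 1 \<le> (1 + \<bar>c\<bar>) * exp (\<delta> * norm B)"
        by (rule mult_mono) (use \<delta> in auto)
      then show ?thesis by (simp add: exp_sum_def)
    qed
    then show "\<exists>K>0. \<forall>\<^sub>F n in sequentially. \<forall>B\<in>U. \<bar>exp_sum [(c, 0)] B\<bar> \<le> K * exp (\<delta> * norm B)"
      by (intro exI[of _ "1 + \<bar>c\<bar>"] conjI always_eventually allI ballI)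
         (simp_all only: add_pos_nonneg zero_less_one abs_ge_zero)
  qed (auto simp: exponents_in_def exp_sum_def subspace_0[OF U])
next
  case (add f g)
  from add.IH(1) obtain X where "exp_sums_approximate U f X" by blast
  note X = exp_sums_approximateD[OF this]
  from add.IH(2) obtain Y where "exp_sums_approximate U g Y" by blast
  note Y = exp_sums_approximateD[OF this]
  show ?case
    unfolding exp_sums_approximate_def
  proof (intro exI[of _ "\<lambda>n. X n @ Y n"] conjI allI impI ballI)
    fix e :: real assume "e > 0"
    from eventually_conj[OF X(1)[OF this] Y(1)[OF this]]
    show "\<forall>\<^sub>F n in sequentially. exponents_in U e (X n @ Y n)"
      by (rule eventually_mono) (auto simp: exponents_in_def)
  next
    fix \<delta> :: real assume \<delta>: "\<delta> > 0"
    obtain K where K: "K > 0" "\<forall>\<^sub>F n in sequentially. \<forall>B\<in>U. \<bar>exp_sum (X n) B\<bar> \<le> K * exp (\<delta> * norm B)"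
      using X(3)[OF \<delta>] by blast
    obtain L where L: "L > 0" "\<forall>\<^sub>F n in sequentially. \<forall>B\<in>U. \<bar>exp_sum (Y n) B\<bar> \<le> L * exp (\<delta> * norm B)"
      using Y(3)[OF \<delta>] by blast
    from K(2) L(2) have "\<forall>\<^sub>F n in sequentially. \<forall>B\<in>U. \<bar>exp_sum (X n @ Y n) B\<bar> \<le> (K + L) * exp (\<delta> * norm B)"
    proof eventually_elim
      case (elim n)
      show ?case
      proof
        fix B assume B: "B \<in> U"
        have "\<bar>exp_sum (X n) B + exp_sum (Y n) B\<bar> \<le> \<bar>exp_sum (X n) B\<bar> + \<bar>exp_sum (Y n) B\<bar>"
          by (rule abs_triangle_ineq)
        also have "\<dots> \<le> K * exp (\<delta> * norm B) + L * exp (\<delta> * norm B)"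
          using elim B by (intro add_mono) auto
        finally show "\<bar>exp_sum (X n @ Y n) B\<bar> \<le> (K + L) * exp (\<delta> * norm B)"
          by (simp add: exp_sum_append distrib_right)
      qed
    qed
    then show "\<exists>K>0. \<forall>\<^sub>F n in sequentially. \<forall>B\<in>U. \<bar>exp_sum (X n @ Y n) B\<bar> \<le> K * exp (\<delta> * norm B)"
      using K L by (intro exI[of _ "K + L"]) auto
  qed (auto simp: exp_sum_append intro!: tendsto_add X Y)
next
  case (mult f g)
  from mult.IH(1) obtain X where "exp_sums_approximate U f X" by blast
  note X = exp_sums_approximateD[OF this]
  from mult.IH(2) obtain Y where "exp_sums_approximate U g Y" by blast
  note Y = exp_sums_approximateD[OF this]
  let ?Z = "\<lambda>n. concat (map (\<lambda>(c, a). map (\<lambda>(d, b). (c * d, a + b)) (Y n)) (X n))"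
  show ?case
    unfolding exp_sums_approximate_def
  proof (intro exI[of _ ?Z] conjI allI impI ballI)
    fix e :: real assume "e > 0"
    then have "\<forall>\<^sub>F n in sequentially. exponents_in U (e / 2) (X n)" "\<forall>\<^sub>F n in sequentially. exponents_in U (e / 2) (Y n)"
      using X(1) Y(1) by auto
    then show "\<forall>\<^sub>F n in sequentially. exponents_in U e (?Z n)"
    proof eventually_elim
      case (elim n)
      have "a + b \<in> U" "norm (a + b) < e" if "(c, a) \<in> set (X n)" "(d, b) \<in> set (Y n)" for a b c d
      proof -
        have "a \<in> U" "norm a < e / 2" "b \<in> U" "norm b < e / 2"
          using elim that by (auto simp: exponents_in_def)
        then show "a + b \<in> U" "norm (a + b) < e"
          using U norm_triangle_ineq[of a b] by (auto intro: subspace_add)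
      qed
      then show ?case by (auto simp: exponents_in_def)
    qed
  next
    fix \<delta> :: real assume "\<delta> > 0"
    then have \<delta>: "\<delta> / 2 > 0" by simp
    obtain K where K: "K > 0" "\<forall>\<^sub>F n in sequentially. \<forall>B\<in>U. \<bar>exp_sum (X n) B\<bar> \<le> K * exp (\<delta> / 2 * norm B)"
      using X(3)[OF \<delta>] by blast
    obtain L where L: "L > 0" "\<forall>\<^sub>F n in sequentially. \<forall>B\<in>U. \<bar>exp_sum (Y n) B\<bar> \<le> L * exp (\<delta> / 2 * norm B)"
      using Y(3)[OF \<delta>] by blast
    from K(2) L(2) have "\<forall>\<^sub>F n in sequentially. \<forall>B\<in>U. \<bar>exp_sum (?Z n) B\<bar> \<le> (K * L) * exp (\<delta> * norm B)"
    proof eventually_elim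
      case (elim n)
      show ?case
      proof
        fix B assume "B \<in> U"
        then have "\<bar>exp_sum (X n) B\<bar> * \<bar>exp_sum (Y n) B\<bar>
            \<le> (K * exp (\<delta> / 2 * norm B)) * (L * exp (\<delta> / 2 * norm B))"
          using elim K L by (intro mult_mono) auto
        also have "\<dots> = (K * L) * exp (\<delta> / 2 * norm B + \<delta> / 2 * norm B)"
          by (simp only: exp_add) simp
        finally show "\<bar>exp_sum (?Z n) B\<bar> \<le> (K * L) * exp (\<delta> * norm B)"
          by (simp add: exp_sum_mult abs_mult)
      qed
    qed
    then show "\<exists>K>0. \<forall>\<^sub>F n in sequentially. \<forall>B\<in>U. \<bar>exp_sum (?Z n) B\<bar> \<le> K * exp (\<delta> * norm B)"
      using K L by (intro exI[of _ "K * L"]) auto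
  qed (auto simp: exp_sum_mult intro!: tendsto_mult X Y)
qed

section \<open>Laplace transforms\<close>

text \<open>As \<open>ennreal\<close> sends negative numbers to 0, the sign of \<open>g A\<close>
  has to be required. That g is real-valued makes the integrals finite.\<close>

definition laplace_transform_on :: "'a::euclidean_space set \<Rightarrow> 'a measure \<Rightarrow> ('a \<Rightarrow> real) \<Rightarrow> bool" where
  "laplace_transform_on C \<mu> g \<longleftrightarrow> sets \<mu> = sets borel \<and>
     (\<forall>A\<in>C. 0 \<le> g A \<and> (\<integral>\<^sup>+B. ennreal (exp (- (A \<bullet> B))) \<partial>\<mu>) = ennreal (g A))"

lemma laplace_transform_onD:
  assumes "laplace_transform_on C \<mu> g"
  shows "sets \<mu> = sets borel" "A \<in> C \<Longrightarrow> 0 \<le> g A"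
    "A \<in> C \<Longrightarrow> (\<integral>\<^sup>+B. ennreal (exp (- (A \<bullet> B))) \<partial>\<mu>) = ennreal (g A)"
  using assms by (auto simp: laplace_transform_on_def)

lemma laplace_transform_on_integral:
  assumes "laplace_transform_on C \<mu> g" "A \<in> C"
  shows "has_bochner_integral \<mu> (\<lambda>B. exp (- (A \<bullet> B))) (g A)"
proof -
  note [measurable_cong] = laplace_transform_onD(1)[OF assms(1)]
  show ?thesis
    by (intro has_bochner_integral_nn_integral) (use laplace_transform_onD[OF assms(1)] assms(2) in auto)
qed

text \<open>The alternating difference of the exponential at B is exp (- (x \<bullet> B)) times the
  factors 1 - exp (- (h \<bullet> B)), which are nonnegative where h \<bullet> B \<ge> 0.\<close>

lemma alternating_laplace_transform:
  assumes g: "laplace_transform_on C \<mu> g"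
    and add: "\<And>x y. x \<in> C \<Longrightarrow> y \<in> C \<Longrightarrow> x + y \<in> C"
    and pos: "AE B in \<mu>. \<forall>A\<in>C. 0 \<le> A \<bullet> B"
  shows "alternating C g"
  unfolding alternating_def
proof (intro allI impI)
  fix hs x assume hs: "set hs \<subseteq> C" and x: "x \<in> C"
  have int: "has_bochner_integral \<mu> (\<lambda>B. alt_diff hs (\<lambda>A. exp (- (A \<bullet> B))) x) (alt_diff hs g x)"
    using hs x
  proof (induction hs arbitrary: x)
    case Nil
    then show ?case using laplace_transform_on_integral[OF g] by simp
  next
    case (Cons h hs)
    then show ?case using add by (auto intro!: has_bochner_integral_diff)
  qed
  have eq: "alt_diff hs (\<lambda>A. exp (- (A \<bullet> B))) y = exp (- (y \<bullet> B)) * (\<Prod>h\<leftarrow>hs. 1 - exp (- (h \<bullet> B)))" for B y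
  proof (induction hs arbitrary: y)
    case (Cons h hs)
    have "exp (- ((y + h) \<bullet> B)) = exp (- (y \<bullet> B)) * exp (- (h \<bullet> B))"
      by (simp add: inner_add_left flip: exp_add)
    then show ?case by (simp add: Cons algebra_simps)
  qed auto
  have "0 \<le> (\<Prod>h\<leftarrow>hs. 1 - exp (- (h \<bullet> B)))" if "\<forall>A\<in>C. 0 \<le> A \<bullet> B" for B
    using hs that by (induction hs) auto
  then have "AE B in \<mu>. 0 \<le> alt_diff hs (\<lambda>A. exp (- (A \<bullet> B))) x"
    using pos by (auto elim!: eventually_mono simp: eq)
  then show "0 \<le> alt_diff hs g x"
    using int has_bochner_integral_integral_eq integral_nonneg_AE by metis
qed

section \<open>Sigma-finiteness, point masses and convolution\<close>

lemma sigma_finite_measureI_nn_integral: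
  fixes h :: "'a \<Rightarrow> real"
  assumes h[measurable]: "h \<in> borel_measurable M" and pos: "\<And>x. x \<in> space M \<Longrightarrow> h x > 0"
    and fin: "(\<integral>\<^sup>+x. ennreal (h x) \<partial>M) < \<infinity>"
  shows "sigma_finite_measure M"
proof
  let ?A = "\<lambda>n. {x \<in> space M. 1 / real (Suc n) \<le> h x}"
  have "emeasure M (?A n) < \<infinity>" for n
  proof -
    have "emeasure M (?A n) \<le> ennreal (real (Suc n)) * (\<integral>\<^sup>+x\<in>space M. ennreal (h x) \<partial>M)"
    proof (rule order_trans[OF emeasure_mono nn_integral_Markov_inequality])
      show "?A n \<subseteq> {x \<in> space M. 1 \<le> ennreal (real (Suc n)) * ennreal (h x)}"
      proof
        fix x assume x: "x \<in> ?A n"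
        then have "1 \<le> real (Suc n) * h x" by (simp add: field_simps)
        then have "1 \<le> ennreal (real (Suc n) * h x)" by (simp only: ennreal_ge_1)
        then show "x \<in> {x \<in> space M. 1 \<le> ennreal (real (Suc n)) * ennreal (h x)}"
          using x by (simp only: ennreal_mult' of_nat_0_le_iff) simp
      qed
    qed auto
    also have "\<dots> < \<infinity>"
    proof -
      have "(\<integral>\<^sup>+x\<in>space M. ennreal (h x) \<partial>M) = (\<integral>\<^sup>+x. ennreal (h x) \<partial>M)"
        by (intro nn_integral_cong) auto
      then show ?thesis using fin by (simp add: ennreal_mult_less_top)
    qed
    finally show ?thesis .
  qed
  moreover have "(\<Union>n. ?A n) = space M"
  proof -
    have "\<exists>n. 1 / real (Suc n) \<le> h x" if "x \<in> space M" for x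
      using reals_Archimedean[OF pos[OF that]] by (metis inverse_eq_divide less_imp_le)
    then show ?thesis by blast
  qed
  ultimately show "\<exists>A. countable A \<and> A \<subseteq> sets M \<and> \<Union> A = space M \<and> (\<forall>a\<in>A. emeasure M a \<noteq> \<infinity>)"
    by (intro exI[of _ "range ?A"]) (auto simp: less_top[symmetric])
qed

lemma laplace_transform_on_sigma_finite:
  assumes g: "laplace_transform_on C \<mu> g" and A: "A \<in> C"
  shows "sigma_finite_measure \<mu>"
proof -
  note [measurable_cong] = laplace_transform_onD(1)[OF g]
  show ?thesis
    by (rule sigma_finite_measureI_nn_integral[where h = "\<lambda>B. exp (- (A \<bullet> B))"])
       (use laplace_transform_onD[OF g] A in auto)
qed

context sigma_finite_measure
begin

lemma AE_pair_fst:
  assumes "AE x in N. P x"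
  shows "AE z in N \<Otimes>\<^sub>M M. P (fst z)"
proof -
  obtain X where X: "X \<in> null_sets N" "{x \<in> space N. \<not> P x} \<subseteq> X"
    using assms by (auto simp: eventually_ae_filter)
  have "emeasure (N \<Otimes>\<^sub>M M) (X \<times> space M) = 0"
    using X by (subst emeasure_pair_measure_Times) auto
  then show ?thesis
    by (intro AE_I[of _ _ "X \<times> space M"]) (use X in \<open>auto simp: space_pair_measure\<close>)
qed

lemma AE_pair_snd:
  assumes "AE x in M. P x"
  shows "AE z in N \<Otimes>\<^sub>M M. P (snd z)"
proof -
  obtain X where X: "X \<in> null_sets M" "{x \<in> space M. \<not> P x} \<subseteq> X"
    using assms by (auto simp: eventually_ae_filter)
  have "emeasure (N \<Otimes>\<^sub>M M) (space N \<times> X) = 0"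
    using X by (subst emeasure_pair_measure_Times) auto
  then show ?thesis
    by (intro AE_I[of _ _ "space N \<times> X"]) (use X in \<open>auto simp: space_pair_measure\<close>)
qed

end

lemma laplace_transform_on_cong:
  assumes "laplace_transform_on C \<mu> f" "\<And>A. A \<in> C \<Longrightarrow> f A = g A"
  shows "laplace_transform_on C \<mu> g"
  using assms by (simp add: laplace_transform_on_def)

definition dirac :: "'a::topological_space \<Rightarrow> 'a measure" where
  "dirac x = distr (count_space {x}) borel (\<lambda>y. y)"

lemma sets_dirac [simp]: "sets (dirac x) = sets borel"
  by (simp add: dirac_def)

lemma nn_integral_dirac:
  assumes "f \<in> borel_measurable borel"
  shows "(\<integral>\<^sup>+y. f y \<partial>dirac x) = f x"
  unfolding dirac_def using assms
  by (subst nn_integral_distr) (auto simp: nn_integral_count_space_finite)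

lemma AE_dirac: "{y. P y} \<in> sets borel \<Longrightarrow> P x \<Longrightarrow> AE y in dirac x. P y"
  unfolding dirac_def by (subst AE_distr_iff) (auto simp: AE_count_space)

lemma laplace_transform_on_dirac: "laplace_transform_on C (dirac 0) (\<lambda>_. 1)"
  by (auto simp: laplace_transform_on_def nn_integral_dirac)

text \<open>Absorbs Gaussian and Gamma factors into the measure.\<close>

lemma laplace_transform_on_scale:
  assumes f: "laplace_transform_on C \<mu> (\<lambda>A. c * f A)" and c: "c > 0" and P: "AE B in \<mu>. P B"
  obtains \<nu> where "laplace_transform_on C \<nu> f" "AE B in \<nu>. P B"
proof -
  note [measurable_cong] = laplace_transform_onD(1)[OF f]
  define \<nu> where "\<nu> = density \<mu> (\<lambda>_. ennreal (1 / c))"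
  have "(\<integral>\<^sup>+B. ennreal (exp (- (A \<bullet> B))) \<partial>\<nu>) = ennreal (f A)" "0 \<le> f A" if "A \<in> C" for A
  proof -
    have "0 \<le> c * f A" using laplace_transform_onD(2)[OF f that] .
    then show 0: "0 \<le> f A" using c by (simp add: zero_le_mult_iff)
    have "(\<integral>\<^sup>+B. ennreal (exp (- (A \<bullet> B))) \<partial>\<nu>) = ennreal (1 / c) * ennreal (c * f A)"
      unfolding \<nu>_def using laplace_transform_onD(3)[OF f that]
      by (simp add: nn_integral_density nn_integral_cmult)
    also have "\<dots> = ennreal (f A)" using c 0 by (simp flip: ennreal_mult')
    finally show "(\<integral>\<^sup>+B. ennreal (exp (- (A \<bullet> B))) \<partial>\<nu>) = ennreal (f A)" .
  qed
  then have "laplace_transform_on C \<nu> f"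
    using laplace_transform_onD(1)[OF f] by (auto simp: laplace_transform_on_def \<nu>_def)
  moreover have "AE B in \<nu>. P B"
    unfolding \<nu>_def using P by (subst AE_density) (auto elim!: eventually_mono)
  ultimately show ?thesis by (rule that)
qed

text \<open>\<rho> is the convolution. The predicates P, Q, R record where the measures live, and
  the point A0 yields the sigma-finiteness needed for Fubini.\<close>

lemma laplace_transform_on_mult:
  fixes C :: "'a::euclidean_space set"
  assumes f: "laplace_transform_on C \<mu> f" and g: "laplace_transform_on C \<nu> g" and C: "A0 \<in> C"
    and P: "AE x in \<mu>. P x" and Q: "AE y in \<nu>. Q y"
    and PQ: "\<And>x y. P x \<Longrightarrow> Q y \<Longrightarrow> R (x + y)" and R: "{x. R x} \<in> sets borel"
  obtains \<rho> where "laplace_transform_on C \<rho> (\<lambda>A. f A * g A)" "AE x in \<rho>. R x"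
proof -
  interpret m: sigma_finite_measure \<mu> by (rule laplace_transform_on_sigma_finite[OF f C])
  interpret n: sigma_finite_measure \<nu> by (rule laplace_transform_on_sigma_finite[OF g C])
  interpret mn: pair_sigma_finite \<mu> \<nu> ..
  note [measurable_cong] = laplace_transform_onD(1)[OF f] laplace_transform_onD(1)[OF g]
  define \<rho> where "\<rho> = distr (\<mu> \<Otimes>\<^sub>M \<nu>) borel (\<lambda>(x, y). x + y)"
  have "(\<integral>\<^sup>+B. ennreal (exp (- (A \<bullet> B))) \<partial>\<rho>) = ennreal (f A * g A)" if "A \<in> C" for A
  proof -
    have "(\<integral>\<^sup>+B. ennreal (exp (- (A \<bullet> B))) \<partial>\<rho>)
        = (\<integral>\<^sup>+z. ennreal (exp (- (A \<bullet> fst z))) * ennreal (exp (- (A \<bullet> snd z))) \<partial>(\<mu> \<Otimes>\<^sub>M \<nu>))"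
      unfolding \<rho>_def
      by (subst nn_integral_distr)
         (auto simp: case_prod_unfold inner_add_right exp_add exp_diff exp_minus field_simps ennreal_mult'[symmetric] intro!: nn_integral_cong)
    also have "\<dots> = (\<integral>\<^sup>+x. \<integral>\<^sup>+y. ennreal (exp (- (A \<bullet> x))) * ennreal (exp (- (A \<bullet> y))) \<partial>\<nu> \<partial>\<mu>)"
      by (subst n.nn_integral_fst[symmetric]) auto
    also have "\<dots> = ennreal (f A) * ennreal (g A)"
      using laplace_transform_onD(3)[OF f that] laplace_transform_onD(3)[OF g that]
      by (simp add: nn_integral_cmult nn_integral_multc)
    finally show ?thesis
      using laplace_transform_onD(2)[OF f that] by (simp add: ennreal_mult')
  qed
  then have 1: "laplace_transform_on C \<rho> (\<lambda>A. f A * g A)"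
    using laplace_transform_onD(2)[OF f] laplace_transform_onD(2)[OF g]
    by (auto simp: laplace_transform_on_def \<rho>_def)
  have "AE z in \<mu> \<Otimes>\<^sub>M \<nu>. P (fst z)" by (rule n.AE_pair_fst[OF P])
  moreover have "AE z in \<mu> \<Otimes>\<^sub>M \<nu>. Q (snd z)" by (rule n.AE_pair_snd[OF Q])
  ultimately have "AE z in \<mu> \<Otimes>\<^sub>M \<nu>. R (fst z + snd z)"
    by eventually_elim (rule PQ)
  then have "AE x in \<rho>. R x"
    unfolding \<rho>_def by (subst AE_distr_iff) (use R in \<open>auto simp: case_prod_unfold\<close>)
  with 1 that show ?thesis by blast
qed

section \<open>Measures concentrated on a variety\<close>

lemma gamma_laplace:
  fixes c \<kappa> :: real
  assumes c: "c > 0" and \<kappa>: "\<kappa> > 0"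
  shows "(\<integral>\<^sup>+s. ennreal (indicator {0<..} s * s powr (\<kappa> - 1) * exp (- (c * s))) \<partial>lborel)
    = ennreal (Gamma \<kappa> * c powr (- \<kappa>))"
proof -
  let ?f = "\<lambda>s::real. ennreal (indicator {0..} s * s powr (\<kappa> - 1) / exp s)"
  have "ennreal (Gamma \<kappa>) = (\<integral>\<^sup>+s. ?f s \<partial>lborel)"
    by (rule Gamma_conv_nn_integral_real[OF \<kappa>])
  also have "\<dots> = ennreal \<bar>c\<bar> * (\<integral>\<^sup>+s. ?f (0 + c * s) \<partial>lborel)"
    by (rule nn_integral_real_affine) (use c in auto)
  also have "\<dots> = (\<integral>\<^sup>+s. ennreal \<bar>c\<bar> * ?f (0 + c * s) \<partial>lborel)"
    by (rule nn_integral_cmult[symmetric]) auto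
  also have "\<dots> = (\<integral>\<^sup>+s. ennreal (c powr \<kappa>) *
      ennreal (indicator {0<..} s * s powr (\<kappa> - 1) * exp (- (c * s))) \<partial>lborel)"
  proof (rule nn_integral_cong)
    fix s :: real
    consider "s < 0" | "s = 0" | "s > 0" by linarith
    then show "ennreal \<bar>c\<bar> * ?f (0 + c * s) = ennreal (c powr \<kappa>) *
      ennreal (indicator {0<..} s * s powr (\<kappa> - 1) * exp (- (c * s)))"
    proof cases
      case 1
      then have "c * s < 0" using c by (simp add: mult_pos_neg)
      with 1 show ?thesis by simp
    next
      case 3
      have "c * (c * s) powr (\<kappa> - 1) = c powr \<kappa> * s powr (\<kappa> - 1)"
        using c 3 by (simp add: powr_mult powr_diff)
      then have "c * ((c * s) powr (\<kappa> - 1) / exp (c * s)) = c powr \<kappa> * (s powr (\<kappa> - 1) * exp (- (c * s)))"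
        by (simp add: exp_minus field_simps)
      with 3 c show ?thesis
        by (simp add: indicator_def flip: ennreal_mult')
    qed simp
  qed
  also have "\<dots> = ennreal (c powr \<kappa>) *
      (\<integral>\<^sup>+s. ennreal (indicator {0<..} s * s powr (\<kappa> - 1) * exp (- (c * s))) \<partial>lborel)"
    by (rule nn_integral_cmult) auto
  finally have "ennreal (c powr - \<kappa>) * ennreal (Gamma \<kappa>) = ennreal (c powr - \<kappa>) * (ennreal (c powr \<kappa>) *
      (\<integral>\<^sup>+s. ennreal (indicator {0<..} s * s powr (\<kappa> - 1) * exp (- (c * s))) \<partial>lborel))"
    by simp
  then show ?thesis
    using c by (simp add: mult.assoc[symmetric] ennreal_mult'[symmetric] powr_add[symmetric] mult.commute[of _ "Gamma \<kappa>"])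
qed

lemma gamma_laplace_integral:
  fixes c \<kappa> :: real
  assumes "c > 0" "\<kappa> > 0"
  shows "has_bochner_integral lborel
    (\<lambda>s. indicator {0<..} s * s powr (\<kappa> - 1) * exp (- (c * s))) (Gamma \<kappa> * c powr (- \<kappa>))"
  by (rule has_bochner_integral_nn_integral)
     (use gamma_laplace[OF assms] assms in \<open>auto simp: Gamma_real_pos less_imp_le\<close>)

text \<open>For \<kappa> < 1 the quotient of (s - t) powr (\<kappa> - 1) by s powr (\<kappa> - 1) is
  unbounded near s = t, so only an average over t can be bounded. The constant adds up the cases: 2
  / \<kappa> for s \<le> 2; for s > 2 the quotient is at most 1 if \<kappa> \<ge> 1, and otherwise
  at most 2 powr (1 - \<kappa>), because s - t \<ge> s / 2.\<close>

lemma powr_average_bound: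
  fixes s \<kappa> :: real
  assumes s: "s > 0" and \<kappa>: "\<kappa> > 0"
  shows "(\<integral>\<^sup>+t. ennreal (indicator {0<..<1} t * (indicator {0<..} (s - t) * (s - t) powr (\<kappa> - 1))) \<partial>lborel)
    \<le> ennreal ((2 / \<kappa> + 1 + 2 powr (1 - \<kappa>)) * s powr (\<kappa> - 1))"
proof (cases "s \<le> 2")
  case True
  have "(\<integral>\<^sup>+t. ennreal (indicator {0<..<1} t * (indicator {0<..} (s - t) * (s - t) powr (\<kappa> - 1))) \<partial>lborel)
      \<le> (\<integral>\<^sup>+t. ennreal (indicator {0..s} (s - t) * (s - t) powr (\<kappa> - 1)) \<partial>lborel)"
    by (intro nn_integral_mono ennreal_leI) (auto simp: indicator_def)
  also have "\<dots> = (\<integral>\<^sup>+u. ennreal (indicator {0..s} u * u powr (\<kappa> - 1)) \<partial>lborel)"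
    using nn_integral_real_affine[of "\<lambda>u. ennreal (indicator {0..s} u * u powr (\<kappa> - 1))" "-1" s] by simp
  also have "\<dots> = ennreal (s powr \<kappa> / \<kappa>)"
  proof -
    have "((\<lambda>u. u powr (\<kappa> - 1)) has_integral (s powr \<kappa> / \<kappa>)) {0..s}"
      using has_integral_powr_from_0[of "\<kappa> - 1" s] \<kappa> s by simp
    from nn_integral_has_integral_lebesgue[OF _ this] show ?thesis by simp
  qed
  also have "\<dots> \<le> ennreal ((2 / \<kappa> + 1 + 2 powr (1 - \<kappa>)) * s powr (\<kappa> - 1))"
  proof (rule ennreal_leI)
    have "s powr \<kappa> = s * s powr (\<kappa> - 1)" using s by (simp add: powr_diff)
    also have "\<dots> \<le> 2 * s powr (\<kappa> - 1)" using True by (intro mult_right_mono) auto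
    finally have "s powr \<kappa> / \<kappa> \<le> (2 / \<kappa>) * s powr (\<kappa> - 1)"
      using \<kappa> by (simp add: divide_right_mono)
    also have "\<dots> \<le> (2 / \<kappa> + 1 + 2 powr (1 - \<kappa>)) * s powr (\<kappa> - 1)"
      by (intro mult_right_mono) auto
    finally show "s powr \<kappa> / \<kappa> \<le> (2 / \<kappa> + 1 + 2 powr (1 - \<kappa>)) * s powr (\<kappa> - 1)" .
  qed
  finally show ?thesis .
next
  case False
  have "(s - t) powr (\<kappa> - 1) \<le> (2 / \<kappa> + 1 + 2 powr (1 - \<kappa>)) * s powr (\<kappa> - 1)" if t: "0 < t" "t < 1" for t
  proof (cases "\<kappa> \<ge> 1")
    case True
    have "(s - t) powr (\<kappa> - 1) \<le> 1 * s powr (\<kappa> - 1)"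
      using True False t by (simp, intro powr_mono2) auto
    also have "\<dots> \<le> (2 / \<kappa> + 1 + 2 powr (1 - \<kappa>)) * s powr (\<kappa> - 1)"
      using \<kappa> by (intro mult_right_mono) (auto simp: add_nonneg_nonneg)
    finally show ?thesis .
  next
    case k: False
    have "(s - t) powr (\<kappa> - 1) \<le> (s / 2) powr (\<kappa> - 1)"
      using k False t by (intro powr_mono2') auto
    also have "\<dots> = 2 powr (1 - \<kappa>) * s powr (\<kappa> - 1)"
      using s by (simp add: powr_divide powr_diff)
    also have "\<dots> \<le> (2 / \<kappa> + 1 + 2 powr (1 - \<kappa>)) * s powr (\<kappa> - 1)"
      using \<kappa> by (intro mult_right_mono) auto
    finally show ?thesis .
  qed
  then have "(\<integral>\<^sup>+t. ennreal (indicator {0<..<1} t * (indicator {0<..} (s - t) * (s - t) powr (\<kappa> - 1))) \<partial>lborel)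
      \<le> (\<integral>\<^sup>+t. ennreal ((2 / \<kappa> + 1 + 2 powr (1 - \<kappa>)) * s powr (\<kappa> - 1)) * indicator {0<..<1} (t::real) \<partial>lborel)"
    using s by (intro nn_integral_mono) (auto simp: indicator_def intro!: ennreal_leI)
  also have "\<dots> = ennreal ((2 / \<kappa> + 1 + 2 powr (1 - \<kappa>)) * s powr (\<kappa> - 1))"
    by (subst nn_integral_cmult_indicator) auto
  finally show ?thesis .
qed

lemma exp_sum_nth: "exp_sum xs B = (\<Sum>i<length xs. fst (xs ! i) * exp (- (snd (xs ! i) \<bullet> B)))"
  by (simp add: exp_sum_def sum_list_sum_nth atLeast0LessThan case_prod_beta)

lemma measurable_exp_sum [measurable]: "exp_sum xs \<in> borel_measurable (borel :: 'a::euclidean_space measure)"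
  unfolding exp_sum_nth[abs_def] by measurable

text \<open>Positive definiteness of \<open>F\<close> is that of \<open>(z \<bullet> e) powr \<kappa> * g z\<close>, and multiplying a positive
  definite function by \<open>exp (- s * (z \<bullet> e))\<close> keeps it positive definite. Averaging over \<open>s\<close> turns
  \<open>(z \<bullet> e) powr \<kappa>\<close> into a convolution of \<open>\<mu>\<close> with a measure on the ray through \<open>e\<close>.\<close>

lemma exp_sum_average_le:
  fixes U :: "'a::euclidean_space set"
  assumes U: "subspace U" "E \<in> U" and \<kappa>: "\<kappa> > 0"
    and pos: "\<And>z. z \<in> U \<Longrightarrow> norm (z - E) < 2 * r \<Longrightarrow> 0 < z \<bullet> e"
    and F: "\<And>z. z \<in> U \<Longrightarrow> norm (z - E) < 2 * r \<Longrightarrow> F z = (z \<bullet> e) powr \<kappa> * g z"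
    and lap: "laplace_transform_on {z \<in> U. norm (z - E) < 2 * r} \<mu> g"
    and PD: "\<And>n c z. (\<And>i. i < n \<Longrightarrow> z i \<in> U \<and> norm (z i - (1/2) *\<^sub>R E) < r) \<Longrightarrow>
        0 \<le> (\<Sum>i<(n::nat). \<Sum>j<n. c i * c j * F (z i + z j))"
    and xs: "exponents_in U r xs" and r: "r > 0"
  shows "(\<integral>\<^sup>+t. indicator {0<..<1} t *
        (\<integral>\<^sup>+B. ennreal (exp (- (E \<bullet> (B + t *\<^sub>R e))) * (exp_sum xs (B + t *\<^sub>R e))\<^sup>2) \<partial>\<mu>) \<partial>lborel)
    \<le> ennreal (2 / \<kappa> + 1 + 2 powr (1 - \<kappa>)) *
        (\<integral>\<^sup>+B. ennreal (exp (- (E \<bullet> B)) * (exp_sum xs B)\<^sup>2) \<partial>\<mu>)"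
proof -
  note [measurable_cong] = laplace_transform_onD(1)[OF lap]
  define n where "n = length xs"
  define c where "c i = fst (xs ! i)" for i
  \<comment> \<open>Centring at E / 2 makes z i + z j equal to E plus two exponents, so the double
    sum of exponentials is exp (- (E \<bullet> B)) times the square of the exponential sum.\<close>
  define z where "z i = (1/2) *\<^sub>R E + snd (xs ! i)" for i
  define w where "w i j = (z i + z j) \<bullet> e" for i j
  have z: "z i \<in> U \<and> norm (z i - (1/2) *\<^sub>R E) < r" if "i < n" for i
  proof -
    have "xs ! i \<in> set xs" using that by (auto simp: n_def)
    then have "snd (xs ! i) \<in> U" "norm (snd (xs ! i)) < r"
      using xs by (auto simp: exponents_in_def case_prod_beta)
    then show ?thesis using U by (auto simp: z_def intro: subspace_add subspace_scale)
  qed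
  have zz: "z i + z j \<in> U" "norm (z i + z j - E) < 2 * r" if "i < n" "j < n" for i j
  proof -
    show "z i + z j \<in> U" using z that U by (auto intro: subspace_add)
    have "z i + z j - E = (z i - (1/2) *\<^sub>R E) + (z j - (1/2) *\<^sub>R E)"
      by (simp add: algebra_simps flip: scaleR_add_left)
    then have "norm (z i + z j - E) \<le> norm (z i - (1/2) *\<^sub>R E) + norm (z j - (1/2) *\<^sub>R E)"
      using norm_triangle_ineq by metis
    also have "\<dots> < 2 * r" using z that by (smt (verit))
    finally show "norm (z i + z j - E) < 2 * r" .
  qed
  have w: "w i j > 0" if "i < n" "j < n" for i j
    unfolding w_def by (intro pos zz that)
  define G where "G i j = g (z i + z j)" for i j
  have FG: "F (z i + z j) = w i j powr \<kappa> * G i j" if "i < n" "j < n" for i j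
    unfolding w_def G_def by (intro F zz that)
  \<comment> \<open>The quadratic form of F with the coefficients c i * exp (- s * (z i \<bullet>
    e)), hence nonnegative.\<close>
  define H where "H s = (\<Sum>i<n. \<Sum>j<n. c i * c j * (exp (- (w i j * s)) * (w i j powr \<kappa> * G i j)))" for s
  have H0: "0 \<le> H s" for s
  proof -
    have "0 \<le> (\<Sum>i<n. \<Sum>j<n. (c i * exp (- (s * (z i \<bullet> e)))) * (c j * exp (- (s * (z j \<bullet> e)))) * F (z i + z j))"
      by (rule PD) (rule z)
    also have "\<dots> = H s"
      unfolding H_def
    proof (intro sum.cong refl)
      fix i j assume "i \<in> {..<n}" "j \<in> {..<n}"
      then have "F (z i + z j) = w i j powr \<kappa> * G i j" by (simp add: FG)
      moreover have "exp (- (w i j * s)) = exp (- (s * (z i \<bullet> e))) * exp (- (s * (z j \<bullet> e)))"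
        by (simp add: w_def inner_add_left algebra_simps flip: exp_add)
      ultimately show "(c i * exp (- (s * (z i \<bullet> e)))) * (c j * exp (- (s * (z j \<bullet> e)))) * F (z i + z j)
          = c i * c j * (exp (- (w i j * s)) * (w i j powr \<kappa> * G i j))"
        by (simp add: ac_simps)
    qed
    finally show ?thesis .
  qed
  have [measurable]: "H \<in> borel_measurable borel" unfolding H_def[abs_def] by measurable
  \<comment> \<open>The squared norm of the exponential sum with respect to \<mu> moved by t
    e.\<close>
  define \<Phi> where "\<Phi> t = (\<Sum>i<n. \<Sum>j<n. c i * c j * (exp (- (w i j * t)) * G i j))" for t
  let ?q = "\<lambda>t B. exp (- (E \<bullet> (B + t *\<^sub>R e))) * (exp_sum xs (B + t *\<^sub>R e))\<^sup>2"
  have q: "?q t B = (\<Sum>i<n. \<Sum>j<n. c i * c j * (exp (- (w i j * t)) * exp (- ((z i + z j) \<bullet> B))))" for t B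
  proof -
    have "?q t B = exp (- (E \<bullet> (B + t *\<^sub>R e))) *
        (\<Sum>i<n. \<Sum>j<n. (c i * exp (- (snd (xs ! i) \<bullet> (B + t *\<^sub>R e)))) * (c j * exp (- (snd (xs ! j) \<bullet> (B + t *\<^sub>R e)))))"
      by (simp add: exp_sum_nth power2_eq_square sum_product c_def n_def)
    also have "\<dots> = (\<Sum>i<n. \<Sum>j<n. c i * c j * (exp (- (w i j * t)) * exp (- ((z i + z j) \<bullet> B))))"
      unfolding sum_distrib_left
    proof (intro sum.cong refl)
      fix i j
      have "z i + z j = E + (snd (xs ! i) + snd (xs ! j))"
        by (simp add: z_def algebra_simps flip: scaleR_add_left)
      then have "exp (- (w i j * t)) * exp (- ((z i + z j) \<bullet> B)) = exp (- (E \<bullet> (B + t *\<^sub>R e))) *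
          (exp (- (snd (xs ! i) \<bullet> (B + t *\<^sub>R e))) * exp (- (snd (xs ! j) \<bullet> (B + t *\<^sub>R e))))"
        by (simp add: w_def inner_add_left inner_add_right algebra_simps flip: exp_add)
      then show "exp (- (E \<bullet> (B + t *\<^sub>R e))) * (c i * exp (- (snd (xs ! i) \<bullet> (B + t *\<^sub>R e))) * (c j * exp (- (snd (xs ! j) \<bullet> (B + t *\<^sub>R e)))))
        = c i * c j * (exp (- (w i j * t)) * exp (- ((z i + z j) \<bullet> B)))"
        by (simp add: ac_simps)
    qed
    finally show ?thesis .
  qed
  have intq: "has_bochner_integral \<mu> (?q t) (\<Phi> t)" for t
    unfolding q \<Phi>_def G_def
    by (intro has_bochner_integral_sum has_bochner_integral_mult_right
          laplace_transform_on_integral[OF lap]) (use zz in auto)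
  have nnq: "(\<integral>\<^sup>+B. ennreal (?q t B) \<partial>\<mu>) = ennreal (\<Phi> t)" for t
    using nn_integral_eq_integral[of \<mu> "?q t"] intq[of t] by (simp add: has_bochner_integral_iff)
  let ?k = "\<lambda>s::real. indicator {0<..} s * s powr (\<kappa> - 1)"
  \<comment> \<open>The Gamma integral in s produces \<open>w i j powr (- \<kappa>)\<close>, which
    cancels the power in F and leaves g.\<close>
  have intH: "has_bochner_integral lborel (\<lambda>s. ?k s * H (s + t)) (Gamma \<kappa> * \<Phi> t)" for t
  proof -
    have *: "has_bochner_integral lborel
       (\<lambda>s. \<Sum>i<n. \<Sum>j<n. (c i * c j * (exp (- (w i j * t)) * (w i j powr \<kappa> * G i j))) * (?k s * exp (- (w i j * s))))
       (\<Sum>i<n. \<Sum>j<n. (c i * c j * (exp (- (w i j * t)) * (w i j powr \<kappa> * G i j))) * (Gamma \<kappa> * w i j powr (- \<kappa>)))"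
      by (intro has_bochner_integral_sum has_bochner_integral_mult_right gamma_laplace_integral \<kappa>) (use w in auto)
    have 1: "(\<lambda>s. \<Sum>i<n. \<Sum>j<n. (c i * c j * (exp (- (w i j * t)) * (w i j powr \<kappa> * G i j))) * (?k s * exp (- (w i j * s))))
        = (\<lambda>s. ?k s * H (s + t))"
    proof
      fix s
      have "exp (- (w i j * t)) * exp (- (w i j * s)) = exp (- (w i j * (s + t)))" for i j
        by (simp add: algebra_simps flip: exp_add)
      then show "(\<Sum>i<n. \<Sum>j<n. (c i * c j * (exp (- (w i j * t)) * (w i j powr \<kappa> * G i j))) * (?k s * exp (- (w i j * s))))
          = ?k s * H (s + t)"
        unfolding H_def sum_distrib_left by (intro sum.cong refl) (simp add: ac_simps)
    qed
    have 2: "(\<Sum>i<n. \<Sum>j<n. (c i * c j * (exp (- (w i j * t)) * (w i j powr \<kappa> * G i j))) * (Gamma \<kappa> * w i j powr (- \<kappa>)))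
        = Gamma \<kappa> * \<Phi> t"
      unfolding \<Phi>_def sum_distrib_left
    proof (intro sum.cong refl)
      fix i j assume "i \<in> {..<n}" "j \<in> {..<n}"
      then have "w i j powr \<kappa> * w i j powr (- \<kappa>) = 1"
        using w[of i j] by (simp flip: powr_add)
      then show "(c i * c j * (exp (- (w i j * t)) * (w i j powr \<kappa> * G i j))) * (Gamma \<kappa> * w i j powr (- \<kappa>))
        = Gamma \<kappa> * (c i * c j * (exp (- (w i j * t)) * G i j))"
        by (simp add: ac_simps)
    qed
    from * show ?thesis unfolding 1 2 .
  qed
  have nnH: "(\<integral>\<^sup>+s. ennreal (?k s * H (s + t)) \<partial>lborel) = ennreal (Gamma \<kappa>) * ennreal (\<Phi> t)" for t
  proof -
    have "(\<integral>\<^sup>+s. ennreal (?k s * H (s + t)) \<partial>lborel) = ennreal (Gamma \<kappa> * \<Phi> t)"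
      using nn_integral_eq_integral[of lborel "\<lambda>s. ?k s * H (s + t)"] intH[of t] H0
      by (simp add: has_bochner_integral_iff)
    then show ?thesis using \<kappa> by (simp add: ennreal_mult' Gamma_real_pos less_imp_le)
  qed
  let ?M = "2 / \<kappa> + 1 + 2 powr (1 - \<kappa>)"
  have "(\<integral>\<^sup>+t. indicator {0<..<1} t * (ennreal (Gamma \<kappa>) * ennreal (\<Phi> t)) \<partial>lborel)
      = (\<integral>\<^sup>+t. \<integral>\<^sup>+s. ennreal (indicator {0<..<1} t * (?k (s - t) * H s)) \<partial>lborel \<partial>lborel)"
  proof (rule nn_integral_cong)
    fix t :: real
    have "ennreal (Gamma \<kappa>) * ennreal (\<Phi> t) = (\<integral>\<^sup>+s. ennreal (?k s * H (s + t)) \<partial>lborel)"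
      by (rule nnH[symmetric])
    also have "\<dots> = (\<integral>\<^sup>+s. ennreal (?k (s - t) * H s) \<partial>lborel)"
      using nn_integral_real_affine[of "\<lambda>s. ennreal (?k s * H (s + t))" 1 "- t"] by simp
    finally show "indicator {0<..<1} t * (ennreal (Gamma \<kappa>) * ennreal (\<Phi> t))
        = (\<integral>\<^sup>+s. ennreal (indicator {0<..<1} t * (?k (s - t) * H s)) \<partial>lborel)"
      by (simp add: indicator_def)
  qed
  \<comment> \<open>After the change of variable, t occurs only in the weight
    \<open>?k (s - t)\<close>; with the t-integral inside, the nonnegative \<open>H s\<close>
    factors out and \<open>powr_average_bound\<close> applies.\<close>
  also have "\<dots> = (\<integral>\<^sup>+s. \<integral>\<^sup>+t. ennreal (indicator {0<..<1} t * (?k (s - t) * H s)) \<partial>lborel \<partial>lborel)"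
    by (rule lborel_pair.Fubini') measurable
  also have "\<dots> \<le> (\<integral>\<^sup>+s. ennreal ?M * ennreal (?k s * H s) \<partial>lborel)"
  proof (rule nn_integral_mono)
    fix s :: real
    show "(\<integral>\<^sup>+t. ennreal (indicator {0<..<1} t * (?k (s - t) * H s)) \<partial>lborel) \<le> ennreal ?M * ennreal (?k s * H s)"
    proof (cases "s > 0")
      case True
      have "(\<integral>\<^sup>+t. ennreal (indicator {0<..<1} t * (?k (s - t) * H s)) \<partial>lborel)
          = (\<integral>\<^sup>+t. ennreal (indicator {0<..<1} t * ?k (s - t)) * ennreal (H s) \<partial>lborel)"
        using H0 by (intro nn_integral_cong) (simp only: mult.assoc[symmetric] ennreal_mult'')
      also have "\<dots> = (\<integral>\<^sup>+t. ennreal (indicator {0<..<1} t * ?k (s - t)) \<partial>lborel) * ennreal (H s)"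
        by (rule nn_integral_multc) measurable
      also have "\<dots> \<le> ennreal (?M * s powr (\<kappa> - 1)) * ennreal (H s)"
        by (intro mult_right_mono powr_average_bound True \<kappa>) auto
      also have "\<dots> = ennreal ?M * ennreal (?k s * H s)"
      proof -
        have "?k s = s powr (\<kappa> - 1)" using True by simp
        moreover have "0 \<le> s powr (\<kappa> - 1) * H s" using H0 by simp
        ultimately show ?thesis
          using H0[of s] by (simp only: ennreal_mult''[symmetric] mult.assoc)
      qed
      finally show ?thesis .
    next
      case False
      then have "(\<integral>\<^sup>+t. ennreal (indicator {0<..<1} t * (?k (s - t) * H s)) \<partial>lborel) = (\<integral>\<^sup>+t. 0 \<partial>(lborel::real measure))"
        by (intro nn_integral_cong) (auto simp: indicator_def)
      then show ?thesis by simp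
    qed
  qed
  also have "\<dots> = ennreal ?M * (ennreal (Gamma \<kappa>) * ennreal (\<Phi> 0))"
    using nnH[of 0] by (subst nn_integral_cmult) auto
  finally have *: "(\<integral>\<^sup>+t. indicator {0<..<1} t * (ennreal (Gamma \<kappa>) * ennreal (\<Phi> t)) \<partial>lborel)
      \<le> ennreal ?M * (ennreal (Gamma \<kappa>) * ennreal (\<Phi> 0))" .
  have [measurable]: "\<Phi> \<in> borel_measurable borel" unfolding \<Phi>_def[abs_def] by measurable
  have "ennreal (Gamma \<kappa>) * (\<integral>\<^sup>+t. indicator {0<..<1} t * ennreal (\<Phi> t) \<partial>lborel)
      \<le> ennreal (Gamma \<kappa>) * (ennreal ?M * ennreal (\<Phi> 0))"
  proof -
    have "ennreal (Gamma \<kappa>) * (\<integral>\<^sup>+t. indicator {0<..<1} t * ennreal (\<Phi> t) \<partial>lborel)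
        = (\<integral>\<^sup>+t. ennreal (Gamma \<kappa>) * (indicator {0<..<1} t * ennreal (\<Phi> t)) \<partial>lborel)"
      by (rule nn_integral_cmult[symmetric]) measurable
    also have "\<dots> = (\<integral>\<^sup>+t. indicator {0<..<1} t * (ennreal (Gamma \<kappa>) * ennreal (\<Phi> t)) \<partial>lborel)"
      by (intro nn_integral_cong mult.left_commute)
    finally show ?thesis
      using * by (simp only: mult.left_commute)
  qed
  then have "(\<integral>\<^sup>+t. indicator {0<..<1} t * ennreal (\<Phi> t) \<partial>lborel) \<le> ennreal ?M * ennreal (\<Phi> 0)"
    using \<kappa> Gamma_real_pos[OF \<kappa>] ennreal_mult_le_mult_iff[of "ennreal (Gamma \<kappa>)"] by simp
  moreover have "(\<integral>\<^sup>+B. ennreal (exp (- (E \<bullet> B)) * (exp_sum xs B)\<^sup>2) \<partial>\<mu>) = ennreal (\<Phi> 0)"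
    using nnq[of 0] by (simp only: scaleR_zero_left add_0_right)
  ultimately show ?thesis
    by (simp only: nnq)
qed

text \<open>P vanishes almost everywhere, so the norms of the exponential sums approximating P tend
  to 0. By \<open>exp_sum_average_le\<close> and Fatou, the weighted integral of the square of P (B
  + t e) over B then vanishes for almost every t in (0, 1), although P is nonzero at these points
  and \<mu> is not zero.\<close>

lemma no_positive_definite_power:
  fixes U :: "'a::euclidean_space set"
  assumes U: "subspace U" "E \<in> U" "e \<in> U" and \<kappa>: "\<kappa> > 0" and r: "r > 0"
    and pos: "\<And>z. z \<in> U \<Longrightarrow> norm (z - E) < 2 * r \<Longrightarrow> 0 < z \<bullet> e"
    and F: "\<And>z. z \<in> U \<Longrightarrow> norm (z - E) < 2 * r \<Longrightarrow> F z = (z \<bullet> e) powr \<kappa> * g z"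
    and lap: "laplace_transform_on {z \<in> U. norm (z - E) < 2 * r} \<mu> g"
    and half: "(\<integral>\<^sup>+B. ennreal (exp (- (((1/2) *\<^sub>R E) \<bullet> B))) \<partial>\<mu>) < \<infinity>"
    and PD: "\<And>n c z. (\<And>i. i < n \<Longrightarrow> z i \<in> U \<and> norm (z i - (1/2) *\<^sub>R E) < r) \<Longrightarrow>
        0 \<le> (\<Sum>i<(n::nat). \<Sum>j<n. c i * c j * F (z i + z j))"
    and supp: "AE B in \<mu>. B \<in> U \<and> norm B \<le> E \<bullet> B"
    and P: "real_polynomial_function P" "AE B in \<mu>. P B = 0" "AE B in \<mu>. \<forall>t>0. P (B + t *\<^sub>R e) \<noteq> 0"
    and nontriv: "emeasure \<mu> (space \<mu>) \<noteq> 0"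
  shows False
proof -
  note [measurable_cong] = laplace_transform_onD(1)[OF lap]
  interpret sigma_finite_measure \<mu>
    by (rule laplace_transform_on_sigma_finite[OF lap, of E]) (use U r in auto)
  have [measurable]: "P \<in> borel_measurable borel"
    using P(1) by (intro borel_measurable_continuous_onI)
      (simp add: continuous_on_polymonial_function real_polynomial_function_eq)
  from polynomial_exp_sums_approximate[OF P(1) U(1)]
  obtain X0 where "exp_sums_approximate U P X0" by blast
  note X0 = exp_sums_approximateD[OF this]
  \<comment> \<open>Squaring turns the rate 1/4 into 1/2. With norm B \<le> E \<bullet> B this
    leaves the dominating function exp (- (E \<bullet> B) / 2), integrable by
    \<open>half\<close>.\<close>
  obtain K where K: "K > 0" "\<forall>\<^sub>F n in sequentially. \<forall>B\<in>U. \<bar>exp_sum (X0 n) B\<bar> \<le> K * exp (1/4 * norm B)"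
    using X0(3)[of "1/4"] by auto
  obtain N where N: "\<And>n. n \<ge> N \<Longrightarrow> exponents_in U r (X0 n)"
    "\<And>n B. n \<ge> N \<Longrightarrow> B \<in> U \<Longrightarrow> \<bar>exp_sum (X0 n) B\<bar> \<le> K * exp (1/4 * norm B)"
    using eventually_conj[OF X0(1)[OF r] K(2)] unfolding eventually_sequentially by auto
  define X where "X n = X0 (n + N)" for n
  have X1: "exponents_in U r (X n)" for n by (simp add: X_def N)
  have X2: "(\<lambda>n. exp_sum (X n) B) \<longlonglongrightarrow> P B" if "B \<in> U" for B
    unfolding X_def using X0(2)[OF that] by (rule LIMSEQ_ignore_initial_segment)
  have X3: "\<bar>exp_sum (X n) B\<bar> \<le> K * exp (1/4 * norm B)" if "B \<in> U" for n B
    unfolding X_def by (intro N that) simp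
  let ?M = "2 / \<kappa> + 1 + 2 powr (1 - \<kappa>)"
  let ?R = "\<lambda>n. \<integral>\<^sup>+B. ennreal (exp (- (E \<bullet> B)) * (exp_sum (X n) B)\<^sup>2) \<partial>\<mu>"
  let ?L = "\<lambda>n t. \<integral>\<^sup>+B. ennreal (exp (- (E \<bullet> (B + t *\<^sub>R e))) * (exp_sum (X n) (B + t *\<^sub>R e))\<^sup>2) \<partial>\<mu>"
  let ?J = "\<lambda>t. \<integral>\<^sup>+B. ennreal (exp (- (E \<bullet> (B + t *\<^sub>R e))) * (P (B + t *\<^sub>R e))\<^sup>2) \<partial>\<mu>"
  have "?R \<longlonglongrightarrow> (\<integral>\<^sup>+B. ennreal (exp (- (E \<bullet> B)) * (P B)\<^sup>2) \<partial>\<mu>)"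
  proof (rule nn_integral_dominated_convergence[where w = "\<lambda>B. ennreal (K\<^sup>2) * ennreal (exp (- (((1/2) *\<^sub>R E) \<bullet> B)))"])
    show "AE B in \<mu>. ennreal (exp (- (E \<bullet> B)) * (exp_sum (X n) B)\<^sup>2)
        \<le> ennreal (K\<^sup>2) * ennreal (exp (- (((1/2) *\<^sub>R E) \<bullet> B)))" for n
      using supp
    proof eventually_elim
      case (elim B)
      have "(exp_sum (X n) B)\<^sup>2 \<le> (K * exp (1/4 * norm B))\<^sup>2"
        using X3[of B n] elim by (metis abs_ge_zero power2_abs power_mono)
      also have "\<dots> = K\<^sup>2 * exp (1/2 * norm B)"
        by (simp add: power_mult_distrib power2_eq_square flip: exp_add)
      also have "\<dots> \<le> K\<^sup>2 * exp (1/2 * (E \<bullet> B))"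
        using elim by (intro mult_left_mono) auto
      finally have "exp (- (E \<bullet> B)) * (exp_sum (X n) B)\<^sup>2 \<le> exp (- (E \<bullet> B)) * (K\<^sup>2 * exp (1/2 * (E \<bullet> B)))"
        by (intro mult_left_mono) auto
      also have "\<dots> = K\<^sup>2 * exp (- (((1/2) *\<^sub>R E) \<bullet> B))"
        by (simp add: algebra_simps flip: exp_add)
      finally show ?case by (simp add: ennreal_leI flip: ennreal_mult')
    qed
    show "(\<integral>\<^sup>+B. ennreal (K\<^sup>2) * ennreal (exp (- (((1/2) *\<^sub>R E) \<bullet> B))) \<partial>\<mu>) < \<infinity>"
      using half by (subst nn_integral_cmult) (auto simp: ennreal_mult_less_top)
    show "AE B in \<mu>. (\<lambda>n. ennreal (exp (- (E \<bullet> B)) * (exp_sum (X n) B)\<^sup>2))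
        \<longlonglongrightarrow> ennreal (exp (- (E \<bullet> B)) * (P B)\<^sup>2)"
      using supp by eventually_elim (intro tendsto_intros X2, auto)
  qed measurable
  moreover have "(\<integral>\<^sup>+B. ennreal (exp (- (E \<bullet> B)) * (P B)\<^sup>2) \<partial>\<mu>) = 0"
    using P(2) by (subst nn_integral_0_iff_AE) (auto elim!: eventually_mono)
  ultimately have R: "?R \<longlonglongrightarrow> 0" by simp
  \<comment> \<open>Fatou's lemma is used twice, in B for fixed t and then in t.\<close>
  have "(\<integral>\<^sup>+t. indicator {0<..<1} t * ?J t \<partial>lborel)
      \<le> (\<integral>\<^sup>+t. liminf (\<lambda>n. indicator {0<..<1} t * ?L n t) \<partial>lborel)"
  proof (rule nn_integral_mono)
    fix t :: real
    have "?J t \<le> (\<integral>\<^sup>+B. liminf (\<lambda>n. ennreal (exp (- (E \<bullet> (B + t *\<^sub>R e))) * (exp_sum (X n) (B + t *\<^sub>R e))\<^sup>2)) \<partial>\<mu>)"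
    proof (rule nn_integral_mono_AE)
      show "AE B in \<mu>. ennreal (exp (- (E \<bullet> (B + t *\<^sub>R e))) * (P (B + t *\<^sub>R e))\<^sup>2)
          \<le> liminf (\<lambda>n. ennreal (exp (- (E \<bullet> (B + t *\<^sub>R e))) * (exp_sum (X n) (B + t *\<^sub>R e))\<^sup>2))"
        using supp
      proof eventually_elim
        case (elim B)
        have "B + t *\<^sub>R e \<in> U" using elim U by (auto intro: subspace_add subspace_scale)
        then have "(\<lambda>n. ennreal (exp (- (E \<bullet> (B + t *\<^sub>R e))) * (exp_sum (X n) (B + t *\<^sub>R e))\<^sup>2))
          \<longlonglongrightarrow> ennreal (exp (- (E \<bullet> (B + t *\<^sub>R e))) * (P (B + t *\<^sub>R e))\<^sup>2)"
          by (intro tendsto_ennrealI tendsto_mult tendsto_const tendsto_power X2)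
        from lim_imp_Liminf[OF sequentially_bot this] show ?case by (rule eq_refl[OF sym])
      qed
    qed
    also have "\<dots> \<le> liminf (\<lambda>n. ?L n t)"
      by (rule nn_integral_liminf) measurable
    finally show "indicator {0<..<1} t * ?J t \<le> liminf (\<lambda>n. indicator {0<..<1} t * ?L n t)"
      by (cases "t \<in> {0<..<1}") simp_all
  qed
  also have "\<dots> \<le> liminf (\<lambda>n. \<integral>\<^sup>+t. indicator {0<..<1} t * ?L n t \<partial>lborel)"
    by (rule nn_integral_liminf) measurable
  also have "\<dots> \<le> liminf (\<lambda>n. ennreal ?M * ?R n)"
    by (intro Liminf_mono always_eventually allI exp_sum_average_le[OF U(1,2) \<kappa> pos F lap PD X1 r]) auto
  also have "\<dots> = 0"
  proof -
    have "(\<lambda>n. ennreal ?M * ?R n) \<longlonglongrightarrow> ennreal ?M * 0"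
      by (intro ennreal_tendsto_cmult R) auto
    then show ?thesis by (simp add: lim_imp_Liminf)
  qed
  finally have "(\<integral>\<^sup>+t. indicator {0<..<1} t * ?J t \<partial>lborel) = 0" by simp
  moreover have "(\<lambda>t. indicator {0<..<1} t * ?J t) \<in> borel_measurable lborel" by measurable
  ultimately have "AE t in lborel. indicator {0<..<1} t * ?J t = 0"
    using nn_integral_0_iff_AE by blast
  then have "AE t in lborel. t \<notin> {0<..<1} \<or> ?J t = 0"
    by (auto elim!: eventually_mono simp: indicator_def split: if_splits)
  moreover have "?J t \<noteq> 0" if t: "t > 0" for t
  proof
    assume "?J t = 0"
    then have "AE B in \<mu>. ennreal (exp (- (E \<bullet> (B + t *\<^sub>R e))) * (P (B + t *\<^sub>R e))\<^sup>2) = 0"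
      by (subst (asm) nn_integral_0_iff_AE) auto
    with P(3) have "AE B in \<mu>. False"
      by eventually_elim (use t in \<open>auto simp: mult_le_0_iff not_le\<close>)
    then obtain N where "N \<in> null_sets \<mu>" "space \<mu> \<subseteq> N"
      by (auto simp: eventually_ae_filter)
    then have "emeasure \<mu> (space \<mu>) \<le> 0"
      using emeasure_mono[of "space \<mu>" N \<mu>] by (auto simp: null_sets_def)
    then show False using nontriv by simp
  qed
  ultimately have "AE t in lborel. t \<notin> {0<..<(1::real)}"
    by (auto elim!: eventually_mono)
  then have "emeasure lborel {0<..<(1::real)} = 0"
    by (subst (asm) AE_iff_measurable[of "{0<..<1}"]) auto
  then show False by simp
qed

section \<open>Hermitian matrices over the reals, complex numbers and quaternions\<close>

definition diag_at :: "'m \<Rightarrow> real \<Rightarrow> 'f::real_algebra_1^'m^'m" where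
  "diag_at i s = (\<chi> a b. if a = b then (if a = i then of_real s else 1) else 0)"

text \<open>Padding with the identity keeps principal blocks of every size in one type, so that all
  principal minors are values of the single function \<open>Pd\<close>.\<close>

definition block_one :: "'m set \<Rightarrow> 'f::zero_neq_one^'m^'m \<Rightarrow> 'f^'m^'m" where
  "block_one S A = (\<chi> a b. if a \<in> S \<and> b \<in> S then A $ a $ b else if a = b then 1 else 0)"

definition column_at :: "'m \<Rightarrow> 'f::zero_neq_one^'m \<Rightarrow> 'f^'m^'m" where
  "column_at i u = (\<chi> a b. if b = i then u $ a else if a = b then 1 else 0)"

text \<open>\<open>Pd\<close> is the determinant up to the power \<open>e\<close>: on positive definite matrices the determinant
  is \<open>Pd X powr e\<close> (for quaternions, \<open>Pd\<close> is the square of the Moore determinant and \<open>e = 1/2\<close>).\<close>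

locale hermitian_matrices =
  fixes cj :: "'f::{real_algebra_1,euclidean_space} \<Rightarrow> 'f"
    and Pd nd :: "'f^'m::finite^'m \<Rightarrow> real" and e :: real
    and adj :: "'f^'m^'m \<Rightarrow> 'f^'m^'m" and Herm PosDef :: "('f^'m^'m) set"
  defines "adj M \<equiv> (\<chi> a b. cj (M $ b $ a))"
    and "Herm \<equiv> {X. adj X = X}"
    and "PosDef \<equiv> {X \<in> Herm. \<forall>v. v \<noteq> 0 \<longrightarrow> 0 < v \<bullet> (X *v v)}"
  assumes cj_add: "cj (x + y) = cj x + cj y"
    and cj_scaleR: "cj (r *\<^sub>R x) = r *\<^sub>R cj x"
    and cj_mult: "cj (x * y) = cj y * cj x"
    and cj_cj [simp]: "cj (cj x) = x"
    and cj_fixed: "cj x = x \<Longrightarrow> x = of_real (x \<bullet> 1)"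
    and inner_cj_cj: "cj x \<bullet> cj y = x \<bullet> y"
    and inner_cj: "(cj x * y) \<bullet> 1 = x \<bullet> y"
    and e: "e > 0"
    and nd_cont: "continuous_on UNIV nd"
    and nd_mult: "nd (g ** h) = nd g * nd h"
    and nd_diag: "s > 0 \<Longrightarrow> nd (diag_at i s) = s powr (2 / e)"
    and Pd_poly: "real_polynomial_function Pd"
    and Pd_one: "Pd (mat 1) = 1"
    and Pd_conj: "X \<in> Herm \<Longrightarrow> Pd (adj g ** X ** g) = nd g * Pd X"
    and Pd_singular: "X \<in> Herm \<Longrightarrow> v \<noteq> 0 \<Longrightarrow> X *v v = 0 \<Longrightarrow> Pd X = 0"
begin

section \<open>Scalars, adjoints and the hermitian form\<close>

lemma cj_0 [simp]: "cj 0 = 0" using cj_scaleR[of 0 0] by simp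
lemma cj_1 [simp]: "cj 1 = 1" using cj_mult[of "cj 1" 1] by simp
lemma cj_of_real [simp]: "cj (of_real r) = of_real r" by (simp add: of_real_def cj_scaleR)
lemma cj_sum: "cj (sum f I) = (\<Sum>i\<in>I. cj (f i))"
  by (induction I rule: infinite_finite_induct) (auto simp: cj_add)
lemma cj_eq_0_iff [simp]: "cj x = 0 \<longleftrightarrow> x = 0" by (metis cj_0 cj_cj)

lemma linear_cj: "linear cj" by (rule linearI) (auto simp: cj_add cj_scaleR)

lemma inner_one_one: "(1::'f) \<bullet> 1 = 1"
proof -
  have "(1::'f) = of_real (1 \<bullet> (1::'f))" by (rule cj_fixed) simp
  then show ?thesis by (metis of_real_1 of_real_eq_iff)
qed

text \<open>The inner product of x and y is the real part of cj x * y. The point is that the real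
  part of a product does not depend on the order of its factors, extracted here from
  \<open>inner_cj\<close> and \<open>inner_cj_cj\<close>.\<close>

lemma inner_mult_right_cj: "x \<bullet> (y * z) = (x * cj z) \<bullet> (y::'f)"
proof -
  have 1: "x \<bullet> (y * z) = (cj x * y * z) \<bullet> 1" using inner_cj[of x "y * z"] by (simp add: mult.assoc)
  have "(x * cj z) \<bullet> y = (z * (cj x * y)) \<bullet> 1"
    using inner_cj[of "x * cj z" y] by (simp add: cj_mult mult.assoc)
  also have "\<dots> = cj z \<bullet> (cj x * y)" using inner_cj[of "cj z"] by simp
  also have "\<dots> = z \<bullet> cj (cj x * y)" using inner_cj_cj[of z "cj (cj x * y)"] by simp
  also have "\<dots> = cj (cj x * y) \<bullet> z" by (rule inner_commute)
  also have "\<dots> = (cj x * y * z) \<bullet> 1" using inner_cj[of "cj (cj x * y)" z] by simp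
  finally show ?thesis using 1 by simp
qed

lemma cj_mult_self: "cj x * x = of_real (x \<bullet> x)"
  using cj_fixed[of "cj x * x"] by (simp add: cj_mult inner_cj)

lemma inner_mult_mult: "(x * y) \<bullet> (x * y) = (x \<bullet> x) * (y \<bullet> (y::'f))"
proof -
  have "(x * y) \<bullet> (x * y) = (cj y * (cj x * x) * y) \<bullet> 1"
    using inner_cj[of "x * y" "x * y"] by (simp add: cj_mult mult.assoc)
  also have "cj y * (cj x * x) * y = (x \<bullet> x) *\<^sub>R (cj y * y)"
    by (simp add: cj_mult_self[of x] of_real_def)
  finally show ?thesis by (simp add: inner_cj)
qed

lemma adj_nth [simp]: "adj M $ a $ b = cj (M $ b $ a)" by (simp add: adj_def)

lemma adj_adj [simp]: "adj (adj M) = M" by (simp add: vec_eq_iff)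

lemma adj_mat [simp]: "adj (mat 1) = mat 1" by (auto simp: vec_eq_iff mat_def)

lemma adj_mult: "adj (A ** B) = adj B ** adj A"
  by (simp add: vec_eq_iff matrix_matrix_mult_def cj_sum cj_mult)

lemma adj_add: "adj (A + B) = adj A + adj B" by (simp add: vec_eq_iff cj_add)
lemma adj_scaleR: "adj (r *\<^sub>R A) = r *\<^sub>R adj A" by (simp add: vec_eq_iff cj_scaleR)

lemma subspace_Herm: "subspace Herm"
  by (auto simp: subspace_def Herm_def adj_add adj_scaleR) (simp add: vec_eq_iff)

lemma HermD: "X \<in> Herm \<Longrightarrow> cj (X $ a $ b) = X $ b $ a"
  unfolding Herm_def by (metis (mono_tags, lifting) adj_nth mem_Collect_eq)

lemma Herm_conj: "X \<in> Herm \<Longrightarrow> adj g ** X ** g \<in> Herm"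
  by (simp add: Herm_def adj_mult matrix_mul_assoc)

lemma PosDef_Herm: "X \<in> PosDef \<Longrightarrow> X \<in> Herm" by (simp add: PosDef_def)

lemma linear_mv: "linear (\<lambda>v. M *v (v::'f^'m))"
  by (rule linearI) (auto simp: vec_eq_iff matrix_vector_mult_def distrib_left sum.distrib scaleR_sum_right)

lemma mv_sub: "M *v (v - w) = M *v v - M *v (w::'f^'m)"
  by (rule linear_diff[OF linear_mv])

lemma mv_add: "M *v (v + w) = M *v v + M *v (w::'f^'m)"
  by (rule linear_add[OF linear_mv])

lemma mv_scaleR: "M *v (r *\<^sub>R v) = r *\<^sub>R (M *v (v::'f^'m))"
  by (rule linear_scale[OF linear_mv])

lemma inner_mv: "u \<bullet> (M *v v) = (\<Sum>a\<in>UNIV. \<Sum>b\<in>UNIV. (u $ a) \<bullet> (M $ a $ b * v $ b))" for M :: "'f^'m^'m"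
  by (simp add: inner_vec_def matrix_vector_mult_def inner_sum_right)

lemma inner_adj: "u \<bullet> (M *v v) = (adj M *v u) \<bullet> v"
proof -
  have "(adj M *v u) \<bullet> v = v \<bullet> (adj M *v u)" by (rule inner_commute)
  also have "\<dots> = (\<Sum>b\<in>UNIV. \<Sum>a\<in>UNIV. (v $ b) \<bullet> (cj (M $ a $ b) * u $ a))"
    by (simp add: inner_mv)
  also have "\<dots> = (\<Sum>b\<in>UNIV. \<Sum>a\<in>UNIV. (u $ a) \<bullet> (M $ a $ b * v $ b))"
  proof (intro sum.cong refl)
    fix a b
    have "(v $ b) \<bullet> (cj (M $ a $ b) * u $ a) = cj (cj (M $ a $ b) * u $ a) \<bullet> cj (v $ b)"
      using inner_cj_cj[of "cj (M $ a $ b) * u $ a" "v $ b"] inner_commute by metis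
    also have "\<dots> = (cj (u $ a) * M $ a $ b) \<bullet> cj (v $ b)" by (simp add: cj_mult)
    also have "\<dots> = cj (u $ a) \<bullet> (cj (v $ b) * cj (M $ a $ b))" by (simp add: inner_mult_right_cj)
    also have "\<dots> = (u $ a) \<bullet> (M $ a $ b * v $ b)"
      using inner_cj_cj[of "u $ a" "M $ a $ b * v $ b"] by (simp add: cj_mult)
    finally show "(v $ b) \<bullet> (cj (M $ a $ b) * u $ a) = (u $ a) \<bullet> (M $ a $ b * v $ b)" .
  qed
  also have "\<dots> = u \<bullet> (M *v v)" unfolding inner_mv by (rule sum.swap)
  finally show ?thesis by simp
qed

lemma Herm_inner: "A \<in> Herm \<Longrightarrow> u \<bullet> (A *v v) = (A *v u) \<bullet> v"
  using inner_adj[of u A v] by (simp add: Herm_def)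

lemma quad_add:
  assumes "A \<in> Herm"
  shows "(u + v) \<bullet> (A *v (u + v)) = u \<bullet> (A *v u) + v \<bullet> (A *v v) + 2 * (v \<bullet> (A *v u))"
  using Herm_inner[OF assms, of u v] by (simp add: mv_add inner_add_left inner_add_right inner_commute)

lemma PosDef_pos: "A \<in> PosDef \<Longrightarrow> v \<noteq> 0 \<Longrightarrow> 0 < v \<bullet> (A *v v)"
  by (simp add: PosDef_def)

lemma PosDef_nonneg: "A \<in> PosDef \<Longrightarrow> 0 \<le> v \<bullet> (A *v v)"
  using PosDef_pos[of A v] by (cases "v = 0") auto

lemma mv_add_left: "(A + B) *v (v::'f^'m) = A *v v + B *v v"
  by (simp add: vec_eq_iff matrix_vector_mult_def distrib_right sum.distrib)

lemma mv_scaleR_left: "(r *\<^sub>R A) *v (v::'f^'m) = r *\<^sub>R (A *v v)"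
  by (simp add: vec_eq_iff matrix_vector_mult_def scaleR_sum_right)

lemma PosDef_add: "A \<in> PosDef \<Longrightarrow> B \<in> PosDef \<Longrightarrow> A + B \<in> PosDef"
  using subspace_Herm by (auto simp: PosDef_def mv_add_left inner_add_right subspace_add intro!: add_pos_pos)

lemma PosDef_scaleR: "A \<in> PosDef \<Longrightarrow> c > 0 \<Longrightarrow> c *\<^sub>R A \<in> PosDef"
  using subspace_Herm by (auto simp: PosDef_def mv_scaleR_left subspace_scale)

lemma mat_one_PosDef: "mat 1 \<in> PosDef"
  by (auto simp: PosDef_def Herm_def)

lemma bounded_bilinear_times: "bounded_bilinear (\<lambda>x y::'f. x * y)"
  using bilinear_conv_bounded_bilinear[of "\<lambda>x y::'f. x * y"]
  by (auto simp: bilinear_def algebra_simps intro!: linearI)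

lemma continuous_quad: "continuous_on UNIV (\<lambda>(A::'f^'m^'m, v). v \<bullet> (A *v v))"
proof -
  note bounded_bilinear_times
  then have "continuous_on UNIV (\<lambda>z::('f^'m^'m)\<times>('f^'m). fst z $ a $ b * snd z $ b)" for a b
    by (rule bounded_bilinear.continuous_on) (intro continuous_intros)+
  then show ?thesis
    unfolding case_prod_unfold inner_mv by (intro continuous_intros) auto
qed

text \<open>Positivity can be tested on the compact unit sphere, where the tube lemma turns joint
  continuity of the form into an open condition on A.\<close>

lemma openin_PosDef: "openin (top_of_set Herm) PosDef"
proof -
  have "PosDef = Herm \<inter> {A. \<forall>v\<in>sphere 0 1. v \<bullet> (A *v v) \<in> {0<..}}"
  proof (intro Set.set_eqI iffI)
    fix A assume A: "A \<in> Herm \<inter> {A. \<forall>v\<in>sphere 0 1. v \<bullet> (A *v v) \<in> {0<..}}"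
    have "0 < v \<bullet> (A *v v)" if "v \<noteq> 0" for v
    proof -
      have "(1 / norm v) *\<^sub>R v \<in> sphere 0 1" using that by simp
      then have "((1 / norm v) *\<^sub>R v) \<bullet> (A *v ((1 / norm v) *\<^sub>R v)) \<in> {0<..}"
        using A by blast
      then have "0 < ((1 / norm v) *\<^sub>R v) \<bullet> (A *v ((1 / norm v) *\<^sub>R v))"
        by (simp only: greaterThan_iff)
      also have "\<dots> = (1 / norm v)\<^sup>2 * (v \<bullet> (A *v v))"
        by (simp only: mv_scaleR inner_scaleR_left inner_scaleR_right power2_eq_square mult.assoc)
      finally show ?thesis using that by (simp add: zero_less_mult_iff)
    qed
    then show "A \<in> PosDef" using A by (auto simp: PosDef_def)
  next
    fix A assume A: "A \<in> PosDef"
    have "0 < v \<bullet> (A *v v)" if "v \<in> sphere 0 1" for v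
      by (rule PosDef_pos[OF A]) (use that in auto)
    then show "A \<in> Herm \<inter> {A. \<forall>v\<in>sphere 0 1. v \<bullet> (A *v v) \<in> {0<..}}"
      using PosDef_Herm[OF A] by blast
  qed
  moreover have "open {A::'f^'m^'m. \<forall>v\<in>sphere 0 1. v \<bullet> (A *v v) \<in> {0<..}}"
  proof (rule Topological_Spaces.openI)
    fix A :: "'f^'m^'m" assume A: "A \<in> {A. \<forall>v\<in>sphere 0 1. v \<bullet> (A *v v) \<in> {0<..}}"
    have op: "open ((\<lambda>(A::'f^'m^'m, v). v \<bullet> (A *v v)) -` {0<..})"
      using continuous_quad by (simp add: continuous_on_open_vimage)
    have sub: "{A} \<times> sphere 0 1 \<subseteq> (\<lambda>(A::'f^'m^'m, v). v \<bullet> (A *v v)) -` {0<..}"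
      using A by auto
    obtain W where "open W" "A \<in> W" "W \<times> sphere 0 1 \<subseteq> (\<lambda>(A::'f^'m^'m, v). v \<bullet> (A *v v)) -` {0<..}"
      using Elementary_Topology.tube_lemma[OF compact_sphere op sub] by blast
    then show "\<exists>T. open T \<and> A \<in> T \<and> T \<subseteq> {A. \<forall>v\<in>sphere 0 1. v \<bullet> (A *v v) \<in> {0<..}}"
      by (intro exI[of _ W]) auto
  qed
  ultimately show ?thesis by (simp add: openin_open_Int)
qed

lemma convex_PosDef: "convex PosDef"
proof (rule convexI)
  fix x y and u v :: real
  assume xy: "x \<in> PosDef" "y \<in> PosDef" and uv: "0 \<le> u" "0 \<le> v" "u + v = 1"
  show "u *\<^sub>R x + v *\<^sub>R y \<in> PosDef"
  proof (cases "u = 0 \<or> v = 0")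
    case False
    then show ?thesis using xy uv by (intro PosDef_add PosDef_scaleR) auto
  qed (use xy uv in auto)
qed

lemma open_convex_cone_PosDef: "open_convex_cone Herm PosDef"
  by (simp add: open_convex_cone_def openin_PosDef convex_PosDef PosDef_scaleR)

section \<open>Pivots\<close>

lemma block_one_nth: "block_one S A $ a $ b = (if a \<in> S \<and> b \<in> S then A $ a $ b else if a = b then 1 else 0)"
  by (simp add: block_one_def)

lemma block_one_empty: "block_one {} A = mat 1"
  by (auto simp: vec_eq_iff block_one_nth mat_def)

lemma block_one_UNIV: "block_one UNIV A = A"
  by (auto simp: vec_eq_iff block_one_nth)

lemma block_one_Herm: "A \<in> Herm \<Longrightarrow> block_one S A \<in> Herm"
  unfolding Herm_def by (auto simp: vec_eq_iff block_one_nth)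

definition restrict_vec :: "'m set \<Rightarrow> 'f^'m \<Rightarrow> 'f^'m" where
  "restrict_vec S v = (\<chi> a. if a \<in> S then v $ a else 0)"

lemma block_one_mv: "(block_one S A *v v) $ a = (if a \<in> S then (A *v restrict_vec S v) $ a else v $ a)"
proof (cases "a \<in> S")
  case True
  then show ?thesis
    unfolding matrix_vector_mult_def
    by (simp add: block_one_nth restrict_vec_def) (intro sum.cong, auto)
next
  case False
  then show ?thesis
    by (simp add: matrix_vector_mult_def block_one_nth if_distrib[of "\<lambda>x. x * _"] cong: if_cong)
qed

text \<open>Positivity is asked only on vectors supported in S, since in
  \<open>Pd_low_rank_ray\<close> the matrix may be degenerate outside the block.\<close>

lemma block_one_PosDef:
  assumes A: "A \<in> Herm" and pos: "\<And>v. (\<And>a. a \<notin> S \<Longrightarrow> v $ a = 0) \<Longrightarrow> v \<noteq> 0 \<Longrightarrow> 0 < v \<bullet> (A *v v)"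
  shows "block_one S A \<in> PosDef"
proof -
  have "0 < v \<bullet> (block_one S A *v v)" if "v \<noteq> 0" for v
  proof -
    let ?w = "restrict_vec S v" and ?u = "restrict_vec (- S) v"
    have "v \<bullet> (block_one S A *v v) = (\<Sum>a\<in>UNIV. (?w $ a) \<bullet> ((A *v ?w) $ a) + (?u $ a) \<bullet> (?u $ a))"
      unfolding inner_vec_def by (intro sum.cong refl) (simp add: block_one_mv restrict_vec_def)
    also have "\<dots> = ?w \<bullet> (A *v ?w) + ?u \<bullet> ?u"
      by (simp add: sum.distrib inner_vec_def)
    finally have eq: "v \<bullet> (block_one S A *v v) = ?w \<bullet> (A *v ?w) + ?u \<bullet> ?u" .
    have w0: "0 \<le> ?w \<bullet> (A *v ?w)"
      using pos[of ?w] by (cases "?w = 0") (auto simp: restrict_vec_def)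
    show ?thesis
    proof (cases "?w = 0")
      case True
      then have "?u \<noteq> 0" using that by (auto simp: vec_eq_iff restrict_vec_def split: if_splits)
      then show ?thesis using eq w0 by (smt (verit) inner_gt_zero_iff)
    next
      case False
      then have "0 < ?w \<bullet> (A *v ?w)" by (intro pos) (auto simp: restrict_vec_def)
      then show ?thesis using eq by (smt (verit) inner_ge_zero)
    qed
  qed
  then show ?thesis using block_one_Herm[OF A] by (simp add: PosDef_def)
qed

lemma PosDef_block_one: "A \<in> PosDef \<Longrightarrow> block_one S A \<in> PosDef"
  by (intro block_one_PosDef PosDef_Herm PosDef_pos)

text \<open>Stands in for inverting A, whose entries need not commute: an injective real-linear
  endomorphism in finite dimension is onto.\<close>

lemma PosDef_surj:
  assumes "A \<in> PosDef"
  obtains w where "A *v w = b"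
proof -
  have "inj (\<lambda>v. A *v v)"
    using PosDef_pos[OF assms] by (subst linear_injective_0[OF linear_mv]) (metis inner_zero_right less_irrefl)
  then have "surj (\<lambda>v. A *v v)" by (rule linear_injective_imp_surjective[OF linear_mv]) (rule refl)
  then show ?thesis using that by (metis surj_def)
qed

text \<open>The vector \<open>u\<close> is the column of the inverse of the unipotent factor in the block elimination;
  the pivot \<open>p\<close> is the Schur complement of the block \<open>S\<close> at \<open>i\<close>.\<close>

lemma pivot_exists:
  assumes A: "A \<in> PosDef" and i: "i \<notin> S"
  obtains u p where "u $ i = 1" "\<And>a. a \<notin> insert i S \<Longrightarrow> u $ a = 0"
    "\<And>a. a \<in> S \<Longrightarrow> (A *v u) $ a = 0" "(A *v u) $ i = of_real p" "p > 0"
proof -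
  \<comment> \<open>w solves the system of the block S with the i-th column of A, restricted to S,
    as right-hand side; then \<open>axis i 1 - w\<close> is orthogonal to S under A.\<close>
  define b where "b = restrict_vec S (A *v axis i 1)"
  obtain w where w: "block_one S A *v w = b"
    using PosDef_surj[OF PosDef_block_one[OF A]] by blast
  have w0: "w $ a = 0" if "a \<notin> S" for a
    using that block_one_mv[of S A w a] by (simp add: w b_def restrict_vec_def)
  then have rw: "restrict_vec S w = w" by (auto simp: vec_eq_iff restrict_vec_def)
  define u where "u = axis i 1 - w"
  have u1: "u $ i = 1" using w0[OF i] by (simp add: u_def)
  have u2: "u $ a = 0" if "a \<notin> insert i S" for a
    using that w0 by (auto simp: u_def axis_def)
  have u3: "(A *v u) $ a = 0" if "a \<in> S" for a
  proof -
    have "(A *v w) $ a = (block_one S A *v w) $ a"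
      using that block_one_mv[of S A w a] by (simp add: rw)
    also have "\<dots> = (A *v axis i 1) $ a" using that by (simp add: w b_def restrict_vec_def)
    finally show ?thesis by (simp add: u_def mv_sub)
  qed
  have u23: "u $ a = 0 \<or> (A *v u) $ a = 0" if "a \<noteq> i" for a
    using that u2[of a] u3[of a] by blast
  \<comment> \<open>In each coordinate other than i either u or A u vanishes, so the hermitian form
    at u is the entry of A u at i. Being a hermitian form, it is fixed by \<open>cj\<close> and
    therefore real.\<close>
  have hip: "(\<Sum>a\<in>UNIV. cj (u $ a) * (A *v u) $ a) = (A *v u) $ i"
  proof -
    have "(\<Sum>a\<in>UNIV. cj (u $ a) * (A *v u) $ a) = (\<Sum>a\<in>{i}. cj (u $ a) * (A *v u) $ a)"
      by (intro sum.mono_neutral_right) (use u23 in force)+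
    then show ?thesis using u1 by simp
  qed
  have "cj (\<Sum>a\<in>UNIV. cj (u $ a) * (A *v u) $ a) = (\<Sum>a\<in>UNIV. cj (u $ a) * (A *v u) $ a)"
  proof -
    have "cj (\<Sum>a\<in>UNIV. cj (u $ a) * (A *v u) $ a) = (\<Sum>a\<in>UNIV. \<Sum>b\<in>UNIV. cj (u $ b) * A $ b $ a * u $ a)"
      by (simp add: cj_sum cj_mult matrix_vector_mult_def sum_distrib_right HermD[OF PosDef_Herm[OF A]])
    also have "\<dots> = (\<Sum>a\<in>UNIV. cj (u $ a) * (A *v u) $ a)"
      by (subst sum.swap) (simp add: matrix_vector_mult_def sum_distrib_left mult.assoc)
    finally show ?thesis .
  qed
  then have real: "(A *v u) $ i = of_real ((A *v u) $ i \<bullet> 1)"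
    unfolding hip by (rule cj_fixed)
  have "u \<bullet> (A *v u) = (\<Sum>a\<in>UNIV. u $ a \<bullet> (A *v u) $ a)" by (rule inner_vec_def)
  also have "\<dots> = (\<Sum>a\<in>{i}. u $ a \<bullet> (A *v u) $ a)"
    by (intro sum.mono_neutral_right) (use u23 in force)+
  finally have "u \<bullet> (A *v u) = (A *v u) $ i \<bullet> 1" using u1 by (simp add: inner_commute)
  moreover have "u \<noteq> 0" using u1 by auto
  ultimately have "(A *v u) $ i \<bullet> 1 > 0" using PosDef_pos[OF A] by metis
  then show ?thesis using that u1 u2 u3 real by blast
qed

lemma nd_one: "nd (mat 1) = 1"
proof -
  fix i :: 'm
  have "diag_at i 1 = (mat 1 :: 'f^'m^'m)" by (auto simp: vec_eq_iff diag_at_def mat_def)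
  then show ?thesis using nd_diag[of 1 i] by simp
qed

text \<open>Conjugation by diagonal matrices contracts the unipotent matrix to the identity.\<close>

lemma nd_column_at:
  assumes "u $ i = 1"
  shows "nd (column_at i u) = 1"
proof -
  define U where "U s = column_at i (\<chi> a. if a = i then 1 else s *\<^sub>R u $ a)" for s :: real
  have U: "nd (U s) = nd (column_at i u)" if "s > 0" for s
  proof -
    have "diag_at i (1 / s) ** column_at i u ** diag_at i s = U s"
      unfolding U_def using that assms
      by (auto simp: vec_eq_iff matrix_matrix_mult_def diag_at_def column_at_def if_distrib[of "\<lambda>x. x * _"]
           if_distrib[of "\<lambda>x. _ * x"] of_real_def cong: if_cong)
    then have "nd (U s) = nd (diag_at i (1 / s)) * nd (column_at i u) * nd (diag_at i s)"
      using nd_mult by metis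
    then show ?thesis using that by (simp add: nd_diag powr_divide)
  qed
  have "(\<lambda>n. U (1 / real (Suc n))) \<longlonglongrightarrow> U 0"
    unfolding U_def column_at_def
  proof (intro tendsto_vec_lambda)
    fix a b
    have "(\<lambda>n. (1 / real (Suc n)) *\<^sub>R u $ a) \<longlonglongrightarrow> 0 *\<^sub>R u $ a"
      using LIMSEQ_inverse_real_of_nat by (intro tendsto_scaleR tendsto_const) (simp add: inverse_eq_divide)
    then show "(\<lambda>n. if b = i then (\<chi> a. if a = i then 1 else (1 / real (Suc n)) *\<^sub>R u $ a) $ a
        else if a = b then 1 else 0)
      \<longlonglongrightarrow> (if b = i then (\<chi> a. if a = i then 1 else 0 *\<^sub>R u $ a) $ a else if a = b then 1 else 0)"
      by (cases "b = i"; cases "a = i") simp_all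
  qed
  moreover have "U 0 = mat 1" by (auto simp: U_def column_at_def vec_eq_iff mat_def)
  ultimately have "(\<lambda>n. nd (U (1 / real (Suc n)))) \<longlonglongrightarrow> nd (mat 1)"
    using nd_cont by (metis UNIV_I continuous_on_sequentially o_def continuous_on_tendsto_compose eventually_sequentiallyI)
  moreover have "(\<lambda>n. nd (U (1 / real (Suc n)))) = (\<lambda>n. nd (column_at i u))"
    by (intro ext U) simp
  ultimately show ?thesis using nd_one LIMSEQ_unique tendsto_const by metis
qed

text \<open>Both sides are the block S of A together with the pivot p at i. The right side is
  written as a congruence as well, so that \<open>Pd_conj\<close> evaluates both.\<close>

lemma pivot_congruence:
  assumes A: "A \<in> PosDef" and i: "i \<notin> S"
    and u: "u $ i = 1" "\<And>a. a \<notin> insert i S \<Longrightarrow> u $ a = 0"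
      "\<And>a. a \<in> S \<Longrightarrow> (A *v u) $ a = 0" "(A *v u) $ i = of_real p" "p > 0"
  shows "adj (column_at i u) ** block_one (insert i S) A ** column_at i u
    = adj (diag_at i (sqrt p)) ** block_one S A ** diag_at i (sqrt p)"
proof -
  let ?X = "block_one (insert i S) A" and ?T = "column_at i u" and ?d = "diag_at i (sqrt p)"
  have X: "?X \<in> Herm" by (intro block_one_Herm PosDef_Herm A)
  have ru: "restrict_vec (insert i S) u = u" using u(2) by (auto simp: vec_eq_iff restrict_vec_def)
  have Xu: "(?X *v u) $ c = (if c = i then of_real p else 0)" for c
    using u i by (auto simp: block_one_mv ru)
  have XT: "(?X ** ?T) $ c $ b = (if b = i then (if c = i then of_real p else 0) else ?X $ c $ b)" for c b
  proof (cases "b = i")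
    case True
    have "(?X ** ?T) $ c $ i = (?X *v u) $ c"
      by (simp add: matrix_matrix_mult_def matrix_vector_mult_def column_at_def)
    then show ?thesis using True Xu by simp
  next
    case False
    then show ?thesis
      by (simp add: matrix_matrix_mult_def column_at_def if_distrib[of "\<lambda>x. _ * x"] cong: if_cong)
  qed
  have uX: "(\<Sum>c\<in>UNIV. cj (u $ c) * ?X $ c $ b) = (if b = i then of_real p else 0)" for b
  proof -
    have "(\<Sum>c\<in>UNIV. cj (u $ c) * ?X $ c $ b) = cj ((?X *v u) $ b)"
      by (simp add: matrix_vector_mult_def cj_sum cj_mult HermD[OF X])
    then show ?thesis unfolding Xu by simp
  qed
  have L: "(adj ?T ** (?X ** ?T)) $ a $ b = (if a = i \<or> b = i then (if a = b then of_real p else 0) else ?X $ a $ b)" for a b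
  proof (cases "a = i")
    case True
    have "(adj ?T ** (?X ** ?T)) $ i $ b = (\<Sum>c\<in>UNIV. cj (u $ c) * (?X ** ?T) $ c $ b)"
    proof -
      have "(adj ?T ** Y) $ i $ b = (\<Sum>c\<in>UNIV. cj (?T $ c $ i) * Y $ c $ b)" for Y
        by (simp add: matrix_matrix_mult_def)
      moreover have "?T $ c $ i = u $ c" for c by (simp add: column_at_def)
      ultimately show ?thesis by simp
    qed
    also have "\<dots> = (if b = i then of_real p else 0)"
    proof (cases "b = i")
      case True
      then show ?thesis using u(1) by (simp add: XT if_distrib[of "\<lambda>x. _ * x"] cong: if_cong)
    next
      case False
      then show ?thesis using uX[of b] by (simp add: XT)
    qed
    finally show ?thesis using True by auto
  next
    case False
    have "(adj ?T ** Y) $ a $ b = (\<Sum>c\<in>UNIV. cj (?T $ c $ a) * Y $ c $ b)" for Y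
      by (simp add: matrix_matrix_mult_def)
    moreover have "cj (?T $ c $ a) * y = (if c = a then y else 0)" for c y
      using False by (simp add: column_at_def)
    ultimately have "(adj ?T ** (?X ** ?T)) $ a $ b = (?X ** ?T) $ a $ b"
      by simp
    then show ?thesis using False by (auto simp: XT)
  qed
  have sq: "of_real (sqrt p) * of_real (sqrt p) = (of_real p :: 'f)"
    using u(5) by (simp flip: of_real_mult)
  have R: "(adj ?d ** (block_one S A ** ?d)) $ a $ b
      = cj (?d $ a $ a) * (block_one S A $ a $ b * ?d $ b $ b)" for a b
  proof -
    have "(adj ?d ** (block_one S A ** ?d)) $ a $ b
      = (\<Sum>c\<in>UNIV. if c = a then cj (?d $ a $ a) * (block_one S A ** ?d) $ c $ b else 0)"
      unfolding matrix_matrix_mult_def[of "adj ?d"] vec_lambda_beta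
      by (intro sum.cong refl) (auto simp: diag_at_def)
    also have "\<dots> = cj (?d $ a $ a) * (block_one S A ** ?d) $ a $ b" by simp
    also have "(block_one S A ** ?d) $ a $ b = (\<Sum>c\<in>UNIV. if c = b then block_one S A $ a $ c * ?d $ b $ b else 0)"
      unfolding matrix_matrix_mult_def vec_lambda_beta by (intro sum.cong refl) (auto simp: diag_at_def)
    also have "\<dots> = block_one S A $ a $ b * ?d $ b $ b" by simp
    finally show ?thesis .
  qed
  show ?thesis
    unfolding matrix_mul_assoc[symmetric] vec_eq_iff L R
    using i sq by (auto simp: diag_at_def block_one_nth)
qed

lemma Pd_block_insert:
  assumes A: "A \<in> PosDef" and i: "i \<notin> S"
    and u: "u $ i = 1" "\<And>a. a \<notin> insert i S \<Longrightarrow> u $ a = 0"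
      "\<And>a. a \<in> S \<Longrightarrow> (A *v u) $ a = 0" "(A *v u) $ i = of_real p" "p > 0"
  shows "Pd (block_one (insert i S) A) = p powr (1 / e) * Pd (block_one S A)"
proof -
  have H: "block_one T A \<in> Herm" for T by (intro block_one_Herm PosDef_Herm A)
  have "Pd (block_one (insert i S) A) = nd (column_at i u) * Pd (block_one (insert i S) A)"
    by (simp add: nd_column_at u)
  also have "\<dots> = Pd (adj (column_at i u) ** block_one (insert i S) A ** column_at i u)"
    by (rule Pd_conj[OF H, symmetric])
  also have "\<dots> = Pd (adj (diag_at i (sqrt p)) ** block_one S A ** diag_at i (sqrt p))"
    by (rule arg_cong[of _ _ Pd], rule pivot_congruence[OF A i u(1) _ _ u(4,5)]) (use u in auto)
  also have "\<dots> = sqrt p powr (2 / e) * Pd (block_one S A)"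
    using u(5) by (simp add: Pd_conj[OF H] nd_diag)
  also have "sqrt p powr (2 / e) = p powr (1 / e)"
    using u(5) by (simp add: powr_half_sqrt[symmetric] powr_powr)
  finally show ?thesis .
qed

lemma Pd_block_pos: "A \<in> PosDef \<Longrightarrow> Pd (block_one S A) > 0"
proof (induction S rule: finite_induct[OF finite])
  case 1
  then show ?case by (simp add: block_one_empty Pd_one)
next
  case (2 i S)
  obtain u p where u: "u $ i = 1" "\<And>a. a \<notin> insert i S \<Longrightarrow> u $ a = 0"
      "\<And>a. a \<in> S \<Longrightarrow> (A *v u) $ a = 0" "(A *v u) $ i = of_real p" "p > 0"
    using pivot_exists[OF 2(4,2)] by blast
  show ?case
    using Pd_block_insert[OF 2(4,2) u(1) _ _ u(4,5)] u(2,3,5) 2 by simp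
qed

definition minor :: "'m set \<Rightarrow> 'f^'m^'m \<Rightarrow> real" where
  "minor S A = Pd (block_one S A) powr e"

lemma minor_pos: "A \<in> PosDef \<Longrightarrow> minor S A > 0"
  using Pd_block_pos[of A S] by (simp add: minor_def)

lemma minor_empty: "minor {} A = 1"
  by (simp add: minor_def block_one_empty Pd_one)

lemma minor_insert:
  assumes A: "A \<in> PosDef" and i: "i \<notin> S"
    and u: "u $ i = 1" "\<And>a. a \<notin> insert i S \<Longrightarrow> u $ a = 0"
      "\<And>a. a \<in> S \<Longrightarrow> (A *v u) $ a = 0" "(A *v u) $ i = of_real p" "p > 0"
  shows "minor (insert i S) A = p * minor S A"
proof -
  have "Pd (block_one (insert i S) A) = p powr (1 / e) * Pd (block_one S A)"
    by (rule Pd_block_insert[OF A i u(1) _ _ u(4,5)]) (use u in auto)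
  then show ?thesis
    unfolding minor_def
    using Pd_block_pos[OF A, of S] u(5) e by (simp add: powr_mult powr_powr)
qed

text \<open>Cholesky factorization, one pivot at a time. It supplies the congruence that takes the
  identity to a chosen point of a subcone.\<close>

lemma PosDef_factor:
  assumes A: "A \<in> PosDef"
  obtains k where "A = adj k ** k"
proof -
  have "\<exists>k. block_one S A = adj k ** k" for S
  proof (induction S rule: finite_induct[OF finite])
    case 1
    show ?case by (intro exI[of _ "mat 1"]) (simp add: block_one_empty)
  next
    case (2 i S)
    then obtain k where k: "block_one S A = adj k ** k" by blast
    obtain u p where u: "u $ i = 1" "\<And>a. a \<notin> insert i S \<Longrightarrow> u $ a = 0"
      "\<And>a. a \<in> S \<Longrightarrow> (A *v u) $ a = 0" "(A *v u) $ i = of_real p" "p > 0"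
      using pivot_exists[OF A 2(2)] by blast
    let ?T = "column_at i u" and ?d = "diag_at i (sqrt p) :: 'f^'m^'m"
    \<comment> \<open>The inverse of the unipotent factor: the off-diagonal entries of column i
      change sign.\<close>
    define T' where "T' = column_at i (\<chi> a. if a = i then 1 else - (u $ a))"
    have TT: "?T ** T' = mat 1"
    proof -
      have "(?T ** T') $ a $ b = (mat 1 :: 'f^'m^'m) $ a $ b" for a b
      proof (cases "b = i")
        case True
        have "(?T ** T') $ a $ i = (\<Sum>c\<in>UNIV. (if c = i then u $ a else 0) + (if c = a then (if a = i then 0 else - (u $ a)) else 0))"
          unfolding matrix_matrix_mult_def vec_lambda_beta T'_def column_at_def
          by (intro sum.cong refl) auto
        then show ?thesis using True u(1) by (auto simp: sum.distrib mat_def)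
      next
        case False
        have "(?T ** T') $ a $ b = (\<Sum>c\<in>UNIV. if c = b then ?T $ a $ b else 0)"
          unfolding matrix_matrix_mult_def vec_lambda_beta T'_def using False
          by (intro sum.cong refl) (auto simp: column_at_def)
        then show ?thesis using False by (simp add: column_at_def mat_def)
      qed
      then show ?thesis by (simp add: vec_eq_iff)
    qed
    have "block_one (insert i S) A = adj T' ** (adj ?T ** block_one (insert i S) A ** ?T) ** T'"
    proof -
      have "adj T' ** (adj ?T ** block_one (insert i S) A ** ?T) ** T'
          = adj (?T ** T') ** block_one (insert i S) A ** (?T ** T')"
        by (simp add: adj_mult matrix_mul_assoc)
      then show ?thesis by (simp add: TT)
    qed
    also have "adj ?T ** block_one (insert i S) A ** ?T = adj ?d ** block_one S A ** ?d"
      by (rule pivot_congruence[OF A 2(2) u(1) _ _ u(4,5)]) (use u in auto)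
    finally have "block_one (insert i S) A = adj (k ** ?d ** T') ** (k ** ?d ** T')"
      by (simp add: k adj_mult matrix_mul_assoc)
    then show ?case by blast
  qed
  from this[of UNIV] show ?thesis using that by (auto simp: block_one_UNIV)
qed

end

section \<open>Gaussian measures\<close>

lemma nn_integral_gaussian_finite:
  "(\<integral>\<^sup>+l. ennreal (exp (- (l \<bullet> l))) \<partial>(lborel :: 'f::euclidean_space measure)) < \<infinity>"
proof -
  have 1: "(\<integral>\<^sup>+x. ennreal (exp (- x\<^sup>2)) \<partial>lborel) < \<infinity>"
  proof -
    let ?g = "\<lambda>s::real. ennreal (indicator {0<..} s * s powr (1 - 1) * exp (- (1 * s)))"
    have "AE x in lborel. ennreal (exp (- x\<^sup>2)) \<le> ennreal (exp 1) * ?g x + ennreal (exp 1) * ?g (0 + (-1) * x)"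
    proof -
      have "AE x in lborel. x \<noteq> (0::real)" by (rule AE_lborel_singleton)
      then show ?thesis
      proof eventually_elim
        case (elim x)
        \<comment> \<open>Comparison with a multiple of exp (- \<bar>x\<bar>), which is a Gamma
          integral on each open half-line; the point 0 is a null set.\<close>
        have "\<bar>x\<bar> \<le> 1 + x\<^sup>2"
          using zero_le_power2[of "\<bar>x\<bar> - 1"] by (simp add: power2_eq_square algebra_simps flip: abs_mult) 
        then have "exp (- x\<^sup>2) \<le> exp 1 * exp (- \<bar>x\<bar>)"
          by (simp flip: exp_add)
        then show ?case using elim
          by (cases "x > 0") (auto simp: ennreal_mult'[symmetric] intro!: ennreal_leI)
      qed
    qed
    then have "(\<integral>\<^sup>+x. ennreal (exp (- x\<^sup>2)) \<partial>lborel)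
        \<le> (\<integral>\<^sup>+x. ennreal (exp 1) * ?g x + ennreal (exp 1) * ?g (0 + (-1) * x) \<partial>lborel)"
      by (rule nn_integral_mono_AE)
    also have "\<dots> = ennreal (exp 1) * (\<integral>\<^sup>+x. ?g x \<partial>lborel) + ennreal (exp 1) * (\<integral>\<^sup>+x. ?g (0 + (-1) * x) \<partial>lborel)"
      by (subst nn_integral_add) (simp_all add: nn_integral_cmult)
    finally have "(\<integral>\<^sup>+x. ennreal (exp (- x\<^sup>2)) \<partial>lborel)
        \<le> ennreal (exp 1) * (\<integral>\<^sup>+x. ?g x \<partial>lborel) + ennreal (exp 1) * (\<integral>\<^sup>+x. ?g (0 + (-1) * x) \<partial>lborel)" .
    moreover have "(\<integral>\<^sup>+x. ?g x \<partial>lborel) = \<bar>- 1 :: real\<bar> * (\<integral>\<^sup>+x. ?g (0 + (-1) * x) \<partial>lborel)"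
      by (rule nn_integral_real_affine) auto
    then have "(\<integral>\<^sup>+x. ?g (0 + (-1) * x) \<partial>lborel) = (\<integral>\<^sup>+x. ?g x \<partial>lborel)"
      by (simp only: abs_minus_cancel abs_one ennreal_1 mult_1)
    moreover have "(\<integral>\<^sup>+x. ?g x \<partial>lborel) = ennreal (Gamma 1 * 1 powr (- 1))"
      by (rule gamma_laplace) auto
    ultimately have le: "(\<integral>\<^sup>+x. ennreal (exp (- x\<^sup>2)) \<partial>lborel)
        \<le> ennreal (exp 1) * ennreal (Gamma 1 * 1 powr (- 1)) + ennreal (exp 1) * ennreal (Gamma 1 * 1 powr (- 1))"
      by (simp only:)
    show ?thesis
      by (rule le_less_trans[OF le]) (simp add: ennreal_mult_less_top)
  qed
  have "(\<integral>\<^sup>+l. ennreal (exp (- (l \<bullet> l))) \<partial>(lborel :: 'f measure))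
      = (\<integral>\<^sup>+l. (\<Prod>b\<in>Basis. ennreal (exp (- (l \<bullet> b)\<^sup>2))) \<partial>(lborel :: 'f measure))"
  proof (rule nn_integral_cong)
    fix l :: 'f
    have "exp (- (l \<bullet> l)) = (\<Prod>b\<in>Basis. exp (- (l \<bullet> b)\<^sup>2))"
      by (subst euclidean_inner) (simp add: exp_sum power2_eq_square flip: sum_negf)
    then show "ennreal (exp (- (l \<bullet> l))) = (\<Prod>b\<in>Basis. ennreal (exp (- (l \<bullet> b)\<^sup>2)))"
      by (simp add: prod_ennreal)
  qed
  also have "\<dots> = (\<Prod>b\<in>(Basis::'f set). \<integral>\<^sup>+x. ennreal (exp (- x\<^sup>2)) \<partial>lborel)"
    by (rule nn_integral_lborel_prod) auto
  also have "\<dots> < \<infinity>" using 1 by (simp add: power_less_top_ennreal)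
  finally show ?thesis .
qed

text \<open>Equal to pi powr (DIM('f) / 2) but kept abstract:
  \<open>laplace_transform_on_scale\<close> removes such factors once they are known to be finite
  and positive.\<close>

definition gauss_const :: "'f::euclidean_space itself \<Rightarrow> real" where
  "gauss_const _ = enn2real (\<integral>\<^sup>+l. ennreal (exp (- (l \<bullet> l))) \<partial>(lborel :: 'f measure))"

lemma gauss_const:
  "(\<integral>\<^sup>+l. ennreal (exp (- (l \<bullet> l))) \<partial>(lborel :: 'f::euclidean_space measure)) = ennreal (gauss_const TYPE('f))"
  "gauss_const TYPE('f) > 0"
proof -
  let ?I = "(\<integral>\<^sup>+l. ennreal (exp (- (l \<bullet> l))) \<partial>(lborel :: 'f measure))"
  show eq: "?I = ennreal (gauss_const TYPE('f))"
    using nn_integral_gaussian_finite[where 'f = 'f] by (simp add: gauss_const_def)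
  have "?I \<noteq> 0"
  proof
    assume "?I = 0"
    then have "AE l in lborel. ennreal (exp (- (l \<bullet> (l::'f)))) = 0"
      by (subst (asm) nn_integral_0_iff_AE) auto
    then have "AE l in (lborel :: 'f measure). False" by (rule eventually_mono) simp
    then have "emeasure (lborel :: 'f measure) UNIV = 0"
      by (subst (asm) AE_iff_measurable[of UNIV]) auto
    then show False by simp
  qed
  then show "gauss_const TYPE('f) > 0"
    using eq by (metis ennreal_neg less_eq_real_def linorder_not_less ennreal_0)
qed

text \<open>Rescaling by sqrt p. The exponent DIM('f) / 2 is the origin of
  \<open>hdim\<close>.\<close>

lemma nn_integral_gaussian:
  fixes p :: real
  assumes p: "p > 0"
  shows "(\<integral>\<^sup>+l. ennreal (exp (- (p * (l \<bullet> l)))) \<partial>(lborel :: 'f::euclidean_space measure))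
    = ennreal (gauss_const TYPE('f) * p powr (- real DIM('f) / 2))"
proof -
  let ?h = "\<lambda>l::'f. ennreal (exp (- (p * (l \<bullet> l))))"
  have sq: "1 / sqrt p \<noteq> 0" using p by simp
  have 1: "(\<integral>\<^sup>+l. ?h l \<partial>lborel) = ennreal (\<bar>1 / sqrt p\<bar> ^ DIM('f)) * (\<integral>\<^sup>+l. ?h (0 + (1 / sqrt p) *\<^sub>R l) \<partial>lborel)"
    by (subst lborel_affine[OF sq, of 0]) (simp add: nn_integral_density nn_integral_distr nn_integral_cmult)
  have 2: "(\<integral>\<^sup>+l. ?h (0 + (1 / sqrt p) *\<^sub>R l) \<partial>lborel) = (\<integral>\<^sup>+l. ennreal (exp (- (l \<bullet> l))) \<partial>(lborel :: 'f measure))"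
  proof (rule nn_integral_cong)
    fix l :: 'f
    have "p * ((1 / sqrt p) * ((1 / sqrt p) * (l \<bullet> l))) = l \<bullet> l"
      using p by (simp add: field_simps)
    then show "?h (0 + (1 / sqrt p) *\<^sub>R l) = ennreal (exp (- (l \<bullet> l)))"
      by (simp only: add_0 inner_scaleR_left inner_scaleR_right)
  qed
  have 3: "\<bar>1 / sqrt p\<bar> ^ DIM('f) = p powr (- real DIM('f) / 2)"
  proof -
    have "\<bar>1 / sqrt p\<bar> = p powr (- 1 / 2)"
      using p by (simp add: powr_minus powr_half_sqrt inverse_eq_divide powr_divide)
    then have "\<bar>1 / sqrt p\<bar> ^ DIM('f) = (p powr (- 1 / 2)) powr real DIM('f)"
      using p by (simp add: powr_realpow)
    then show ?thesis by (simp add: powr_powr)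
  qed
  show ?thesis
    unfolding 1 2 3 gauss_const(1) using gauss_const(2)[where 'f = 'f]
    by (subst ennreal_mult'[symmetric]) (simp_all add: mult.commute)
qed

text \<open>A closed set is a countable union of compact sets, and so is its image. This makes the
  sets of matrices of bounded rank measurable.\<close>

lemma borel_image_closed:
  fixes f :: "'a::euclidean_space \<Rightarrow> 'b::euclidean_space"
  assumes "closed K" "continuous_on K f"
  shows "f ` K \<in> sets borel"
proof -
  have "K = (\<Union>n. K \<inter> cball 0 (real n))"
  proof -
    have "\<exists>n. norm x \<le> real n" for x :: 'a by (rule real_arch_simple)
    then show ?thesis by auto
  qed
  then have "f ` K = (\<Union>n. f ` (K \<inter> cball 0 (real n)))" by blast
  moreover have "f ` (K \<inter> cball 0 (real n)) \<in> sets borel" for n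
    using assms by (intro borel_compact compact_continuous_image closed_Int_compact)
       (auto intro: continuous_on_subset)
  ultimately show ?thesis by auto
qed

context hermitian_matrices
begin

lemmas continuous_on_times = bounded_bilinear.continuous_on[OF bounded_bilinear_times]

lemma continuous_on_cj: "continuous_on X f \<Longrightarrow> continuous_on X (\<lambda>x. cj (f x))"
  by (rule continuous_on_compose2[OF linear_continuous_on[OF linear_cj[unfolded linear_conv_bounded_linear], of UNIV]])
     auto

definition outer :: "'f^'m \<Rightarrow> 'f^'m^'m" where
  "outer z = (\<chi> a b. z $ a * cj (z $ b))"

text \<open>Scalars act on the right, because over the quaternions this is the action that commutes
  with matrices (\<open>mv_rmul\<close>).\<close>

definition rmul :: "'f^'m \<Rightarrow> 'f \<Rightarrow> 'f^'m" where
  "rmul z l = (\<chi> a. z $ a * l)"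

lemma rmul_nth [simp]: "rmul z l $ a = z $ a * l" by (simp add: rmul_def)

lemma mv_rmul: "A *v rmul z l = rmul (A *v z) l"
  by (simp add: vec_eq_iff matrix_vector_mult_def sum_distrib_right mult.assoc)

lemma continuous_on_outer: "continuous_on X f \<Longrightarrow> continuous_on X (\<lambda>x. outer (f x))"
  unfolding outer_def by (intro continuous_on_vec_lambda continuous_on_times continuous_on_cj continuous_intros)

lemma measurable_outer [measurable]: "outer \<in> borel_measurable borel"
  by (intro borel_measurable_continuous_onI continuous_on_outer continuous_on_id)

text \<open>Turns the Laplace kernel at a rank-one matrix into a Gaussian function of the vector
  z.\<close>

lemma inner_outer: "A \<bullet> outer z = z \<bullet> (A *v z)"
proof -
  have "A $ a $ b \<bullet> (z $ a * cj (z $ b)) = z $ a \<bullet> (A $ a $ b * z $ b)" for a b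
    using inner_mult_right_cj[of "z $ a" "A $ a $ b" "z $ b"] inner_commute by metis
  then show ?thesis
    unfolding inner_mv by (simp add: inner_vec_def outer_def)
qed

lemma outer_Herm: "outer z \<in> Herm"
  by (simp add: Herm_def vec_eq_iff outer_def cj_mult)

lemma mat_one_inner_outer: "mat 1 \<bullet> outer z = z \<bullet> z"
  by (simp add: inner_outer)

lemma norm_outer: "norm (outer z) = z \<bullet> z"
proof -
  have "outer z \<bullet> outer z = (\<Sum>a\<in>UNIV. \<Sum>b\<in>UNIV. (z $ a \<bullet> z $ a) * (z $ b \<bullet> z $ b))"
    by (simp only: inner_vec_def outer_def vec_lambda_beta inner_mult_mult inner_cj_cj)
  also have "\<dots> = (z \<bullet> z)\<^sup>2"
    by (simp add: inner_vec_def[of z] power2_eq_square sum_product)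
  finally show ?thesis by (simp add: norm_eq_sqrt_inner)
qed

lemma outer_quad: "v \<bullet> (outer z *v v) = (\<Sum>b\<in>UNIV. cj (z $ b) * v $ b) \<bullet> (\<Sum>b\<in>UNIV. cj (z $ b) * v $ b)"
proof -
  let ?c = "\<Sum>b\<in>UNIV. cj (z $ b) * v $ b"
  have "(outer z *v v) $ a = z $ a * ?c" for a
    by (simp add: outer_def matrix_vector_mult_def sum_distrib_left mult.assoc)
  then have "v \<bullet> (outer z *v v) = (\<Sum>a\<in>UNIV. v $ a \<bullet> (z $ a * ?c))"
    by (simp add: inner_vec_def[of v])
  also have "\<dots> = (\<Sum>a\<in>UNIV. (cj (z $ a) * v $ a) \<bullet> ?c)"
  proof (intro sum.cong refl)
    fix a
    show "v $ a \<bullet> (z $ a * ?c) = (cj (z $ a) * v $ a) \<bullet> ?c"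
      using inner_cj[of "v $ a" "z $ a * ?c"] inner_cj[of "cj (z $ a) * v $ a" ?c]
      by (simp add: cj_mult mult.assoc)
  qed
  also have "\<dots> = ?c \<bullet> ?c" by (simp add: inner_sum_left)
  finally show ?thesis .
qed

lemma outer_quad_nonneg: "0 \<le> v \<bullet> (outer z *v v)"
  by (simp add: outer_quad)

lemma linear_axis: "linear (\<lambda>l. axis i l :: 'f^'m)"
  by (rule linearI) (auto simp: vec_eq_iff axis_def)

lemma measurable_axis [measurable]: "(\<lambda>l. axis i l :: 'f^'m) \<in> borel_measurable borel"
  by (intro borel_measurable_continuous_onI linear_continuous_on linear_axis[unfolded linear_conv_bounded_linear])

lemma measurable_quad [measurable]: "(\<lambda>v::'f^'m. v \<bullet> (A *v v)) \<in> borel_measurable borel"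
proof -
  have "continuous_on UNIV (\<lambda>v::'f^'m. (\<lambda>(A::'f^'m^'m, v). v \<bullet> (A *v v)) (A, v))"
    by (rule continuous_on_compose2[OF continuous_quad]) (auto intro: continuous_intros)
  then show ?thesis by (intro borel_measurable_continuous_onI) simp
qed

section \<open>Gaussian integrals over coordinate subspaces\<close>

definition hdim :: real where "hdim = real DIM('f) / 2"

definition supported :: "'m set \<Rightarrow> 'f^'m \<Rightarrow> bool" where
  "supported S v \<longleftrightarrow> (\<forall>a. a \<notin> S \<longrightarrow> v $ a = 0)"

lemma closed_supported: "closed {v. supported S v}"
proof -
  have "{v. supported S v} = (\<Inter>a\<in>-S. {v. v $ a = 0})" by (auto simp: supported_def)
  moreover have "closed {v::'f^'m. v $ a = 0}" for a
    by (intro closed_Collect_eq continuous_intros)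
  ultimately show ?thesis by auto
qed

text \<open>\<open>gaussian S c \<nu>\<close>: \<open>\<nu>\<close> is, up to a factor, Lebesgue measure on the vectors supported in \<open>S\<close>.\<close>

definition gaussian :: "'m set \<Rightarrow> real \<Rightarrow> ('f^'m) measure \<Rightarrow> bool" where
  "gaussian S c \<nu> \<longleftrightarrow> c > 0 \<and> sets \<nu> = sets borel \<and> (AE y in \<nu>. supported S y) \<and>
     (\<forall>w f. supported S w \<longrightarrow> f \<in> borel_measurable borel \<longrightarrow> (\<integral>\<^sup>+y. f (w + y) \<partial>\<nu>) = (\<integral>\<^sup>+y. f y \<partial>\<nu>)) \<and>
     (\<forall>A\<in>PosDef. \<forall>z. (\<forall>a\<in>S. (A *v z) $ a = 0) \<longrightarrow>
        (\<integral>\<^sup>+y. ennreal (exp (- ((z + y) \<bullet> (A *v (z + y))))) \<partial>\<nu>)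
          = ennreal (c * (exp (- (z \<bullet> (A *v z))) * minor S A powr (- hdim))))"

lemma gaussianD:
  assumes "gaussian S c \<nu>"
  shows "c > 0" "sets \<nu> = sets borel" "AE y in \<nu>. supported S y"
    "supported S w \<Longrightarrow> f \<in> borel_measurable borel \<Longrightarrow> (\<integral>\<^sup>+y. f (w + y) \<partial>\<nu>) = (\<integral>\<^sup>+y. f y \<partial>\<nu>)"
    "A \<in> PosDef \<Longrightarrow> (\<And>a. a \<in> S \<Longrightarrow> (A *v z) $ a = 0) \<Longrightarrow>
      (\<integral>\<^sup>+y. ennreal (exp (- ((z + y) \<bullet> (A *v (z + y))))) \<partial>\<nu>)
          = ennreal (c * (exp (- (z \<bullet> (A *v z))) * minor S A powr (- hdim)))"
  using assms unfolding gaussian_def by auto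

lemma gaussian_sigma_finite:
  assumes g: "gaussian S c \<nu>"
  shows "sigma_finite_measure \<nu>"
proof -
  note [measurable_cong] = gaussianD(2)[OF g]
  show ?thesis
  proof (rule sigma_finite_measureI_nn_integral[where h = "\<lambda>y. exp (- (y \<bullet> (mat 1 *v y)))"])
    show "(\<integral>\<^sup>+y. ennreal (exp (- (y \<bullet> (mat 1 *v y)))) \<partial>\<nu>) < \<infinity>"
      using gaussianD(5)[OF g mat_one_PosDef, of 0] by simp
  qed auto
qed

lemma pivot_quad:
  assumes u: "u $ i = 1" "\<And>a. a \<notin> insert i S \<Longrightarrow> u $ a = 0"
      "\<And>a. a \<in> S \<Longrightarrow> (A *v u) $ a = 0" "(A *v u) $ i = of_real p"
  shows "rmul u l \<bullet> (A *v rmul u l) = p * (l \<bullet> l)"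
proof -
  have u23: "u $ a = 0 \<or> (A *v u) $ a = 0" if "a \<noteq> i" for a
    using that u(2)[of a] u(3)[of a] by blast
  have "rmul u l \<bullet> (A *v rmul u l) = (\<Sum>a\<in>UNIV. (u $ a * l) \<bullet> ((A *v u) $ a * l))"
    by (simp add: mv_rmul inner_vec_def)
  also have "\<dots> = (\<Sum>a\<in>{i}. (u $ a * l) \<bullet> ((A *v u) $ a * l))"
    by (intro sum.mono_neutral_right) (use u23 in force)+
  also have "\<dots> = l \<bullet> (of_real p * l)" using u by simp
  finally show ?thesis by (simp add: of_real_def)
qed

text \<open>Completing the square: \<open>axis i l\<close> differs from \<open>rmul u l\<close> by a
  vector supported in S, which translation invariance absorbs, and \<open>rmul u l\<close> is
  orthogonal to S under A.\<close>

lemma gaussian_shift: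
  assumes g: "gaussian S c \<nu>" and A: "A \<in> PosDef" and i: "i \<notin> S"
    and u: "u $ i = 1" "\<And>a. a \<notin> insert i S \<Longrightarrow> u $ a = 0"
      "\<And>a. a \<in> S \<Longrightarrow> (A *v u) $ a = 0"
    and z: "\<And>a. a \<in> S \<Longrightarrow> (A *v z) $ a = 0"
  shows "(\<integral>\<^sup>+y. ennreal (exp (- ((z + axis i l + y) \<bullet> (A *v (z + axis i l + y))))) \<partial>\<nu>)
    = ennreal (c * (exp (- ((z + rmul u l) \<bullet> (A *v (z + rmul u l)))) * minor S A powr (- hdim)))"
proof -
  let ?w = "rmul u l - axis i l" and ?f = "\<lambda>y. ennreal (exp (- ((z + axis i l + y) \<bullet> (A *v (z + axis i l + y)))))"
  have "supported S ?w"
    using u(1,2) by (auto simp: supported_def axis_def)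
  then have "(\<integral>\<^sup>+y. ?f y \<partial>\<nu>) = (\<integral>\<^sup>+y. ?f (?w + y) \<partial>\<nu>)"
    by (intro gaussianD(4)[OF g, symmetric]) measurable
  also have "\<dots> = (\<integral>\<^sup>+y. ennreal (exp (- ((z + rmul u l + y) \<bullet> (A *v (z + rmul u l + y))))) \<partial>\<nu>)"
    by (simp add: algebra_simps)
  also have "\<dots> = ennreal (c * (exp (- ((z + rmul u l) \<bullet> (A *v (z + rmul u l)))) * minor S A powr (- hdim)))"
    by (rule gaussianD(5)[OF g A]) (use z u in \<open>simp add: mv_add mv_rmul\<close>)
  finally show ?thesis .
qed

text \<open>The new coordinate l is integrated last. The form at \<open>z + rmul u l\<close> is the
  form at z plus p * (l \<bullet> l), so l contributes p powr (- hdim), and p is the quotient of the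
  two minors.\<close>

lemma gaussian_insert:
  assumes g: "gaussian S c \<nu>" and i: "i \<notin> S"
  shows "gaussian (insert i S) (c * gauss_const TYPE('f)) (distr (lborel \<Otimes>\<^sub>M \<nu>) borel (\<lambda>(l, y). axis i l + y))"
    (is "gaussian _ _ ?\<nu>")
proof -
  interpret n: sigma_finite_measure \<nu> by (rule gaussian_sigma_finite[OF g])
  note [measurable_cong] = gaussianD(2)[OF g]
  have nn: "(\<integral>\<^sup>+y. f y \<partial>?\<nu>) = (\<integral>\<^sup>+l. \<integral>\<^sup>+y. f (axis i l + y) \<partial>\<nu> \<partial>lborel)"
    if [measurable]: "f \<in> borel_measurable borel" for f
    by (subst nn_integral_distr) (auto simp: case_prod_unfold n.nn_integral_fst[symmetric])
  show ?thesis
    unfolding gaussian_def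
  proof (intro conjI allI ballI impI)
    show "0 < c * gauss_const TYPE('f)"
      using gaussianD(1)[OF g] gauss_const(2) by (rule mult_pos_pos)
    show "AE y in ?\<nu>. supported (insert i S) y"
    proof (subst AE_distr_iff)
      show "AE x in lborel \<Otimes>\<^sub>M \<nu>. supported (insert i S) (case x of (l, y) \<Rightarrow> axis i l + y)"
        using n.AE_pair_snd[OF gaussianD(3)[OF g], of lborel]
        by (rule eventually_mono) (auto simp: supported_def axis_def case_prod_unfold)
      show "{x \<in> space borel. supported (insert i S) x} \<in> sets borel"
        using closed_supported by simp
    qed measurable
  next
    fix w and f :: "'f^'m \<Rightarrow> ennreal"
    assume w: "supported (insert i S) w" and [measurable]: "f \<in> borel_measurable borel"
    let ?w = "w - axis i (w $ i)"
    have w': "supported S ?w" using w by (auto simp: supported_def axis_def)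
    have [measurable]: "(\<lambda>y. f (w + y)) \<in> borel_measurable borel" by measurable
    have "(\<integral>\<^sup>+y. f (w + y) \<partial>?\<nu>) = (\<integral>\<^sup>+l. \<integral>\<^sup>+y. f (w + (axis i l + y)) \<partial>\<nu> \<partial>lborel)"
      by (rule nn) measurable
    also have "\<dots> = (\<integral>\<^sup>+l. \<integral>\<^sup>+y. f (axis i (w $ i + l) + y) \<partial>\<nu> \<partial>lborel)"
    proof (rule nn_integral_cong)
      fix l
      have "(\<integral>\<^sup>+y. f (w + (axis i l + y)) \<partial>\<nu>) = (\<integral>\<^sup>+y. f (axis i (w $ i + l) + (?w + y)) \<partial>\<nu>)"
        by (simp add: linear_add[OF linear_axis] algebra_simps)
      also have "\<dots> = (\<integral>\<^sup>+y. f (axis i (w $ i + l) + y) \<partial>\<nu>)"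
        by (rule gaussianD(4)[OF g w']) measurable
      finally show "(\<integral>\<^sup>+y. f (w + (axis i l + y)) \<partial>\<nu>) = (\<integral>\<^sup>+y. f (axis i (w $ i + l) + y) \<partial>\<nu>)" .
    qed
    also have "\<dots> = (\<integral>\<^sup>+l. \<integral>\<^sup>+y. f (axis i l + y) \<partial>\<nu> \<partial>(distr lborel borel ((+) (w $ i))))"
      by (subst nn_integral_distr) measurable
    also have "\<dots> = (\<integral>\<^sup>+l. \<integral>\<^sup>+y. f (axis i l + y) \<partial>\<nu> \<partial>lborel)"
      by (simp add: lborel_distr_plus)
    also have "\<dots> = (\<integral>\<^sup>+y. f y \<partial>?\<nu>)" by (rule nn[symmetric]) measurable
    finally show "(\<integral>\<^sup>+y. f (w + y) \<partial>?\<nu>) = (\<integral>\<^sup>+y. f y \<partial>?\<nu>)" .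
  next
    fix A z assume A: "A \<in> PosDef" and z: "\<forall>a\<in>insert i S. (A *v z) $ a = 0"
    obtain u p where u: "u $ i = 1" "\<And>a. a \<notin> insert i S \<Longrightarrow> u $ a = 0"
      "\<And>a. a \<in> S \<Longrightarrow> (A *v u) $ a = 0" "(A *v u) $ i = of_real p" "p > 0"
      using pivot_exists[OF A i] by blast
    have m: "minor (insert i S) A = p * minor S A"
      by (rule minor_insert[OF A i u(1) _ _ u(4,5)]) (use u in auto)
    let ?Q = "\<lambda>v. v \<bullet> (A *v v)"
    let ?k = "c * (exp (- ?Q z) * minor S A powr (- hdim))"
    have Q: "?Q (z + rmul u l) = ?Q z + p * (l \<bullet> l)" for l
    proof -
      have "rmul u l \<bullet> (A *v z) = (\<Sum>a\<in>(UNIV::'m set). 0)"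
        unfolding inner_vec_def
      proof (intro sum.cong refl)
        fix a show "rmul u l $ a \<bullet> (A *v z) $ a = 0"
          using z u(2)[of a] by (cases "a \<in> insert i S") auto
      qed
      moreover have "rmul u l \<bullet> (A *v rmul u l) = p * (l \<bullet> l)"
        by (rule pivot_quad[OF u(1) _ _ u(4), where S = S]) (use u in auto)
      ultimately show ?thesis by (simp add: quad_add[OF PosDef_Herm[OF A]])
    qed
    have "(\<integral>\<^sup>+y. ennreal (exp (- ?Q (z + y))) \<partial>?\<nu>)
        = (\<integral>\<^sup>+l. \<integral>\<^sup>+y. ennreal (exp (- ?Q (z + (axis i l + y)))) \<partial>\<nu> \<partial>lborel)"
      by (rule nn) measurable
    also have "\<dots> = (\<integral>\<^sup>+l. ennreal ?k * ennreal (exp (- (p * (l \<bullet> l)))) \<partial>(lborel :: 'f measure))"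
    proof (rule nn_integral_cong)
      fix l
      have 1: "(\<integral>\<^sup>+y. ennreal (exp (- ?Q (z + (axis i l + y)))) \<partial>\<nu>)
          = ennreal (c * (exp (- ?Q (z + rmul u l)) * minor S A powr (- hdim)))"
        unfolding add.assoc[symmetric]
        by (rule gaussian_shift[OF g A i u(1)]) (use u z in auto)
      have 2: "c * (exp (- ?Q (z + rmul u l)) * minor S A powr (- hdim)) = ?k * exp (- (p * (l \<bullet> l)))"
        unfolding Q by (simp add: exp_diff exp_minus field_simps exp_add)
      show "(\<integral>\<^sup>+y. ennreal (exp (- ?Q (z + (axis i l + y)))) \<partial>\<nu>) = ennreal ?k * ennreal (exp (- (p * (l \<bullet> l))))"
        unfolding 1 2 by (simp add: ennreal_mult'')
    qed
    also have "\<dots> = ennreal ?k * (\<integral>\<^sup>+l. ennreal (exp (- (p * (l \<bullet> l)))) \<partial>(lborel :: 'f measure))"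
      by (rule nn_integral_cmult) measurable
    also have "\<dots> = ennreal ?k * ennreal (gauss_const TYPE('f) * p powr (- real DIM('f) / 2))"
      by (simp only: nn_integral_gaussian[OF u(5)])
    also have "\<dots> = ennreal (?k * (gauss_const TYPE('f) * p powr (- real DIM('f) / 2)))"
      using gauss_const(2)[where 'f = 'f] by (simp add: ennreal_mult'')
    finally have 1: "(\<integral>\<^sup>+y. ennreal (exp (- ?Q (z + y))) \<partial>?\<nu>)
        = ennreal (?k * (gauss_const TYPE('f) * p powr (- real DIM('f) / 2)))" .
    have 2: "?k * (gauss_const TYPE('f) * p powr (- real DIM('f) / 2))
        = c * gauss_const TYPE('f) * (exp (- ?Q z) * minor (insert i S) A powr (- hdim))"
      using minor_pos[OF A, of S] u(5) by (simp add: m powr_mult hdim_def)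
    from 1 show "(\<integral>\<^sup>+y. ennreal (exp (- ?Q (z + y))) \<partial>?\<nu>)
        = ennreal (c * gauss_const TYPE('f) * (exp (- ?Q z) * minor (insert i S) A powr (- hdim)))"
      by (simp only: 2)
  qed simp
qed

lemma gaussian_exists: "\<exists>c \<nu>. gaussian S c \<nu>"
proof (induction S rule: finite_induct[OF finite])
  case 1
  have "gaussian {} 1 (dirac 0)"
    unfolding gaussian_def
  proof (intro conjI allI ballI impI)
    show "AE y in dirac 0. supported {} y"
    proof (rule AE_dirac)
      show "{y. supported {} y} \<in> sets borel" by (rule borel_closed[OF closed_supported])
    qed (simp add: supported_def)
    fix w and f :: "'f^'m \<Rightarrow> ennreal"
    assume "supported {} w" and [measurable]: "f \<in> borel_measurable borel"
    then have "w = 0" by (simp add: supported_def vec_eq_iff)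
    then show "(\<integral>\<^sup>+y. f (w + y) \<partial>dirac 0) = (\<integral>\<^sup>+y. f y \<partial>dirac 0)" by simp
  next
    fix A z assume "A \<in> PosDef" "\<forall>a\<in>{}. (A *v z) $ a = 0"
    have "(\<integral>\<^sup>+y. ennreal (exp (- ((z + y) \<bullet> (A *v (z + y))))) \<partial>dirac 0)
        = ennreal (exp (- ((z + 0) \<bullet> (A *v (z + 0)))))"
      by (rule nn_integral_dirac) measurable
    then show "(\<integral>\<^sup>+y. ennreal (exp (- ((z + y) \<bullet> (A *v (z + y))))) \<partial>dirac 0)
        = ennreal (1 * (exp (- (z \<bullet> (A *v z))) * minor {} A powr (- hdim)))"
      by (simp add: minor_empty)
  qed auto
  then show ?case by blast
next
  case (2 i S)
  then show ?case using gaussian_insert by blast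
qed

end

section \<open>Powers of minors as Laplace transforms\<close>

context hermitian_matrices
begin

text \<open>The condition on the entry at i holds almost everywhere for the measure of
  \<open>pivot_power_laplace\<close> and makes the rank grow in \<open>low_rank_add\<close>.\<close>

definition rank_one_set :: "'m \<Rightarrow> 'm set \<Rightarrow> ('f^'m^'m) set" where
  "rank_one_set i S = outer ` {z. supported (insert i S) z} \<inter> {B. B $ i $ i \<noteq> 0}"

lemma borel_rank_one_set: "rank_one_set i S \<in> sets borel"
proof -
  have "outer ` {z. supported (insert i S) z} \<in> sets borel"
    by (intro borel_image_closed closed_supported continuous_on_outer continuous_on_id)
  moreover have "open {B::'f^'m^'m. B $ i $ i \<noteq> 0}"
    by (intro open_Collect_neq continuous_intros)
  ultimately show ?thesis by (auto simp: rank_one_set_def)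
qed

text \<open>The measure is the image under \<open>z \<mapsto> z z\<^sup>*\<close> of \<open>t powr (s - 1) dt\<close> times Lebesgue measure,
  where \<open>z\<close> has entry \<open>sqrt t\<close> at \<open>i\<close> and arbitrary entries in \<open>S\<close>.\<close>

lemma pivot_power_laplace:
  assumes i: "i \<notin> S" and s: "s > 0"
  obtains \<mu> where
    "laplace_transform_on PosDef \<mu> (\<lambda>A. (minor (insert i S) A / minor S A) powr (- s) * minor S A powr (- hdim))"
    "AE B in \<mu>. B \<in> rank_one_set i S"
proof -
  obtain c \<nu> where g: "gaussian S c \<nu>" using gaussian_exists by blast
  interpret n: sigma_finite_measure \<nu> by (rule gaussian_sigma_finite[OF g])
  note [measurable_cong] = gaussianD(2)[OF g]
  define \<gamma> where "\<gamma> = density lborel (\<lambda>t::real. ennreal (indicator {0<..} t * t powr (s - 1)))"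
  have [measurable_cong]: "sets \<gamma> = sets borel" by (simp add: \<gamma>_def)
  define \<phi> where "\<phi> = (\<lambda>(t, y). outer (axis i (of_real (sqrt t)) + y))"
  have [measurable]: "(\<lambda>t. of_real (sqrt t) :: 'f) \<in> borel_measurable borel"
    unfolding of_real_def by measurable
  have \<phi>[measurable]: "\<phi> \<in> borel_measurable (\<gamma> \<Otimes>\<^sub>M \<nu>)" unfolding \<phi>_def by measurable
  define \<mu> where "\<mu> = distr (\<gamma> \<Otimes>\<^sub>M \<nu>) borel \<phi>"
  let ?g = "\<lambda>A. (minor (insert i S) A / minor S A) powr (- s) * minor S A powr (- hdim)"
  have "(\<integral>\<^sup>+B. ennreal (exp (- (A \<bullet> B))) \<partial>\<mu>) = ennreal (c * Gamma s * ?g A)" if A: "A \<in> PosDef" for A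
  proof -
    obtain u p where u: "u $ i = 1" "\<And>a. a \<notin> insert i S \<Longrightarrow> u $ a = 0"
      "\<And>a. a \<in> S \<Longrightarrow> (A *v u) $ a = 0" "(A *v u) $ i = of_real p" "p > 0"
      using pivot_exists[OF A i] by blast
    have m: "minor (insert i S) A = p * minor S A"
      by (rule minor_insert[OF A i u(1) _ _ u(4,5)]) (use u in auto)
    let ?k = "c * minor S A powr (- hdim)"
    have k: "?k > 0" using gaussianD(1)[OF g] minor_pos[OF A, of S] by simp
    have "(\<integral>\<^sup>+B. ennreal (exp (- (A \<bullet> B))) \<partial>\<mu>) = (\<integral>\<^sup>+z. ennreal (exp (- (A \<bullet> \<phi> z))) \<partial>(\<gamma> \<Otimes>\<^sub>M \<nu>))"
      unfolding \<mu>_def by (rule nn_integral_distr) measurable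
    also have "\<dots> = (\<integral>\<^sup>+t. \<integral>\<^sup>+y. ennreal (exp (- (A \<bullet> \<phi> (t, y)))) \<partial>\<nu> \<partial>\<gamma>)"
      by (rule n.nn_integral_fst[symmetric]) measurable
    also have "\<dots> = (\<integral>\<^sup>+t. ennreal (indicator {0<..} t * t powr (s - 1)) *
        (\<integral>\<^sup>+y. ennreal (exp (- (A \<bullet> \<phi> (t, y)))) \<partial>\<nu>) \<partial>lborel)"
      unfolding \<gamma>_def by (rule nn_integral_density) measurable
    also have "\<dots> = (\<integral>\<^sup>+t. ennreal ?k * ennreal (indicator {0<..} t * t powr (s - 1) * exp (- (p * t))) \<partial>lborel)"
    proof (rule nn_integral_cong)
      fix t :: real
      show "ennreal (indicator {0<..} t * t powr (s - 1)) * (\<integral>\<^sup>+y. ennreal (exp (- (A \<bullet> \<phi> (t, y)))) \<partial>\<nu>)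
        = ennreal ?k * ennreal (indicator {0<..} t * t powr (s - 1) * exp (- (p * t)))"
      proof (cases "t > 0")
        case True
        let ?l = "of_real (sqrt t) :: 'f"
        have "?l \<bullet> ?l = t"
          using True inner_one_one by (simp add: of_real_def)
        then have Q: "rmul u ?l \<bullet> (A *v rmul u ?l) = p * t"
          using pivot_quad[OF u(1) _ _ u(4), where S = S, of ?l] u(2,3) by simp
        have "(\<integral>\<^sup>+y. ennreal (exp (- (A \<bullet> \<phi> (t, y)))) \<partial>\<nu>)
          = (\<integral>\<^sup>+y. ennreal (exp (- ((0 + axis i ?l + y) \<bullet> (A *v (0 + axis i ?l + y))))) \<partial>\<nu>)"
          by (simp add: \<phi>_def inner_outer)
        also have "\<dots> = ennreal (c * (exp (- ((0 + rmul u ?l) \<bullet> (A *v (0 + rmul u ?l)))) * minor S A powr (- hdim)))"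
          by (rule gaussian_shift[OF g A i u(1)]) (use u in auto)
        also have "\<dots> = ennreal (?k * exp (- (p * t)))"
          by (simp add: Q mult_ac)
        finally have 1: "(\<integral>\<^sup>+y. ennreal (exp (- (A \<bullet> \<phi> (t, y)))) \<partial>\<nu>) = ennreal (?k * exp (- (p * t)))" .
        show ?thesis
          unfolding 1 using k by (simp add: ennreal_mult'[symmetric] ennreal_mult''[symmetric] mult_ac)
      qed simp
    qed
    also have "\<dots> = ennreal ?k * (\<integral>\<^sup>+t. ennreal (indicator {0<..} t * t powr (s - 1) * exp (- (p * t))) \<partial>lborel)"
      by (rule nn_integral_cmult) measurable
    also have "\<dots> = ennreal ?k * ennreal (Gamma s * p powr (- s))"
      by (simp only: gamma_laplace[OF u(5) s])
    also have "\<dots> = ennreal (?k * (Gamma s * p powr (- s)))"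
      using k by (simp only: ennreal_mult' less_imp_le)
    also have "\<dots> = ennreal (c * Gamma s * ?g A)"
      using minor_pos[OF A, of S] by (simp add: m mult_ac)
    finally show ?thesis .
  qed
  moreover have pos: "c * Gamma s > 0" using gaussianD(1)[OF g] Gamma_real_pos[OF s] by simp
  ultimately have L: "laplace_transform_on PosDef \<mu> (\<lambda>A. c * Gamma s * ?g A)"
    using pos by (auto simp: laplace_transform_on_def \<mu>_def intro!: mult_nonneg_nonneg)
  have "AE t in \<gamma>. t > 0"
    unfolding \<gamma>_def by (subst AE_density) (auto simp: indicator_def)
  from n.AE_pair_fst[OF this] n.AE_pair_snd[OF gaussianD(3)[OF g]]
  have "AE z in \<gamma> \<Otimes>\<^sub>M \<nu>. \<phi> z \<in> rank_one_set i S"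
  proof eventually_elim
    case (elim z)
    obtain t y where z: "z = (t, y)" by force
    let ?w = "axis i (of_real (sqrt t)) + y"
    have "supported (insert i S) ?w"
      using elim by (auto simp: z supported_def axis_def)
    moreover have "?w $ i = of_real (sqrt t)"
      using elim i by (auto simp: z supported_def)
    then have "outer ?w $ i $ i \<noteq> 0"
      using elim by (simp add: outer_def z flip: of_real_mult)
    ultimately show ?case by (auto simp: rank_one_set_def z \<phi>_def)
  qed
  then have AE: "AE B in \<mu>. B \<in> rank_one_set i S"
    unfolding \<mu>_def by (subst AE_distr_iff) (use borel_rank_one_set in auto)
  show ?thesis
    by (rule laplace_transform_on_scale[OF L pos AE]) (rule that)
qed

lemma inner_outer_nonneg: "A \<in> PosDef \<Longrightarrow> 0 \<le> A \<bullet> outer z"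
  by (simp add: inner_outer PosDef_nonneg)

text \<open>For n = 0 every \<beta> qualifies, since the empty minor is 1. This starts the induction
  in which each index lowers \<beta> by \<open>hdim\<close>.\<close>

definition wallach :: "nat \<Rightarrow> real set" where
  "wallach n = {\<beta>. n = 0 \<or> (real n - 1) * hdim \<le> \<beta> \<or> (\<exists>k::nat. \<beta> = real k * hdim)}"

lemma hdim_pos: "hdim > 0" by (simp add: hdim_def)

lemma wallach_nonneg: "\<beta> \<in> wallach (Suc n) \<Longrightarrow> 0 \<le> \<beta>"
  using hdim_pos by (auto simp: wallach_def intro: order_trans[rotated] mult_nonneg_nonneg)

lemma wallach_Suc: "\<beta> \<in> wallach (Suc n) \<Longrightarrow> \<beta> \<noteq> 0 \<Longrightarrow> \<beta> - hdim \<in> wallach n"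
proof -
  assume b: "\<beta> \<in> wallach (Suc n)" "\<beta> \<noteq> 0"
  then consider "real n * hdim \<le> \<beta>" | k :: nat where "\<beta> = real k * hdim"
    by (auto simp: wallach_def)
  then show ?thesis
  proof cases
    case 1
    then show ?thesis by (simp add: wallach_def algebra_simps)
  next
    case 2
    then obtain j where "k = Suc j" using b(2) by (cases k) auto
    then have "\<beta> - hdim = real j * hdim" using 2 by (simp add: algebra_simps)
    then show ?thesis by (auto simp: wallach_def)
  qed
qed

text \<open>With p the pivot at i, minor (insert i S) powr (- \<beta>) splits into p powr (-
  \<beta>) * minor S powr (- hdim) and minor S powr (- (\<beta> - hdim)).
  \<open>pivot_power_laplace\<close> represents the former for \<beta> > 0; the case \<beta> = 0 is
  the point mass at 0.\<close>

lemma minor_power_laplace: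
  "\<beta> \<in> wallach (card S) \<Longrightarrow>
    \<exists>\<mu>. laplace_transform_on PosDef \<mu> (\<lambda>A. minor S A powr (- \<beta>)) \<and> (AE B in \<mu>. \<forall>A\<in>PosDef. 0 \<le> A \<bullet> B)"
proof (induction S arbitrary: \<beta> rule: finite_induct[OF finite])
  case (1 \<beta>)
  have cl: "{B. \<forall>A\<in>PosDef. 0 \<le> A \<bullet> B} \<in> sets borel"
  proof -
    have "{B. \<forall>A\<in>PosDef. 0 \<le> A \<bullet> B} = (\<Inter>A\<in>PosDef. {B. 0 \<le> A \<bullet> B})" by auto
    moreover have "closed {B. 0 \<le> A \<bullet> B}" for A :: "'f^'m^'m"
      by (intro closed_Collect_le continuous_intros)
    ultimately show ?thesis by (metis (no_types, lifting) borel_closed closed_INT)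
  qed
  have "AE B in dirac 0. \<forall>A\<in>PosDef. 0 \<le> A \<bullet> B"
    by (rule AE_dirac[OF cl]) simp
  moreover have "laplace_transform_on PosDef (dirac 0) (\<lambda>A. minor {} A powr (- \<beta>))"
    using laplace_transform_on_dirac by (simp add: minor_empty)
  ultimately show ?case by blast
next
  case (2 i S \<beta>)
  have cl: "{B. \<forall>A\<in>PosDef. 0 \<le> A \<bullet> B} \<in> sets borel"
  proof -
    have "{B. \<forall>A\<in>PosDef. 0 \<le> A \<bullet> B} = (\<Inter>A\<in>PosDef. {B. 0 \<le> A \<bullet> B})" by auto
    moreover have "closed {B. 0 \<le> A \<bullet> B}" for A :: "'f^'m^'m"
      by (intro closed_Collect_le continuous_intros)
    ultimately show ?thesis by (metis (no_types, lifting) borel_closed closed_INT)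
  qed
  have b: "\<beta> \<in> wallach (Suc (card S))" using 2 by simp
  show ?case
  proof (cases "\<beta> = 0")
    case True
    have "AE B in dirac 0. \<forall>A\<in>PosDef. 0 \<le> A \<bullet> B"
      by (rule AE_dirac[OF cl]) simp
    moreover have "laplace_transform_on PosDef (dirac 0) (\<lambda>A. minor (insert i S) A powr (- \<beta>))"
      by (rule laplace_transform_on_cong[OF laplace_transform_on_dirac])
         (use True minor_pos in \<open>simp add: less_imp_neq[symmetric]\<close>)
    ultimately show ?thesis by blast
  next
    case False
    then have pos: "\<beta> > 0" using wallach_nonneg[OF b] by simp
    obtain \<mu> where \<mu>: "laplace_transform_on PosDef \<mu> (\<lambda>A. minor S A powr (- (\<beta> - hdim)))"
      "AE B in \<mu>. \<forall>A\<in>PosDef. 0 \<le> A \<bullet> B"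
      using 2(3)[OF wallach_Suc[OF b False]] by blast
    obtain \<nu> where \<nu>: "laplace_transform_on PosDef \<nu> (\<lambda>A. (minor (insert i S) A / minor S A) powr (- \<beta>) * minor S A powr (- hdim))"
      "AE B in \<nu>. B \<in> rank_one_set i S"
      by (rule pivot_power_laplace[OF 2(2) pos])
    obtain \<rho> where \<rho>: "laplace_transform_on PosDef \<rho> (\<lambda>A. minor S A powr (- (\<beta> - hdim)) *
        ((minor (insert i S) A / minor S A) powr (- \<beta>) * minor S A powr (- hdim)))"
      "AE B in \<rho>. \<forall>A\<in>PosDef. 0 \<le> A \<bullet> B"
    proof (rule laplace_transform_on_mult[OF \<mu>(1) \<nu>(1) mat_one_PosDef \<mu>(2) \<nu>(2)])
      fix x y assume "\<forall>A\<in>PosDef. 0 \<le> A \<bullet> x" "y \<in> rank_one_set i S"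
      then show "\<forall>A\<in>PosDef. 0 \<le> A \<bullet> (x + y)"
        using inner_outer_nonneg by (auto simp: rank_one_set_def inner_add_right)
    qed (use cl in auto)
    have "laplace_transform_on PosDef \<rho> (\<lambda>A. minor (insert i S) A powr (- \<beta>))"
    proof (rule laplace_transform_on_cong[OF \<rho>(1)])
      fix A assume A: "A \<in> PosDef"
      have p: "minor S A > 0" "minor (insert i S) A > 0" using minor_pos[OF A] by auto
      have "minor S A powr (- (\<beta> - hdim)) * (minor S A powr (- hdim) / minor S A powr (- \<beta>)) = 1"
        using p by (simp flip: powr_add powr_diff)
      then show "minor S A powr (- (\<beta> - hdim)) *
        ((minor (insert i S) A / minor S A) powr (- \<beta>) * minor S A powr (- hdim)) = minor (insert i S) A powr (- \<beta>)"
        using p by (simp add: powr_divide field_simps)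
    qed
    with \<rho>(2) show ?thesis by blast
  qed
qed

lemma alternating_minor_power:
  assumes "\<beta> \<in> wallach (card S)"
  shows "alternating PosDef (\<lambda>A. minor S A powr (- \<beta>))"
proof -
  obtain \<mu> where "laplace_transform_on PosDef \<mu> (\<lambda>A. minor S A powr (- \<beta>))" "AE B in \<mu>. \<forall>A\<in>PosDef. 0 \<le> A \<bullet> B"
    using minor_power_laplace[OF assms] by blast
  then show ?thesis by (intro alternating_laplace_transform PosDef_add)
qed

section \<open>Matrices of low rank\<close>

text \<open>The rows of Z indexed by S serve as a family of vectors.\<close>

definition sum_outer :: "'m set \<Rightarrow> 'f^'m^'m \<Rightarrow> 'f^'m^'m" where
  "sum_outer S Z = (\<Sum>j\<in>S. outer (Z $ j))"

text \<open>Positive semidefinite matrices on the block \<open>insert r S\<close>, of rank at most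
  card S, that are definite on the hyperplane v $ r = 0. A difference of two images of closed sets
  is Borel; restricting v to unit vectors keeps the second set closed.\<close>

definition low_rank :: "'m \<Rightarrow> 'm set \<Rightarrow> ('f^'m^'m) set" where
  "low_rank r S = sum_outer S ` {Z. \<forall>j\<in>S. supported (insert r S) (Z $ j)} -
     fst ` {(B, v). supported (insert r S) v \<and> v $ r = 0 \<and> norm v = 1 \<and> v \<bullet> (B *v v) = 0}"

lemma borel_low_rank: "low_rank r S \<in> sets borel"
proof -
  have "closed {Z::'f^'m^'m. supported T (Z $ j)}" for T j
    using continuous_closed_vimage[OF closed_supported, of "\<lambda>Z. Z $ j" T]
    by (auto simp: vimage_def intro!: continuous_intros)
  moreover have "{Z::'f^'m^'m. \<forall>j\<in>S. supported (insert r S) (Z $ j)} = (\<Inter>j\<in>S. {Z. supported (insert r S) (Z $ j)})"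
    by auto
  ultimately have "closed {Z::'f^'m^'m. \<forall>j\<in>S. supported (insert r S) (Z $ j)}" by auto
  moreover have "continuous_on X (sum_outer S)" for X
    unfolding sum_outer_def[abs_def] by (intro continuous_intros continuous_on_outer)
  ultimately have 1: "sum_outer S ` {Z. \<forall>j\<in>S. supported (insert r S) (Z $ j)} \<in> sets borel"
    by (rule borel_image_closed)
  have "closed {(B::'f^'m^'m, v). supported (insert r S) v \<and> v $ r = 0 \<and> norm v = 1 \<and> v \<bullet> (B *v v) = 0}"
  proof -
    have "{(B::'f^'m^'m, v). supported (insert r S) v \<and> v $ r = 0 \<and> norm v = 1 \<and> v \<bullet> (B *v v) = 0}
      = (snd -` {v. supported (insert r S) v}) \<inter> {x. snd x $ r = 0} \<inter> {x. norm (snd x) = 1}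
        \<inter> {x. (case x of (B, v) \<Rightarrow> v \<bullet> (B *v v)) = 0}"
      by auto
    moreover have "closed (snd -` {v. supported (insert r S) v} :: (('f^'m^'m) \<times> ('f^'m)) set)"
      by (intro continuous_closed_vimage closed_supported continuous_intros)
    moreover have "closed {x::('f^'m^'m) \<times> ('f^'m). snd x $ r = 0}" "closed {x::('f^'m^'m) \<times> ('f^'m). norm (snd x) = 1}"
      by (intro closed_Collect_eq continuous_intros)+
    moreover have "closed {x::('f^'m^'m) \<times> ('f^'m). (case x of (B, v) \<Rightarrow> v \<bullet> (B *v v)) = 0}"
      by (intro closed_Collect_eq continuous_quad continuous_intros)
    ultimately show ?thesis by auto
  qed
  then have "fst ` {(B::'f^'m^'m, v). supported (insert r S) v \<and> v $ r = 0 \<and> norm v = 1 \<and> v \<bullet> (B *v v) = 0} \<in> sets borel"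
    by (rule borel_image_closed) (intro continuous_intros)
  with 1 show ?thesis unfolding low_rank_def by auto
qed

lemma supported_mono: "supported S v \<Longrightarrow> S \<subseteq> T \<Longrightarrow> supported T v"
  by (auto simp: supported_def)

lemma sum_mv:
  fixes f :: "'b \<Rightarrow> 'f^'m^'m"
  shows "(\<Sum>j\<in>S. f j) *v v = (\<Sum>j\<in>S. f j *v v)"
proof -
  have "linear (\<lambda>M::'f^'m^'m. M *v v)"
    by (rule linearI) (auto simp: mv_add_left mv_scaleR_left)
  from linear_sum[OF this, of f S] show ?thesis by simp
qed

lemma sum_outer_quad: "v \<bullet> (sum_outer S Z *v v) = (\<Sum>j\<in>S. v \<bullet> (outer (Z $ j) *v v))"
  by (simp add: sum_outer_def sum_mv inner_sum_right)

lemma low_rankE: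
  assumes "B \<in> low_rank r S"
  obtains Z where "B = sum_outer S Z" "\<And>j. j \<in> S \<Longrightarrow> supported (insert r S) (Z $ j)"
    "\<And>v. supported (insert r S) v \<Longrightarrow> v $ r = 0 \<Longrightarrow> v \<bullet> (B *v v) = 0 \<Longrightarrow> v = 0"
proof -
  obtain Z where Z: "B = sum_outer S Z" "\<And>j. j \<in> S \<Longrightarrow> supported (insert r S) (Z $ j)"
    using assms by (auto simp: low_rank_def)
  have "v = 0" if v: "supported (insert r S) v" "v $ r = 0" "v \<bullet> (B *v v) = 0" for v
  proof (rule ccontr)
    assume nz: "v \<noteq> 0"
    let ?w = "(1 / norm v) *\<^sub>R v"
    have "supported (insert r S) ?w" "?w $ r = 0" "norm ?w = 1" "?w \<bullet> (B *v ?w) = 0"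
      using v nz by (auto simp: supported_def mv_scaleR)
    then have "B \<in> fst ` {(B, v). supported (insert r S) v \<and> v $ r = 0 \<and> norm v = 1 \<and> v \<bullet> (B *v v) = 0}"
      by force
    with assms show False by (simp add: low_rank_def)
  qed
  with Z that show ?thesis by blast
qed

lemma low_rankI:
  assumes "B = sum_outer S Z" "\<And>j. j \<in> S \<Longrightarrow> supported (insert r S) (Z $ j)"
    "\<And>v. supported (insert r S) v \<Longrightarrow> v $ r = 0 \<Longrightarrow> v \<bullet> (B *v v) = 0 \<Longrightarrow> v = 0"
  shows "B \<in> low_rank r S"
  unfolding low_rank_def using assms by force

lemma zero_low_rank: "0 \<in> low_rank r {}"
  by (rule low_rankI) (auto simp: sum_outer_def supported_def vec_eq_iff)

text \<open>If the form of B + X vanishes at v, so do both nonnegative summands. The one of B does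
  not see coordinate i and forces v to vanish on \<open>insert r S\<close>; the one of X then
  reduces to the product of cj (z $ i) and v $ i, with z $ i \<noteq> 0.\<close>

lemma low_rank_add:
  assumes i: "i \<notin> S" "i \<noteq> r" and B: "B \<in> low_rank r S" and X: "X \<in> rank_one_set i (insert r S)"
  shows "B + X \<in> low_rank r (insert i S)"
proof -
  obtain Z where Z: "B = sum_outer S Z" "\<And>j. j \<in> S \<Longrightarrow> supported (insert r S) (Z $ j)"
    "\<And>v. supported (insert r S) v \<Longrightarrow> v $ r = 0 \<Longrightarrow> v \<bullet> (B *v v) = 0 \<Longrightarrow> v = 0"
    using low_rankE[OF B] by blast
  obtain z where z: "X = outer z" "supported (insert i (insert r S)) z"
    using X by (auto simp: rank_one_set_def)
  have zi: "z $ i \<noteq> 0" using X by (auto simp: rank_one_set_def z(1) outer_def)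
  define Z' where "Z' = (\<chi> j. if j = i then z else Z $ j)"
  show ?thesis
  proof (rule low_rankI[of _ _ Z'])
    show "B + X = sum_outer (insert i S) Z'"
      using i by (simp add: Z(1) z(1) sum_outer_def Z'_def) (auto intro!: sum.cong)
    show "supported (insert r (insert i S)) (Z' $ j)" if "j \<in> insert i S" for j
      using that z(2) Z(2)[of j] by (auto simp: Z'_def insert_commute intro: supported_mono)
    fix v assume v: "supported (insert r (insert i S)) v" "v $ r = 0" "v \<bullet> ((B + X) *v v) = 0"
    have B0: "0 \<le> w \<bullet> (B *v w)" for w
      by (simp add: Z(1) sum_outer_quad outer_quad_nonneg sum_nonneg)
    have "v \<bullet> (B *v v) + v \<bullet> (X *v v) = 0" using v(3) by (simp add: mv_add_left inner_add_right)
    then have vB: "v \<bullet> (B *v v) = 0" and vX: "v \<bullet> (X *v v) = 0"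
      using B0[of v] outer_quad_nonneg[of v z] by (auto simp: z(1))
    let ?w = "restrict_vec (insert r S) v"
    have "v \<bullet> (outer (Z $ j) *v v) = ?w \<bullet> (outer (Z $ j) *v ?w)" if "j \<in> S" for j
    proof -
      have "(\<Sum>b\<in>UNIV. cj (Z $ j $ b) * v $ b) = (\<Sum>b\<in>UNIV. cj (Z $ j $ b) * ?w $ b)"
        using Z(2)[OF that] by (intro sum.cong) (auto simp: supported_def restrict_vec_def)
      then show ?thesis by (simp add: outer_quad)
    qed
    then have "?w \<bullet> (B *v ?w) = 0"
      using vB by (simp add: Z(1) sum_outer_quad)
    then have w0: "?w = 0"
      using v(2) by (intro Z(3)) (auto simp: supported_def restrict_vec_def)
    have v0: "v $ b = 0" if "b \<noteq> i" for b
    proof (cases "b \<in> insert r S")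
      case True
      then have "v $ b = ?w $ b" by (simp add: restrict_vec_def)
      then show ?thesis by (simp add: w0)
    next
      case False
      then show ?thesis using v(1) that by (auto simp: supported_def)
    qed
    have "(\<Sum>b\<in>UNIV. cj (z $ b) * v $ b) = 0" using vX by (simp add: z(1) outer_quad)
    moreover have "(\<Sum>b\<in>UNIV. cj (z $ b) * v $ b) = (\<Sum>b\<in>{i}. cj (z $ b) * v $ b)"
      using v0 by (intro sum.mono_neutral_right) auto
    ultimately have "cj (z $ i) * v $ i = 0" by simp
    then have "(z $ i \<bullet> z $ i) * (v $ i \<bullet> v $ i) = 0"
      using inner_mult_mult[of "cj (z $ i)" "v $ i"] by (simp add: inner_cj_cj)
    then have "v $ i = 0" using zi by simp
    with v0 show "v = 0" by (metis vec_eq_iff zero_index)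
  qed
qed

text \<open>Here \<open>A \<bullet> outer (axis r 1)\<close> is the diagonal entry of \<open>A\<close> at \<open>r\<close>.\<close>

lemma minor_power_low_rank:
  "r \<notin> S \<Longrightarrow> S = {} \<or> (real (card S) - 1) * hdim < \<beta> \<Longrightarrow>
    \<exists>\<mu>. laplace_transform_on PosDef \<mu>
      (\<lambda>A. minor (insert r S) A powr (- \<beta>) * (A \<bullet> outer (axis r 1)) powr (\<beta> - real (card S) * hdim)) \<and>
      (AE B in \<mu>. B \<in> low_rank r S)"
proof (induction S arbitrary: \<beta> rule: finite_induct[OF finite])
  case (1 \<beta>)
  \<comment> \<open>For a single index the minor is the diagonal entry itself, and the two powers
    cancel.\<close>
  have "minor {r} A powr (- \<beta>) * (A \<bullet> outer (axis r 1)) powr (\<beta> - real (card {}) * hdim) = 1"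
    if A: "A \<in> PosDef" for A
  proof -
    obtain u p where u: "u $ r = 1" "\<And>a. a \<notin> insert r {} \<Longrightarrow> u $ a = 0"
      "\<And>a. a \<in> {} \<Longrightarrow> (A *v u) $ a = 0" "(A *v u) $ r = of_real p" "p > 0"
      using pivot_exists[OF A, of r "{}"] by blast
    have m: "minor {r} A = p"
      using minor_insert[OF A _ u(1) _ _ u(4,5), of "{}"] u by (simp add: minor_empty)
    have "u = axis r 1" using u(1,2) by (auto simp: vec_eq_iff axis_def)
    moreover have "rmul u 1 \<bullet> (A *v rmul u 1) = p * ((1::'f) \<bullet> 1)"
      by (rule pivot_quad[OF u(1) _ _ u(4), where S = "{}"]) (use u in auto)
    moreover have "rmul u 1 = u" by (simp add: vec_eq_iff)
    ultimately have "A \<bullet> outer (axis r 1) = p" by (simp add: inner_outer inner_one_one)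
    then show ?thesis using u(5) by (simp add: m flip: powr_add)
  qed
  then have "laplace_transform_on PosDef (dirac 0)
      (\<lambda>A. minor {r} A powr (- \<beta>) * (A \<bullet> outer (axis r 1)) powr (\<beta> - real (card {}) * hdim))"
    by (intro laplace_transform_on_cong[OF laplace_transform_on_dirac]) simp
  moreover have "AE B in dirac 0. B \<in> low_rank r {}"
    by (rule AE_dirac) (use borel_low_rank zero_low_rank in auto)
  ultimately show ?case by blast
next
  case (2 i S \<beta>)
  have r: "r \<notin> S" "r \<noteq> i" and b: "real (card S) * hdim < \<beta>" using 2 by auto
  then have pos: "\<beta> > 0" using hdim_pos by (smt (verit) mult_nonneg_nonneg of_nat_0_le_iff)
  \<comment> \<open>Removing one index lowers \<beta> and its bound by \<open>hdim\<close> alike. So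
    every pivot exponent is positive, while the exponent of the diagonal entry is the same at each
    stage.\<close>
  have "S = {} \<or> (real (card S) - 1) * hdim < \<beta> - hdim"
    using b by (simp add: algebra_simps)
  from 2(3)[OF r(1) this] obtain \<mu> where \<mu>: "laplace_transform_on PosDef \<mu>
      (\<lambda>A. minor (insert r S) A powr (- (\<beta> - hdim)) * (A \<bullet> outer (axis r 1)) powr (\<beta> - hdim - real (card S) * hdim))"
      "AE B in \<mu>. B \<in> low_rank r S"
    by blast
  obtain \<nu> where \<nu>: "laplace_transform_on PosDef \<nu> (\<lambda>A. (minor (insert i (insert r S)) A / minor (insert r S) A) powr (- \<beta>) *
      minor (insert r S) A powr (- hdim))" "AE B in \<nu>. B \<in> rank_one_set i (insert r S)"
    using pivot_power_laplace[of i "insert r S", OF _ pos] 2 r by auto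
  obtain \<rho> where \<rho>: "laplace_transform_on PosDef \<rho> (\<lambda>A. (minor (insert r S) A powr (- (\<beta> - hdim)) *
      (A \<bullet> outer (axis r 1)) powr (\<beta> - hdim - real (card S) * hdim)) *
      ((minor (insert i (insert r S)) A / minor (insert r S) A) powr (- \<beta>) * minor (insert r S) A powr (- hdim)))"
      "AE B in \<rho>. B \<in> low_rank r (insert i S)"
  proof (rule laplace_transform_on_mult[OF \<mu>(1) \<nu>(1) mat_one_PosDef \<mu>(2) \<nu>(2)])
    show "x + y \<in> low_rank r (insert i S)" if "x \<in> low_rank r S" "y \<in> rank_one_set i (insert r S)" for x y
      using low_rank_add[OF _ _ that] 2 r by auto
  qed (use borel_low_rank in auto)
  have "laplace_transform_on PosDef \<rho> (\<lambda>A. minor (insert r (insert i S)) A powr (- \<beta>) *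
      (A \<bullet> outer (axis r 1)) powr (\<beta> - real (card (insert i S)) * hdim))"
  proof (rule laplace_transform_on_cong[OF \<rho>(1)])
    fix A assume A: "A \<in> PosDef"
    let ?M = "minor (insert r S) A" and ?N = "minor (insert i (insert r S)) A"
    have p: "?M > 0" "?N > 0" using minor_pos[OF A] by auto
    have 1: "?M powr (- (\<beta> - hdim)) * (?M powr (- hdim) / ?M powr (- \<beta>)) = 1"
      using p by (simp flip: powr_add powr_diff)
    have 2: "\<beta> - hdim - real (card S) * hdim = \<beta> - real (card (insert i S)) * hdim"
      using 2 by (simp add: algebra_simps)
    have 3: "insert r (insert i S) = insert i (insert r S)" by (rule insert_commute)
    show "(?M powr (- (\<beta> - hdim)) * (A \<bullet> outer (axis r 1)) powr (\<beta> - hdim - real (card S) * hdim)) *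
      ((?N / ?M) powr (- \<beta>) * ?M powr (- hdim)) = minor (insert r (insert i S)) A powr (- \<beta>) *
      (A \<bullet> outer (axis r 1)) powr (\<beta> - real (card (insert i S)) * hdim)"
      unfolding 2 3 using 1 p by (simp add: powr_divide field_simps)
  qed
  with \<rho>(2) show ?case by blast
qed

end

section \<open>The Wallach set\<close>

context hermitian_matrices
begin

lemma completely_monotone_PosDef:
  assumes f: "\<And>A. A \<in> PosDef \<Longrightarrow> f A = (Pd A powr e) powr (- \<beta>)" and \<beta>: "\<beta> \<in> wallach CARD('m)"
  shows "completely_monotone Herm PosDef f"
proof (rule alternating_imp_completely_monotone[OF open_convex_cone_PosDef])
  have pos: "Pd A > 0" if "A \<in> PosDef" for A
    using Pd_block_pos[OF that, of UNIV] by (simp add: block_one_UNIV)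
  show "smooth_on_open_of Herm PosDef f"
    by (rule smooth_on_open_of_powr[where P = Pd and a = "e * (- \<beta>)"])
       (use f pos in \<open>auto simp: powr_powr subspace_Herm openin_PosDef Pd_poly\<close>)
  have "alternating PosDef (\<lambda>A. minor UNIV A powr (- \<beta>))"
    by (rule alternating_minor_power[OF \<beta>])
  then show "alternating PosDef f"
    by (subst alternating_cong[where g = "\<lambda>A. minor UNIV A powr (- \<beta>)"])
       (auto simp: f minor_def block_one_UNIV PosDef_add)
qed

lemma minor_scale: "A \<in> PosDef \<Longrightarrow> c > 0 \<Longrightarrow> minor S (c *\<^sub>R A) = c ^ card S * minor S A"
proof (induction S rule: finite_induct[OF finite])
  case (2 i S)
  obtain u p where u: "u $ i = 1" "\<And>a. a \<notin> insert i S \<Longrightarrow> u $ a = 0"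
    "\<And>a. a \<in> S \<Longrightarrow> (A *v u) $ a = 0" "(A *v u) $ i = of_real p" "p > 0"
    using pivot_exists[OF 2(4,2)] by blast
  have "minor (insert i S) A = p * minor S A"
    by (rule minor_insert[OF 2(4,2) u(1) _ _ u(4,5)]) (use u in auto)
  moreover have "minor (insert i S) (c *\<^sub>R A) = (c * p) * minor S (c *\<^sub>R A)"
    by (rule minor_insert[OF PosDef_scaleR[OF 2(4,5)] 2(2) u(1)])
       (use u 2(5) in \<open>auto simp: mv_scaleR_left of_real_def\<close>)
  ultimately show ?case using 2 by simp
qed (simp add: minor_empty)

text \<open>The linear part of the affine map \<open>block_one R\<close>; the hermitian matrices it
  fixes form the subspace on which the converse is proved.\<close>

definition block_part :: "'m set \<Rightarrow> 'f^'m^'m \<Rightarrow> 'f^'m^'m" where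
  "block_part R X = (\<chi> a b. if a \<in> R \<and> b \<in> R then X $ a $ b else 0)"

lemma block_one_eq: "block_one R X = block_part R X + block_one R 0"
  by (auto simp: vec_eq_iff block_one_nth block_part_def)

lemma linear_block_part: "linear (block_part R)"
  by (rule linearI) (auto simp: vec_eq_iff block_part_def)

lemma block_part_Herm: "X \<in> Herm \<Longrightarrow> block_part R X \<in> Herm"
  unfolding Herm_def by (auto simp: vec_eq_iff block_part_def)

lemma outer_block_part: "supported R z \<Longrightarrow> block_part R (outer z) = outer z"
  by (auto simp: vec_eq_iff block_part_def outer_def supported_def)

lemma Pd_block_poly: "real_polynomial_function (\<lambda>B. Pd (block_one R B))"
proof -
  have "polynomial_function (\<lambda>B. block_part R B + block_one R 0)"
    using linear_block_part
    by (intro polynomial_function_add polynomial_function_bounded_linear polynomial_function_const)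
       (simp add: linear_conv_bounded_linear)
  then have "polynomial_function (block_one R :: 'f^'m^'m \<Rightarrow> _)"
    by (simp flip: block_one_eq)
  from real_polynomial_function_compose[OF this Pd_poly] show ?thesis by (simp add: o_def)
qed

text \<open>A null vector comes from a real dimension count: T puts the products of v with the card
  S given vectors into the slots of S, 0 into slot r, and copies v outside the block. It misses
  \<open>axis r 1\<close>, so it has a kernel, which consists of vectors in the block annihilated by
  B.\<close>

lemma Pd_low_rank:
  assumes B: "B \<in> low_rank r S" and r: "r \<notin> S"
  shows "Pd (block_one (insert r S) B) = 0"
proof -
  obtain Z where Z: "B = sum_outer S Z" "\<And>j. j \<in> S \<Longrightarrow> supported (insert r S) (Z $ j)"
    using low_rankE[OF B] by blast
  define h where "h j v = (\<Sum>b\<in>UNIV. cj (Z $ j $ b) * v $ b)" for j and v :: "'f^'m"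
  define T where "T v = (\<chi> a. if a \<in> S then h a v else if a = r then 0 else v $ a)" for v :: "'f^'m"
  have lin: "linear T"
    by (rule linearI)
       (auto simp: T_def h_def vec_eq_iff distrib_left sum.distrib scaleR_sum_right)
  have "\<not> surj T"
  proof
    assume "surj T"
    then obtain v where "T v = axis r 1" by (metis surj_def)
    then have "T v $ r = 1" by simp
    then show False using r by (simp add: T_def)
  qed
  then have "\<not> inj T" using linear_injective_imp_surjective[OF lin] by auto
  then obtain v where v: "T v = 0" "v \<noteq> 0" using linear_injective_0[OF lin] by auto
  have h0: "h j v = 0" if "j \<in> S" for j
  proof -
    have "h j v = T v $ j" using that by (simp add: T_def)
    then show ?thesis by (simp add: v)
  qed
  have v0: "v $ a = 0" if "a \<notin> insert r S" for a
  proof -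
    have "v $ a = T v $ a" using that by (simp add: T_def)
    then show ?thesis by (simp add: v)
  qed
  have "(outer (Z $ j) *v v) $ a = Z $ j $ a * h j v" for j a
    by (simp add: outer_def matrix_vector_mult_def h_def sum_distrib_left mult.assoc)
  then have "outer (Z $ j) *v v = 0" if "j \<in> S" for j
    using h0[OF that] by (simp add: vec_eq_iff)
  then have Bv: "B *v v = 0" by (simp add: Z(1) sum_outer_def sum_mv)
  have rv: "restrict_vec (insert r S) v = v" using v0 by (auto simp: restrict_vec_def vec_eq_iff)
  have "(block_one (insert r S) B *v v) $ a = 0" for a
    using v0[of a] by (simp add: block_one_mv rv Bv)
  then have "block_one (insert r S) B *v v = 0" by (simp add: vec_eq_iff)
  moreover have "block_one (insert r S) B \<in> Herm"
    unfolding Z(1) sum_outer_def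
    by (intro block_one_Herm subspace_sum[OF subspace_Herm] outer_Herm)
  ultimately show ?thesis using Pd_singular v(2) by blast
qed

text \<open>B is definite where v $ r = 0, and the added multiple of the r-th diagonal unit is
  positive where v $ r \<noteq> 0.\<close>

lemma Pd_low_rank_ray:
  assumes B: "B \<in> low_rank r S" and t: "t > 0"
  shows "Pd (block_one (insert r S) (B + t *\<^sub>R outer (axis r 1))) \<noteq> 0"
proof -
  obtain Z where Z: "B = sum_outer S Z"
    "\<And>v. supported (insert r S) v \<Longrightarrow> v $ r = 0 \<Longrightarrow> v \<bullet> (B *v v) = 0 \<Longrightarrow> v = 0"
    using low_rankE[OF B] by blast
  let ?X = "B + t *\<^sub>R outer (axis r 1)"
  have "block_one (insert r S) ?X \<in> PosDef"
  proof (rule block_one_PosDef)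
    show "?X \<in> Herm"
      unfolding Z(1) sum_outer_def
      by (intro subspace_add[OF subspace_Herm] subspace_scale[OF subspace_Herm]
            subspace_sum[OF subspace_Herm] outer_Herm)
    fix v :: "'f^'m" assume v: "\<And>a. a \<notin> insert r S \<Longrightarrow> v $ a = 0" "v \<noteq> 0"
    have "(\<Sum>b\<in>UNIV. cj ((axis r 1 :: 'f^'m) $ b) * v $ b) = v $ r"
      by (simp add: axis_def if_distrib[of cj] if_distrib[of "\<lambda>x. x * _"] cong: if_cong)
    then have eq: "v \<bullet> (?X *v v) = v \<bullet> (B *v v) + t * (v $ r \<bullet> v $ r)"
      by (simp add: mv_add_left mv_scaleR_left inner_add_right outer_quad)
    have B0: "0 \<le> v \<bullet> (B *v v)" by (simp add: Z(1) sum_outer_quad outer_quad_nonneg sum_nonneg)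
    show "0 < v \<bullet> (?X *v v)"
    proof (cases "v $ r = 0")
      case True
      then have "v \<bullet> (B *v v) \<noteq> 0" using Z(2)[of v] v by (auto simp: supported_def)
      then show ?thesis using B0 True by (simp add: eq)
    next
      case False
      then show ?thesis using B0 t by (simp add: eq add_nonneg_pos)
    qed
  qed
  from Pd_block_pos[OF this, of UNIV] show ?thesis by (simp add: block_one_UNIV)
qed

text \<open>The norm bound is the triangle inequality, as the norm of a rank-one term equals its
  product with the identity. It gives the decay needed for dominated convergence.\<close>

lemma low_rank_block:
  assumes B: "B \<in> low_rank r S"
  shows "B \<in> Herm" "block_part (insert r S) B = B" "norm B \<le> block_part (insert r S) (mat 1) \<bullet> B"
    "block_one (insert r S) X \<bullet> B = block_part (insert r S) X \<bullet> B"
proof -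
  let ?R = "insert r S"
  obtain Z where Z: "B = sum_outer S Z" "\<And>j. j \<in> S \<Longrightarrow> supported ?R (Z $ j)"
    using low_rankE[OF B] by blast
  show "B \<in> Herm" unfolding Z(1) sum_outer_def by (intro subspace_sum[OF subspace_Herm] outer_Herm)
  show Bb: "block_part ?R B = B"
    unfolding Z(1) sum_outer_def linear_sum[OF linear_block_part]
    using Z(2) by (intro sum.cong refl outer_block_part) auto
  have 0: "block_one ?R 0 \<bullet> B = 0"
  proof -
    have "block_one ?R 0 $ a $ b \<bullet> B $ a $ b = 0" for a b
    proof -
      have "B $ a $ b = block_part ?R B $ a $ b" by (simp add: Bb)
      then show ?thesis by (auto simp: block_one_nth block_part_def)
    qed
    then show ?thesis by (simp add: inner_vec_def)
  qed
  then show 1: "block_one ?R X \<bullet> B = block_part ?R X \<bullet> B" for X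
    by (subst block_one_eq) (simp add: inner_add_left)
  have "block_one ?R (mat 1) = (mat 1 :: 'f^'m^'m)"
    by (auto simp: vec_eq_iff block_one_nth mat_def)
  then have "block_part ?R (mat 1) \<bullet> B = mat 1 \<bullet> B" using 1[of "mat 1"] by simp
  moreover have "norm B \<le> mat 1 \<bullet> B"
    unfolding Z(1) sum_outer_def inner_sum_right mat_one_inner_outer norm_outer[symmetric]
    by (rule norm_sum)
  ultimately show "norm B \<le> block_part ?R (mat 1) \<bullet> B" by simp
qed

lemma not_wallach:
  assumes "\<beta> \<notin> wallach (Suc n)" "0 \<le> \<beta>"
  obtains k where "k \<le> n" "(real k - 1) * hdim < \<beta>" "\<beta> < real k * hdim"
proof -
  \<comment> \<open>Since \<beta> / hdim is not a natural number, its ceiling locates the gap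
    containing \<beta>.\<close>
  define k where "k = nat \<lceil>\<beta> / hdim\<rceil>"
  have ne: "\<beta> \<noteq> real j * hdim" for j using assms(1) by (auto simp: wallach_def)
  have lt: "\<beta> < real n * hdim" using assms(1) by (auto simp: wallach_def not_le)
  have nn: "0 \<le> \<beta> / hdim" using assms(2) hdim_pos by simp
  have k: "real k = of_int \<lceil>\<beta> / hdim\<rceil>" using nn by (simp add: k_def)
  have "\<beta> / hdim \<le> real k" "real k < \<beta> / hdim + 1" unfolding k by linarith+
  then have "\<beta> \<le> real k * hdim" "(real k - 1) * hdim < \<beta>" using hdim_pos by (simp_all add: field_simps)
  moreover have "k \<le> n"
  proof -
    have "\<beta> / hdim \<le> real n" using lt hdim_pos by (simp add: field_simps)
    then show ?thesis by (simp add: k_def nat_le_iff ceiling_le_iff)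
  qed
  ultimately show ?thesis using that[of k] ne[of k] by simp
qed

lemma not_completely_monotone:
  assumes f: "\<And>A. A \<in> PosDef \<Longrightarrow> f A = (Pd A powr e) powr (- \<beta>)" and \<beta>: "\<beta> \<notin> wallach CARD('m)"
    and C: "open_convex_cone Herm C" "C \<noteq> {}" "C \<subseteq> PosDef"
  shows "\<not> completely_monotone Herm C f"
proof
  assume "completely_monotone Herm C f"
  then have alt: "alternating C f" by (rule completely_monotone_imp_alternating[OF C(1)])
  have f': "f A = minor UNIV A powr (- \<beta>)" if "A \<in> PosDef" for A
    using f[OF that] by (simp add: minor_def block_one_UNIV)
  obtain n where n: "CARD('m) = Suc n" by (metis not0_implies_Suc zero_less_card_finite less_irrefl)
  obtain x0 where x0: "x0 \<in> C" using C(2) by auto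
  then have x0P: "x0 \<in> PosDef" using C(3) by auto
  show False
  proof (cases "\<beta> < 0")
    case True
    have "0 \<le> alt_diff [x0] f x0" by (rule alternatingD[OF alt]) (use x0 in auto)
    then have "f (2 *\<^sub>R x0) \<le> f x0" by (simp add: scaleR_2)
    then have "(2 ^ CARD('m) * minor UNIV x0) powr (- \<beta>) \<le> minor UNIV x0 powr (- \<beta>)"
      using x0P PosDef_scaleR[OF x0P, of 2] by (simp add: f' minor_scale)
    moreover have "minor UNIV x0 powr (- \<beta>) < (2 ^ CARD('m) * minor UNIV x0) powr (- \<beta>)"
      using True minor_pos[OF x0P, of UNIV] n by (intro powr_less_mono2) (auto simp del: power_Suc)
    ultimately show False by simp
  next
    case False
    then obtain k where k: "k \<le> n" "(real k - 1) * hdim < \<beta>" "\<beta> < real k * hdim"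
      using not_wallach[OF \<beta>[unfolded n]] by (auto simp: not_less)
    obtain r :: 'm where True by blast
    \<comment> \<open>The bound k \<le> n leaves room for k indices besides r.\<close>
    have "card (UNIV - {r}) = n" using n by simp
    then obtain S where S: "S \<subseteq> UNIV - {r}" "card S = k" using k(1) obtain_subset_with_card_n by metis
    have rS: "r \<notin> S" using S by auto
    let ?R = "insert r S" and ?e = "outer (axis r 1)"
    obtain \<mu> where \<mu>: "laplace_transform_on PosDef \<mu>
      (\<lambda>A. minor ?R A powr (- \<beta>) * (A \<bullet> ?e) powr (\<beta> - real (card S) * hdim))"
      "AE B in \<mu>. B \<in> low_rank r S"
      using minor_power_low_rank[OF rS, of \<beta>] k(2) S(2) by auto
    note [measurable_cong] = laplace_transform_onD(1)[OF \<mu>(1)]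
    obtain g where g: "x0 = adj g ** g" using PosDef_factor[OF x0P] by blast
    \<comment> \<open>On hermitian matrices L multiplies \<open>Pd\<close> by the constant
      \<open>Pd x0\<close>, so composing f with L only rescales it.\<close>
    define L where "L X = adj g ** X ** g" for X
    have L1: "L (mat 1) = x0" by (simp add: L_def g)
    have Lin: "linear L"
    proof (rule linearI)
      show "L (X + Y) = L X + L Y" for X Y
        by (simp add: L_def vec_eq_iff matrix_matrix_mult_def distrib_left distrib_right sum.distrib)
      show "L (c *\<^sub>R X) = c *\<^sub>R L X" for c X
        by (simp add: L_def vec_eq_iff matrix_matrix_mult_def scaleR_sum_right scaleR_sum_left sum_distrib_left sum_distrib_right)
    qed
    have Pd_L: "Pd (L X) = Pd x0 * Pd X" if "X \<in> Herm" for X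
    proof -
      have "Pd x0 = nd g" using Pd_conj[of "mat 1" g] mat_one_PosDef by (simp add: g Pd_one PosDef_Herm)
      then show ?thesis using Pd_conj[OF that, of g] by (simp add: L_def)
    qed
    have Pd0: "Pd x0 > 0" using Pd_block_pos[OF x0P, of UNIV] by (simp add: block_one_UNIV)
    define D where "D = {X \<in> Herm. L X \<in> C}"
    have Dadd: "X + Y \<in> D" if "X \<in> D" "Y \<in> D" for X Y
      using that subspace_add[OF subspace_Herm] open_convex_cone_add[OF C(1)]
      by (auto simp: D_def linear_add[OF Lin])
    have Dscale: "c *\<^sub>R X \<in> D" if "X \<in> D" "c > 0" for c X
      using that subspace_scale[OF subspace_Herm] open_convex_cone_scale[OF C(1)]
      by (auto simp: D_def linear_scale[OF Lin])
    have altD: "alternating D (\<lambda>X. f (L X))"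
      unfolding alternating_def alt_diff_linear_comp[OF Lin]
      by (auto intro!: alternatingD[OF alt] simp: D_def subset_iff)
    obtain \<rho> where \<rho>: "\<rho> > 0" "\<And>X. X \<in> Herm \<Longrightarrow> norm (X - mat 1) < \<rho> \<Longrightarrow> X \<in> D \<and> X \<in> PosDef"
    proof -
      obtain T where T: "open T" "C = Herm \<inter> T"
        using C(1) by (auto simp: open_convex_cone_def openin_open)
      obtain T' where T': "open T'" "PosDef = Herm \<inter> T'"
        using openin_PosDef by (auto simp: openin_open)
      have "open (L -` T)"
        using linear_continuous_on[OF Lin[unfolded linear_conv_bounded_linear], of UNIV] T(1)
        by (simp add: continuous_on_open_vimage)
      then have "open (L -` T \<inter> T')" using T' by blast
      moreover have "mat 1 \<in> L -` T \<inter> T'"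
        using x0 T mat_one_PosDef T' L1 by auto
      ultimately obtain \<rho> where \<rho>: "\<rho> > 0" "ball (mat 1) \<rho> \<subseteq> L -` T \<inter> T'"
        by (meson open_contains_ball)
      have "X \<in> D \<and> X \<in> PosDef" if "X \<in> Herm" "norm (X - mat 1) < \<rho>" for X
      proof -
        have "X \<in> ball (mat 1) \<rho>" using that by (simp add: dist_norm norm_minus_commute)
        then have "X \<in> L -` T \<inter> T'" using \<rho> by blast
        then show ?thesis using that T T' Herm_conj[OF that(1), of g] by (auto simp: D_def L_def)
      qed
      with \<rho>(1) show ?thesis by (rule that)
    qed
    \<comment> \<open>The kernel is studied on the slice z + N with z in U, where N is the identity
      outside the block. There the determinant depends on the block alone, and z = E gives the
      identity.\<close>
    define U where "U = {X \<in> Herm. block_part ?R X = X}"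
    define E where "E = block_part ?R (mat 1)"
    define N where "N = (block_one ?R 0 :: 'f^'m^'m)"
    have U: "subspace U"
      unfolding U_def subspace_def
      using subspace_Herm linear_block_part
      by (auto simp: subspace_0 subspace_add subspace_scale linear_0 linear_add linear_scale)
    have H1: "mat 1 \<in> Herm" by (rule PosDef_Herm[OF mat_one_PosDef])
    have EU: "E \<in> U"
    proof -
      have "E \<in> Herm" unfolding E_def by (rule block_part_Herm[OF H1])
      moreover have "block_part ?R E = E" by (auto simp: E_def block_part_def vec_eq_iff)
      ultimately show ?thesis by (simp add: U_def)
    qed
    have EN: "E + N = mat 1"
      by (auto simp: E_def N_def vec_eq_iff block_part_def block_one_nth mat_def)
    have NH: "N \<in> Herm" unfolding N_def by (intro block_one_Herm subspace_0[OF subspace_Herm])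
    have eU: "?e \<in> U"
      unfolding U_def using outer_Herm by (auto intro!: outer_block_part simp: supported_def axis_def)
    have zN: "z + N = block_one ?R z" if "z \<in> U" for z
      using that block_one_eq[of ?R z] by (simp add: N_def U_def)
    have near: "z + N \<in> PosDef" if "z \<in> U" "norm (z - E) < \<rho>" for z
    proof -
      have eq: "z + N - mat 1 = z - E" by (simp add: algebra_simps flip: EN)
      have "norm (z + N - mat 1) < \<rho>" unfolding eq by (rule that(2))
      moreover have "z + N \<in> Herm"
        using that(1) NH by (intro subspace_add[OF subspace_Herm]) (auto simp: U_def)
      ultimately show ?thesis using \<rho>(2) by blast
    qed
    have Ne: "N \<bullet> ?e = 0"
    proof -
      have "((0::'f^'m^'m) *v w) $ a = 0" for w a by (simp add: matrix_vector_mult_def)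
      then have "(N *v axis r 1) $ a = 0" for a
        by (simp add: N_def block_one_mv) (simp add: axis_def)
      then have "N *v axis r 1 = 0" by (simp add: vec_eq_iff)
      then show ?thesis by (simp add: inner_outer)
    qed
    have pos: "0 < z \<bullet> ?e" if "z \<in> U" "norm (z - E) < \<rho>" for z
    proof -
      have "0 < axis r 1 \<bullet> ((z + N) *v axis r (1::'f))"
        by (rule PosDef_pos[OF near[OF that]]) (simp add: axis_eq_0_iff)
      then show ?thesis by (simp add: inner_add_left Ne flip: inner_outer)
    qed
    have minor_eq: "minor ?R (z + N) = minor ?R z" if "z \<in> U" for z
    proof -
      have "block_one ?R (block_one ?R z) = block_one ?R z" by (auto simp: vec_eq_iff block_one_nth)
      then show ?thesis by (simp add: minor_def zN[OF that])
    qed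
    have half_B: "AE B in \<mu>. (z + N) \<bullet> B = z \<bullet> B" if "z \<in> U" for z
      using \<mu>(2)
    proof eventually_elim
      case (elim B)
      show ?case using low_rank_block(4)[OF elim, of z] that by (simp add: zN U_def)
    qed
    \<comment> \<open>The sums z i + z j then stay within \<rho> / 2 of E, and the points 2 * y i
      below within 2 * r0 + \<rho> / 4 of the identity, which is less than \<rho>.\<close>
    define r0 where "r0 = \<rho> / 4"
    have r0: "r0 > 0" "2 * r0 < \<rho>" using \<rho> by (auto simp: r0_def)
    define gg where "gg z = minor ?R z powr (- \<beta>) * (z \<bullet> ?e) powr (\<beta> - real (card S) * hdim)" for z
    define \<kappa> where "\<kappa> = real k * hdim - \<beta>"
    have \<kappa>: "\<kappa> > 0" using k by (simp add: \<kappa>_def)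
    have lap_eq: "(\<integral>\<^sup>+B. ennreal (exp (- (z \<bullet> B))) \<partial>\<mu>) = ennreal (minor ?R (z + N) powr (- \<beta>) * ((z + N) \<bullet> ?e) powr (\<beta> - real (card S) * hdim))"
      if "z \<in> U" "z + N \<in> PosDef" for z
    proof -
      have "(\<integral>\<^sup>+B. ennreal (exp (- (z \<bullet> B))) \<partial>\<mu>) = (\<integral>\<^sup>+B. ennreal (exp (- ((z + N) \<bullet> B))) \<partial>\<mu>)"
        using half_B[OF that(1)] by (intro nn_integral_cong_AE) (auto elim!: eventually_mono)
      then show ?thesis using laplace_transform_onD(3)[OF \<mu>(1) that(2)] by simp
    qed
    show False
    proof (rule no_positive_definite_power[OF U EU eU \<kappa> r0(1)])
      show "0 < z \<bullet> ?e" if "z \<in> U" "norm (z - E) < 2 * r0" for z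
        using pos that r0 by auto
      show "minor ?R z powr (- \<beta>) = (z \<bullet> ?e) powr \<kappa> * gg z" if "z \<in> U" "norm (z - E) < 2 * r0" for z
        using pos[of z] that r0 S(2) by (simp add: gg_def \<kappa>_def flip: powr_add)
      show "laplace_transform_on {z \<in> U. norm (z - E) < 2 * r0} \<mu> gg"
        unfolding laplace_transform_on_def
      proof (intro conjI ballI)
        fix z assume "z \<in> {z \<in> U. norm (z - E) < 2 * r0}"
        then have z: "z \<in> U" "norm (z - E) < \<rho>" using r0 by auto
        show "(\<integral>\<^sup>+B. ennreal (exp (- (z \<bullet> B))) \<partial>\<mu>) = ennreal (gg z)"
          using lap_eq[OF z(1) near[OF z]] by (simp add: gg_def minor_eq[OF z(1)] inner_add_left Ne)
      qed (use laplace_transform_onD(1)[OF \<mu>(1)] in \<open>auto simp: gg_def\<close>)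
      show "(\<integral>\<^sup>+B. ennreal (exp (- (((1/2) *\<^sub>R E) \<bullet> B))) \<partial>\<mu>) < \<infinity>"
      proof -
        \<comment> \<open>E / 2 + N need not be close to the identity, but it is positive definite,
          and the transform of \<mu> is finite on all of \<open>PosDef\<close>.\<close>
        have hU: "(1/2) *\<^sub>R E \<in> U" using EU U by (rule subspace_scale[rotated])
        have "(1/2) *\<^sub>R E = block_part ?R ((1/2) *\<^sub>R mat 1)"
          by (simp add: E_def linear_scale[OF linear_block_part])
        then have "(1/2) *\<^sub>R E + N = block_one ?R ((1/2) *\<^sub>R mat 1)"
          unfolding N_def by (metis block_one_eq)
        then have "(1/2) *\<^sub>R E + N \<in> PosDef"
          using PosDef_block_one[OF PosDef_scaleR[OF mat_one_PosDef, of "1/2"], of ?R] by simp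
        from lap_eq[OF hU this] show ?thesis by simp
      qed
      show "AE B in \<mu>. B \<in> U \<and> norm B \<le> E \<bullet> B"
        using \<mu>(2) by eventually_elim (auto simp: U_def E_def low_rank_block)
      show "real_polynomial_function (\<lambda>B. Pd (block_one ?R B))" by (rule Pd_block_poly)
      show "AE B in \<mu>. Pd (block_one ?R B) = 0"
        using \<mu>(2) by eventually_elim (rule Pd_low_rank[OF _ rS])
      show "AE B in \<mu>. \<forall>t>0. Pd (block_one ?R (B + t *\<^sub>R ?e)) \<noteq> 0"
        using \<mu>(2) by eventually_elim (auto dest: Pd_low_rank_ray)
      show "emeasure \<mu> (space \<mu>) \<noteq> 0"
      proof
        assume "emeasure \<mu> (space \<mu>) = 0"
        then have "AE B in \<mu>. ennreal (exp (- (mat 1 \<bullet> B))) = 0"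
          by (intro AE_I[of _ _ "space \<mu>"]) auto
        then have "(\<integral>\<^sup>+B. ennreal (exp (- (mat 1 \<bullet> B))) \<partial>\<mu>) = 0"
          by (subst nn_integral_0_iff_AE) auto
        moreover have "minor ?R (mat 1) > 0" "mat 1 \<bullet> ?e > 0"
          using minor_pos[OF mat_one_PosDef] mat_one_inner_outer[of "axis r 1"] inner_one_one
          by (auto simp: inner_axis_axis)
        then have "0 < minor ?R (mat 1) powr (- \<beta>) * (mat 1 \<bullet> ?e) powr (\<beta> - real (card S) * hdim)"
          by simp
        ultimately show False using laplace_transform_onD(3)[OF \<mu>(1) mat_one_PosDef]
          by (metis ennreal_eq_0_iff linorder_not_le)
      qed
      fix n c and z :: "nat \<Rightarrow> _"
      assume z: "\<And>i. i < n \<Longrightarrow> z i \<in> U \<and> norm (z i - (1/2) *\<^sub>R E) < r0"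
      define \<epsilon> where "\<epsilon> = \<rho> / (4 * (1 + norm (mat 1 :: 'f^'m^'m)))"
      have den: "1 + norm (mat 1 :: 'f^'m^'m) > 0" by (simp add: add_pos_nonneg)
      then have \<epsilon>: "\<epsilon> > 0" using \<rho>(1) by (simp add: \<epsilon>_def)
      have \<epsilon>1: "\<epsilon> * norm (mat 1 :: 'f^'m^'m) \<le> \<rho> / 4"
        using den \<rho>(1) by (simp add: \<epsilon>_def field_simps)
      \<comment> \<open>\<open>alternating_positive_definite\<close> wants a base point in D besides
        the vectors. The base point, \<epsilon> times the identity, is taken out again in two halves
        and N is put in in two halves, so that the total is z i + z j + N.\<close>
      define y where "y i = z i + (1/2) *\<^sub>R N - (\<epsilon> / 2) *\<^sub>R mat 1" for i
      have yD: "y i \<in> D" if "i < n" for i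
      proof -
        have zi: "z i \<in> Herm" "norm (z i - (1/2) *\<^sub>R E) < r0" using z[OF that] by (auto simp: U_def)
        have "2 *\<^sub>R y i \<in> Herm"
          unfolding y_def using zi NH H1
          by (intro subspace_scale[OF subspace_Herm] subspace_diff[OF subspace_Herm] subspace_add[OF subspace_Herm])
        moreover have "2 *\<^sub>R y i - mat 1 = 2 *\<^sub>R (z i - (1/2) *\<^sub>R E) - \<epsilon> *\<^sub>R mat 1"
          by (simp add: y_def algebra_simps flip: EN)
        then have "norm (2 *\<^sub>R y i - mat 1) \<le> 2 * norm (z i - (1/2) *\<^sub>R E) + \<epsilon> * norm (mat 1 :: 'f^'m^'m)"
          using norm_triangle_ineq4[of "2 *\<^sub>R (z i - (1/2) *\<^sub>R E)" "\<epsilon> *\<^sub>R (mat 1 :: 'f^'m^'m)"] \<epsilon> by simp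
        then have "norm (2 *\<^sub>R y i - mat 1) < \<rho>"
          using zi(2) \<epsilon>1 \<rho>(1) by (simp add: r0_def)
        ultimately have "2 *\<^sub>R y i \<in> D" using \<rho>(2) by blast
        from Dscale[OF this, of "1/2"] show ?thesis by simp
      qed
      have "mat 1 \<in> D" using \<rho>(2)[OF H1] \<rho>(1) by simp
      then have xD: "\<epsilon> *\<^sub>R mat 1 \<in> D" using \<epsilon> by (rule Dscale)
      have "0 \<le> (\<Sum>i<n. \<Sum>j<n. c i * c j * f (L (\<epsilon> *\<^sub>R mat 1 + y i + y j)))"
        by (rule alternating_positive_definite[where D = D]) (use Dadd altD yD xD in auto)
      also have "\<dots> = (\<Sum>i<n. \<Sum>j<n. (Pd x0 powr e) powr (- \<beta>) * (c i * c j * minor ?R (z i + z j) powr (- \<beta>)))"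
      proof (intro sum.cong refl)
        fix i j assume "i \<in> {..<n}" "j \<in> {..<n}"
        then have zi: "z i \<in> U" "norm (z i - (1/2) *\<^sub>R E) < r0" and zj: "z j \<in> U" "norm (z j - (1/2) *\<^sub>R E) < r0"
          using z by auto
        have eq: "\<epsilon> *\<^sub>R mat 1 + y i + y j = z i + z j + N"
          by (simp add: y_def algebra_simps flip: scaleR_add_left)
        have zU: "z i + z j \<in> U" using zi zj U by (intro subspace_add)
        have "z i + z j - E = (z i - (1/2) *\<^sub>R E) + (z j - (1/2) *\<^sub>R E)"
          by (simp add: algebra_simps flip: scaleR_add_left)
        then have "norm (z i + z j - E) \<le> norm (z i - (1/2) *\<^sub>R E) + norm (z j - (1/2) *\<^sub>R E)"
          using norm_triangle_ineq by metis
        then have nz: "norm (z i + z j - E) < \<rho>" using zi zj r0 by linarith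
        have P: "z i + z j + N \<in> PosDef" by (rule near[OF zU nz])
        have "L (z i + z j + N) \<in> PosDef"
        proof -
          have eq': "z i + z j + N - mat 1 = z i + z j - E" by (simp add: algebra_simps flip: EN)
          have "norm (z i + z j + N - mat 1) < \<rho>" unfolding eq' by (rule nz)
          then have "z i + z j + N \<in> D" using \<rho>(2)[OF PosDef_Herm[OF P]] by blast
          then show ?thesis using C(3) by (auto simp: D_def)
        qed
        then have "f (L (z i + z j + N)) = (Pd x0 powr e * Pd (z i + z j + N) powr e) powr (- \<beta>)"
          using Pd0 Pd_block_pos[OF P, of UNIV]
          by (simp add: f Pd_L[OF PosDef_Herm[OF P]] powr_mult block_one_UNIV)
        also have "\<dots> = (Pd x0 powr e) powr (- \<beta>) * minor ?R (z i + z j) powr (- \<beta>)"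
          by (simp add: powr_mult minor_def zN[OF zU])
        finally show "c i * c j * f (L (\<epsilon> *\<^sub>R mat 1 + y i + y j))
          = (Pd x0 powr e) powr (- \<beta>) * (c i * c j * minor ?R (z i + z j) powr (- \<beta>))"
          by (simp add: eq mult_ac)
      qed
      also have "\<dots> = (Pd x0 powr e) powr (- \<beta>) * (\<Sum>i<n. \<Sum>j<n. c i * c j * minor ?R (z i + z j) powr (- \<beta>))"
        by (simp add: sum_distrib_left)
      finally show "0 \<le> (\<Sum>i<n. \<Sum>j<n. c i * c j * minor ?R (z i + z j) powr (- \<beta>))"
        using Pd0 by (simp add: zero_le_mult_iff)
    qed
  qed
qed

theorem wallach_theorem:
  assumes f: "\<And>A. A \<in> PosDef \<Longrightarrow> f A = (Pd A powr e) powr (- \<beta>)"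
  shows "completely_monotone Herm PosDef f \<longleftrightarrow> \<beta> \<in> wallach CARD('m)"
    and "\<beta> \<notin> wallach CARD('m) \<longrightarrow>
      (\<forall>C. C \<noteq> {} \<and> C \<subseteq> PosDef \<and> open_convex_cone Herm C \<longrightarrow> \<not> completely_monotone Herm C f)"
  using completely_monotone_PosDef[OF f] not_completely_monotone[OF f]
    open_convex_cone_PosDef mat_one_PosDef by blast+

end

section \<open>The pfaffian\<close>

text \<open>Up to the factor \<open>2 ^ m * fact m\<close>, the pfaffian is the antisymmetrization over all permutations
  of the product along the perfect matching \<open>Inl i \<leftrightarrow> Inr i\<close>. For the proofs a different matrix may be
  used at each edge of the matching.\<close>

definition mixed_pf :: "('m::finite \<Rightarrow> complex^('m + 'm)^('m + 'm)) \<Rightarrow> complex" where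
  "mixed_pf X = (\<Sum>\<sigma> | \<sigma> permutes UNIV. of_int (sign \<sigma>) * (\<Prod>i\<in>UNIV. X i $ \<sigma> (Inl i) $ \<sigma> (Inr i)))"

abbreviation unnormalized_pf :: "complex^('m::finite + 'm)^('m + 'm) \<Rightarrow> complex" where
  "unnormalized_pf Y \<equiv> mixed_pf (\<lambda>_. Y)"

lemma prod_UNIV_sum: "(\<Prod>k\<in>(UNIV :: ('a::finite + 'b::finite) set). f k) = (\<Prod>i\<in>UNIV. f (Inl i)) * (\<Prod>i\<in>UNIV. f (Inr i))"
  by (simp add: UNIV_Plus_UNIV[symmetric] prod.Plus del: UNIV_Plus_UNIV)

lemma det_rows_selected:
  fixes A :: "complex^'k::finite^'k"
  shows "det (\<chi> k. A $ \<phi> k) = (if \<phi> permutes UNIV then of_int (sign \<phi>) * det A else 0)"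
proof (cases "\<phi> permutes UNIV")
  case True
  then show ?thesis by (simp add: det_permute_rows)
next
  case False
  then have "\<not> inj \<phi>"
    using finite_UNIV_inj_surj[of \<phi>] by (auto simp: permutes_univ bij_def bij_iff[symmetric])
  then obtain i j where "i \<noteq> j" "\<phi> i = \<phi> j" by (auto simp: inj_def)
  then have "det (\<chi> k. A $ \<phi> k) = 0"
    by (intro det_identical_rows[of i j]) (auto simp: row_def vec_eq_iff)
  then show ?thesis using False by simp
qed

text \<open>Expanding the entries chooses an index pair for every edge, that is, a map \<phi> on all
  indices. The sum over \<sigma> is then the determinant of B with columns selected by \<phi>, which
  vanishes unless \<phi> is a permutation.\<close>

lemma pf_congruence:
  fixes B Y :: "complex^('m::finite + 'm)^('m + 'm)"
  shows "unnormalized_pf (B ** Y ** transpose B) = det B * unnormalized_pf Y"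
proof -
  let ?y = "\<lambda>g :: 'm \<Rightarrow> ('m + 'm) \<times> ('m + 'm). \<Prod>i\<in>UNIV. Y $ fst (g i) $ snd (g i)"
  let ?\<phi> = "\<lambda>(g :: 'm \<Rightarrow> ('m + 'm) \<times> ('m + 'm)) (k :: 'm + 'm). case k of Inl i \<Rightarrow> fst (g i) | Inr i \<Rightarrow> snd (g i)"
  have BYB: "(B ** Y ** transpose B) $ a $ b = (\<Sum>p\<in>UNIV. B $ a $ fst p * Y $ fst p $ snd p * B $ b $ snd p)" for a b
  proof -
    have "(B ** Y ** transpose B) $ a $ b = (\<Sum>d\<in>UNIV. \<Sum>c\<in>UNIV. B $ a $ c * Y $ c $ d * B $ b $ d)"
      by (simp add: matrix_matrix_mult_def transpose_def sum_distrib_right)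
    also have "\<dots> = (\<Sum>c\<in>UNIV. \<Sum>d\<in>UNIV. B $ a $ c * Y $ c $ d * B $ b $ d)" by (rule sum.swap)
    also have "\<dots> = (\<Sum>p\<in>UNIV \<times> UNIV. B $ a $ fst p * Y $ fst p $ snd p * B $ b $ snd p)"
      by (simp add: sum.cartesian_product case_prod_unfold)
    finally show ?thesis by simp
  qed
  have expand: "(\<Prod>i\<in>UNIV. (B ** Y ** transpose B) $ \<sigma> (Inl i) $ \<sigma> (Inr i))
      = (\<Sum>g\<in>UNIV. ?y g * (\<Prod>k\<in>UNIV. B $ \<sigma> k $ ?\<phi> g k))" for \<sigma>
  proof -
    have "(\<Prod>i\<in>UNIV. (B ** Y ** transpose B) $ \<sigma> (Inl i) $ \<sigma> (Inr i))
        = (\<Sum>g\<in>UNIV. \<Prod>i\<in>UNIV. B $ \<sigma> (Inl i) $ fst (g i) * Y $ fst (g i) $ snd (g i) * B $ \<sigma> (Inr i) $ snd (g i))"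
      unfolding BYB by (subst prod_sum_PiE) auto
    also have "\<dots> = (\<Sum>g\<in>UNIV. ?y g * (\<Prod>k\<in>UNIV. B $ \<sigma> k $ ?\<phi> g k))"
      by (simp add: prod_UNIV_sum prod.distrib mult_ac)
    finally show ?thesis .
  qed
  have "unnormalized_pf (B ** Y ** transpose B)
      = (\<Sum>\<sigma> | \<sigma> permutes UNIV. \<Sum>g\<in>UNIV. ?y g * (of_int (sign \<sigma>) * (\<Prod>k\<in>UNIV. B $ \<sigma> k $ ?\<phi> g k)))"
    unfolding mixed_pf_def expand by (simp add: sum_distrib_left mult.left_commute)
  also have "\<dots> = (\<Sum>g\<in>UNIV. ?y g * (\<Sum>\<sigma> | \<sigma> permutes UNIV. of_int (sign \<sigma>) * (\<Prod>k\<in>UNIV. B $ \<sigma> k $ ?\<phi> g k)))"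
    by (subst sum.swap) (simp add: sum_distrib_left)
  also have "\<dots> = (\<Sum>g\<in>UNIV. ?y g * (if ?\<phi> g permutes UNIV then of_int (sign (?\<phi> g)) * det B else 0))"
  proof (intro sum.cong refl arg_cong[of _ _ "(*) _"])
    fix g
    have "(\<Sum>\<sigma> | \<sigma> permutes UNIV. of_int (sign \<sigma>) * (\<Prod>k\<in>UNIV. B $ \<sigma> k $ ?\<phi> g k)) = det (\<chi> k. transpose B $ ?\<phi> g k)"
      by (simp add: det_def transpose_def)
    then show "(\<Sum>\<sigma> | \<sigma> permutes UNIV. of_int (sign \<sigma>) * (\<Prod>k\<in>UNIV. B $ \<sigma> k $ ?\<phi> g k))
      = (if ?\<phi> g permutes UNIV then of_int (sign (?\<phi> g)) * det B else 0)"
      by (simp add: det_rows_selected)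
  qed
  also have "\<dots> = (\<Sum>\<phi>\<in>UNIV. (\<Prod>i\<in>UNIV. Y $ \<phi> (Inl i) $ \<phi> (Inr i)) *
      (if \<phi> permutes UNIV then of_int (sign \<phi>) * det B else 0))"
  proof (rule sum.reindex_bij_witness[where i = "\<lambda>\<phi> i. (\<phi> (Inl i), \<phi> (Inr i))" and j = ?\<phi>])
    show "?\<phi> (\<lambda>i. (\<phi> (Inl i), \<phi> (Inr i))) = \<phi>" for \<phi> :: "'m + 'm \<Rightarrow> 'm + 'm"
      by (rule ext) (simp split: sum.split)
  qed auto
  also have "\<dots> = (\<Sum>\<phi> | \<phi> permutes UNIV. (\<Prod>i\<in>UNIV. Y $ \<phi> (Inl i) $ \<phi> (Inr i)) * (of_int (sign \<phi>) * det B))"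
    by (rule sum.mono_neutral_cong_right) auto
  also have "\<dots> = det B * unnormalized_pf Y"
    by (simp add: mixed_pf_def sum_distrib_left mult_ac)
  finally show ?thesis .
qed

text \<open>Composing \<sigma> with the transposition of the two ends of edge i exchanges the
  indices at that edge only and changes the sign.\<close>

lemma mixed_pf_flip: "mixed_pf (X(i := transpose A)) = - mixed_pf (X(i := A))"
proof -
  let ?t = "Transposition.transpose (Inl i) (Inr i :: 'a + 'a)"
  have t: "?t permutes UNIV" by (rule permutes_swap_id) auto
  have "mixed_pf (X(i := transpose A)) = (\<Sum>\<sigma> | \<sigma> permutes UNIV. of_int (sign (\<sigma> \<circ> ?t)) *
      (\<Prod>j\<in>UNIV. (X(i := transpose A)) j $ (\<sigma> \<circ> ?t) (Inl j) $ (\<sigma> \<circ> ?t) (Inr j)))"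
    unfolding mixed_pf_def by (rule sum_permutations_compose_right[OF t])
  also have "\<dots> = (\<Sum>\<sigma> | \<sigma> permutes UNIV. - (of_int (sign \<sigma>) * (\<Prod>j\<in>UNIV. (X(i := A)) j $ \<sigma> (Inl j) $ \<sigma> (Inr j))))"
  proof (intro sum.cong refl)
    fix \<sigma> :: "'a + 'a \<Rightarrow> 'a + 'a" assume "\<sigma> \<in> {\<sigma>. \<sigma> permutes UNIV}"
    then have "permutation \<sigma>" "permutation ?t" using t by (auto simp: permutation_permutes)
    then have s: "sign (\<sigma> \<circ> ?t) = - sign \<sigma>" by (simp add: sign_compose sign_swap_id)
    have "(\<Prod>j\<in>UNIV. (X(i := transpose A)) j $ (\<sigma> \<circ> ?t) (Inl j) $ (\<sigma> \<circ> ?t) (Inr j))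
        = (\<Prod>j\<in>UNIV. (X(i := A)) j $ \<sigma> (Inl j) $ \<sigma> (Inr j))"
    proof (intro prod.cong refl)
      fix j
      show "(X(i := transpose A)) j $ (\<sigma> \<circ> ?t) (Inl j) $ (\<sigma> \<circ> ?t) (Inr j) = (X(i := A)) j $ \<sigma> (Inl j) $ \<sigma> (Inr j)"
        by (cases "j = i") (simp_all add: Finite_Cartesian_Product.transpose_def Transposition.transpose_def)
    qed
    then show "of_int (sign (\<sigma> \<circ> ?t)) * (\<Prod>j\<in>UNIV. (X(i := transpose A)) j $ (\<sigma> \<circ> ?t) (Inl j) $ (\<sigma> \<circ> ?t) (Inr j))
      = - (of_int (sign \<sigma>) * (\<Prod>j\<in>UNIV. (X(i := A)) j $ \<sigma> (Inl j) $ \<sigma> (Inr j)))"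
      by (simp add: s)
  qed
  also have "\<dots> = - mixed_pf (X(i := A))" by (simp add: mixed_pf_def sum_negf)
  finally show ?thesis .
qed

lemma mixed_pf_diff: "mixed_pf (X(i := A - B)) = mixed_pf (X(i := A)) - mixed_pf (X(i := B))"
proof -
  have split: "(\<Prod>j\<in>UNIV. (X(i := C)) j $ \<sigma> (Inl j) $ \<sigma> (Inr j))
      = C $ \<sigma> (Inl i) $ \<sigma> (Inr i) * (\<Prod>j\<in>UNIV - {i}. X j $ \<sigma> (Inl j) $ \<sigma> (Inr j))" for C and \<sigma> :: "'a + 'a \<Rightarrow> 'a + 'a"
    by (subst prod.remove[of _ i]) (auto intro!: prod.cong)
  show ?thesis
    unfolding mixed_pf_def split by (simp add: sum_subtractf[symmetric] algebra_simps)
qed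

text \<open>The actions of \<pi> on the two summands are conjugate by the swap, so their signs agree
  and the product is 1.\<close>

lemma sign_map_sum:
  fixes \<pi> :: "'m::finite \<Rightarrow> 'm"
  assumes \<pi>: "\<pi> permutes UNIV"
  shows "sign (map_sum \<pi> \<pi>) = 1"
proof -
  let ?l = "map_sum \<pi> (\<lambda>x. x) :: 'm + 'm \<Rightarrow> _" and ?r = "map_sum (\<lambda>x. x) \<pi> :: 'm + 'm \<Rightarrow> _"
  let ?s = "case_sum Inr Inl :: 'm + 'm \<Rightarrow> 'm + 'm"
  have inj: "inj \<pi>" using \<pi> by (simp add: permutes_inj)
  have perm: "permutation f" if "inj f" for f :: "'m + 'm \<Rightarrow> 'm + 'm"
  proof -
    have "bij f" using that by (intro bijI finite_UNIV_inj_surj) auto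
    then have "f permutes UNIV" by (auto simp: permutes_univ bij_iff)
    then show ?thesis by (auto simp: permutation_permutes)
  qed
  have id: "inj (\<lambda>x :: 'm. x)" by (rule inj_on_id2)
  have l: "permutation ?l" by (rule perm[OF sum.inj_map[OF inj id]])
  have r: "permutation ?r" by (rule perm[OF sum.inj_map[OF id inj]])
  have s: "permutation ?s" by (rule perm) (auto simp: inj_def split: sum.splits)
  have "?r = ?s \<circ> ?l \<circ> ?s" by (rule ext) (simp split: sum.split)
  then have "sign ?r = sign ?s * sign ?l * sign ?s"
    using s l by (simp add: sign_compose permutation_compose)
  then have "sign ?r = sign ?l" by (simp add: mult_ac)
  moreover have "map_sum \<pi> \<pi> = ?l \<circ> ?r" by (rule ext) (simp add: map_sum_def split: sum.split)
  ultimately show ?thesis using l r by (simp add: sign_compose)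
qed

text \<open>J is U minus its transpose, so replacing J by U at one edge costs a factor 2. For U only
  the permutations \<open>map_sum \<pi> \<pi>\<close> survive; each contributes 1, so nothing
  cancels.\<close>

lemma unnormalized_pf_J_nonzero: "unnormalized_pf (J_mat :: complex^('m::finite + 'm)^('m + 'm)) \<noteq> 0"
proof -
  let ?U = "block_matrix 0 (mat 1) 0 0 :: complex^('m + 'm)^('m + 'm)"
  let ?J = "J_mat :: complex^('m + 'm)^('m + 'm)"
  have J: "?J = ?U - transpose ?U"
    by (auto simp: vec_eq_iff J_mat_def block_matrix_def Finite_Cartesian_Product.transpose_def mat_def split: sum.splits)
  have step: "mixed_pf (X(i := ?J)) = 2 * mixed_pf (X(i := ?U))" for X i
    unfolding J mixed_pf_diff mixed_pf_flip by simp
  have "mixed_pf (\<lambda>i. if i \<in> T then ?J else ?U) = 2 ^ card T * unnormalized_pf ?U" for T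
  proof (induction T rule: finite_induct[OF finite])
    case (2 i T)
    have "(\<lambda>j. if j \<in> insert i T then ?J else ?U) = (\<lambda>j. if j \<in> T then ?J else ?U)(i := ?J)" by auto
    moreover have "(\<lambda>j. if j \<in> T then ?J else ?U)(i := ?U) = (\<lambda>j. if j \<in> T then ?J else ?U)" using 2 by auto
    ultimately show ?case using step[of "\<lambda>j. if j \<in> T then ?J else ?U" i] 2 by simp
  qed simp
  from this[of UNIV] have eq: "unnormalized_pf ?J = 2 ^ CARD('m) * unnormalized_pf ?U" by simp
  let ?t = "\<lambda>\<sigma>. of_int (sign \<sigma>) * (\<Prod>i\<in>UNIV. ?U $ \<sigma> (Inl i) $ \<sigma> (Inr i))"
  have nonneg: "0 \<le> Re (?t \<sigma>)" if \<sigma>: "\<sigma> permutes UNIV" for \<sigma>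
  proof (cases "(\<Prod>i\<in>UNIV. ?U $ \<sigma> (Inl i) $ \<sigma> (Inr i)) = 0")
    case False
    then have nz: "?U $ \<sigma> (Inl i) $ \<sigma> (Inr i) \<noteq> 0" for i by auto
    have "\<exists>j. \<sigma> (Inl i) = Inl j \<and> \<sigma> (Inr i) = Inr j" for i
      using nz[of i] by (cases "\<sigma> (Inl i)"; cases "\<sigma> (Inr i)") (auto simp: block_matrix_def mat_def split: if_splits)
    then obtain \<pi> where \<pi>: "\<And>i. \<sigma> (Inl i) = Inl (\<pi> i)" "\<And>i. \<sigma> (Inr i) = Inr (\<pi> i)" by metis
    then have \<sigma>_eq: "\<sigma> = map_sum \<pi> \<pi>" by (intro ext) (simp add: map_sum_def split: sum.split)
    have "inj \<pi>"
      using permutes_inj[OF \<sigma>] \<pi> by (metis injD injI sum.inject(1))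
    then have "\<pi> permutes UNIV"
      using finite_UNIV_inj_surj[of \<pi>] by (auto simp: permutes_univ bij_def bij_iff[symmetric])
    then have "sign \<sigma> = 1" unfolding \<sigma>_eq by (rule sign_map_sum)
    moreover have "(\<Prod>i\<in>UNIV. ?U $ \<sigma> (Inl i) $ \<sigma> (Inr i)) = 1"
      by (rule prod.neutral) (simp add: \<pi> block_matrix_def mat_def)
    ultimately show ?thesis by simp
  next
    case True
    then show ?thesis by (simp only: mult_zero_right zero_complex.sel order_refl)
  qed
  have "Re (unnormalized_pf ?U) = (\<Sum>\<sigma> | \<sigma> permutes UNIV. Re (?t \<sigma>))" by (simp add: mixed_pf_def)
  moreover have "Re (?t id) \<le> (\<Sum>\<sigma> | \<sigma> permutes UNIV. Re (?t \<sigma>))"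
  proof (rule member_le_sum)
    show "id \<in> {\<sigma>. \<sigma> permutes (UNIV :: ('m + 'm) set)}" by (simp only: mem_Collect_eq permutes_id)
    show "0 \<le> Re (?t \<sigma>)" if "\<sigma> \<in> {\<sigma>. \<sigma> permutes UNIV} - {id}" for \<sigma> using nonneg that by blast
    show "finite {\<sigma>. \<sigma> permutes (UNIV :: ('m + 'm) set)}" by (rule finite_permutations) simp
  qed
  moreover have "Re (?t id) = 1" by (simp add: block_matrix_def mat_def sign_id)
  ultimately have "unnormalized_pf ?U \<noteq> 0" by auto
  then show ?thesis unfolding eq by simp
qed

section \<open>The square of the pfaffian\<close>

lemma matrix_mult_diff_right: "A ** (B - C) = A ** B - A ** (C :: 'a::comm_ring_1^_^_)"
  by (simp add: vec_eq_iff matrix_matrix_mult_def right_diff_distrib sum_subtractf)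

lemma matrix_mult_add_left: "(A + B) ** C = A ** C + B ** (C :: 'a::comm_ring_1^_^_)"
  by (simp add: vec_eq_iff matrix_matrix_mult_def distrib_right sum.distrib)

lemma matrix_mult_minus_right: "A ** (- C) = - (A ** (C :: 'a::comm_ring_1^_^_))"
  by (simp add: vec_eq_iff matrix_matrix_mult_def sum_negf)

lemma matrix_mult_minus_left: "(- A) ** C = - (A ** (C :: 'a::comm_ring_1^_^_))"
  by (simp add: vec_eq_iff matrix_matrix_mult_def sum_negf)

lemma J_mat_nth:
  "J_mat $ Inl i $ Inl j = 0" "J_mat $ Inl i $ Inr j = (if i = j then 1 else 0)"
  "J_mat $ Inr i $ Inl j = (if i = j then - 1 else 0)" "J_mat $ Inr i $ Inr j = 0"
  by (auto simp: J_mat_def block_matrix_def mat_def)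

lemma sum_UNIV_sum: "(\<Sum>k\<in>(UNIV :: ('a::finite + 'b::finite) set). f k) = (\<Sum>i\<in>UNIV. f (Inl i)) + (\<Sum>i\<in>UNIV. f (Inr i))"
  by (simp add: UNIV_Plus_UNIV[symmetric] sum.Plus del: UNIV_Plus_UNIV)

lemma transpose_J_mat: "transpose J_mat = - J_mat"
proof -
  have "transpose J_mat $ a $ b = - (J_mat $ a $ b)" for a b :: "'a + 'a"
    by (cases a; cases b) (auto simp: Finite_Cartesian_Product.transpose_def J_mat_nth)
  then show ?thesis by (simp add: vec_eq_iff)
qed

text \<open>\<open>J = K ^ 2\<close> for the orthogonal matrix \<open>K = (1 + J) / sqrt 2\<close>.\<close>

lemma det_J_mat: "det (J_mat :: complex^('m::finite + 'm)^('m + 'm)) = 1"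
proof -
  let ?J = "J_mat :: complex^('m + 'm)^('m + 'm)"
  define s :: complex where "s = of_real (1 / sqrt 2)"
  have "s * s = 1 / 2" by (simp add: s_def flip: of_real_mult)
  then have s: "2 * (s * s) = 1" "s * s * 2 = 1" by (simp_all only:) simp_all
  define K where "K = (\<chi> a b. s * ((mat 1 :: complex^('m + 'm)^('m + 'm)) $ a $ b + ?J $ a $ b))"
  have "(K ** K) $ a $ b = ?J $ a $ b" for a b
    using s by (cases a; cases b)
      (auto simp: K_def matrix_matrix_mult_def sum_UNIV_sum J_mat_nth mat_def distrib_left distrib_right
        sum.distrib if_distrib[of "\<lambda>x. _ * x"] if_distrib[of "\<lambda>x. x * _"] cong: if_cong)
  then have KK: "K ** K = ?J" by (simp add: vec_eq_iff)
  have "(K ** transpose K) $ a $ b = (mat 1 :: complex^('m + 'm)^('m + 'm)) $ a $ b" for a b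
    using s by (cases a; cases b)
      (auto simp: K_def matrix_matrix_mult_def Finite_Cartesian_Product.transpose_def sum_UNIV_sum J_mat_nth mat_def distrib_left distrib_right
        sum.distrib if_distrib[of "\<lambda>x. _ * x"] if_distrib[of "\<lambda>x. x * _"] cong: if_cong)
  then have "K ** transpose K = mat 1" by (simp add: vec_eq_iff)
  then have "det K * det K = 1" by (metis det_I det_mul det_transpose)
  then show ?thesis by (metis KK det_mul)
qed

definition square_root_at :: "complex^('m::finite + 'm)^('m + 'm) \<Rightarrow> bool" where
  "square_root_at Y \<longleftrightarrow> (unnormalized_pf Y)\<^sup>2 = (unnormalized_pf (J_mat :: complex^('m + 'm)^('m + 'm)))\<^sup>2 * det Y"

lemma square_root_at_congruence:
  assumes "square_root_at (B ** Y ** transpose B)" "det B \<noteq> 0"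
  shows "square_root_at Y"
  using assms by (simp add: square_root_at_def pf_congruence det_mul power_mult_distrib power2_eq_square)

lemma square_root_at_J:
  fixes B :: "complex^('m::finite + 'm)^('m + 'm)"
  shows "square_root_at (B ** J_mat ** transpose B)"
  by (simp add: square_root_at_def pf_congruence det_mul det_J_mat power2_eq_square)

definition decoupled :: "'m \<Rightarrow> complex^('m::finite + 'm)^('m + 'm) \<Rightarrow> bool" where
  "decoupled i Y \<longleftrightarrow> (\<forall>k. k \<noteq> Inr i \<longrightarrow> Y $ Inl i $ k = 0) \<and> (\<forall>k. k \<noteq> Inl i \<longrightarrow> Y $ Inr i $ k = 0)"

text \<open>Gaussian elimination for antisymmetric matrices: B = 1 + N with N ** N = 0 clears both
  rows of pair i at once. Pairs in T stay decoupled because the coefficients of N vanish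
  there.\<close>

lemma decouple:
  fixes Y :: "complex^('m::finite + 'm)^('m + 'm)"
  assumes Y: "transpose Y = - Y" and T: "\<And>j. j \<in> T \<Longrightarrow> decoupled j Y" and i: "i \<notin> T"
    and a: "Y $ Inl i $ Inr i \<noteq> 0"
  obtains B where "det B \<noteq> 0" "\<And>j. j \<in> insert i T \<Longrightarrow> decoupled j (B ** Y ** transpose B)"
proof -
  have anti: "Y $ k $ l = - (Y $ l $ k)" for k l
    using arg_cong[OF Y, of "\<lambda>M. M $ l $ k"] by (simp add: Finite_Cartesian_Product.transpose_def)
  have diag: "Y $ k $ k = 0" for k using anti[of k k] by simp
  define p where "p = Y $ Inl i $ Inr i"
  have p: "p \<noteq> 0" using a by (simp add: p_def)
  have p': "Y $ Inr i $ Inl i = - p" using anti[of "Inr i" "Inl i"] by (simp add: p_def)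
  \<comment> \<open>\<alpha> and \<beta> are the solutions of the equations that the entries of the
    new matrix at (Inr i, k) and (Inl i, k) vanish.\<close>
  define \<alpha> where "\<alpha> k = (if k = Inl i \<or> k = Inr i then 0 else - (Y $ k $ Inr i) / p)" for k
  define \<beta> where "\<beta> k = (if k = Inl i \<or> k = Inr i then 0 else Y $ k $ Inl i / p)" for k
  define N where "N = (\<chi> k l. (if l = Inl i then \<alpha> k else 0) + (if l = Inr i then \<beta> k else (0::complex)))"
  have NX: "(N ** X) $ k $ l = \<alpha> k * X $ Inl i $ l + \<beta> k * X $ Inr i $ l" for X :: "complex^('m + 'm)^('m + 'm)" and k l
    by (simp add: N_def matrix_matrix_mult_def distrib_right sum.distrib if_distrib[of "\<lambda>x. x * _"] cong: if_cong)
  have XN: "(X ** transpose N) $ k $ l = \<alpha> l * X $ k $ Inl i + \<beta> l * X $ k $ Inr i" for X :: "complex^('m + 'm)^('m + 'm)" and k l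
    by (simp add: N_def matrix_matrix_mult_def Finite_Cartesian_Product.transpose_def distrib_left sum.distrib
        if_distrib[of "\<lambda>x. _ * x"] mult.commute cong: if_cong)
  have N0: "N $ Inl i $ l = 0" "N $ Inr i $ l = 0" for l by (auto simp: N_def \<alpha>_def \<beta>_def)
  have NN: "N ** N = 0" by (simp add: vec_eq_iff NX N0)
  let ?B = "mat 1 + N"
  have "?B ** (mat 1 - N) = mat 1"
    by (simp add: matrix_mult_diff_right matrix_mult_add_left NN)
  then have "det ?B * det (mat 1 - N) = 1" by (metis det_I det_mul)
  then have B: "det ?B \<noteq> 0" by auto
  have tB: "transpose ?B = mat 1 + transpose N"
    by (auto simp: vec_eq_iff Finite_Cartesian_Product.transpose_def mat_def)
  let ?Z = "?B ** Y ** transpose ?B"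
  have BY: "(?B ** Y) $ k $ l = Y $ k $ l + (\<alpha> k * Y $ Inl i $ l + \<beta> k * Y $ Inr i $ l)" for k l
    by (simp add: matrix_mult_add_left NX)
  have Z: "?Z $ k $ l = (?B ** Y) $ k $ l + (\<alpha> l * (?B ** Y) $ k $ Inl i + \<beta> l * (?B ** Y) $ k $ Inr i)" for k l
    unfolding tB by (simp add: matrix_add_ldistrib XN)
  have "decoupled j ?Z" if j: "j \<in> insert i T" for j
  proof (cases "j = i")
    case True
    have ab: "\<alpha> (Inl i) = 0" "\<alpha> (Inr i) = 0" "\<beta> (Inl i) = 0" "\<beta> (Inr i) = 0" by (auto simp: \<alpha>_def \<beta>_def)
    have 1: "?Z $ Inl i $ k = 0" if "k \<noteq> Inr i" for k
    proof (cases "k = Inl i")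
      case False
      then have "\<beta> k * p = Y $ k $ Inl i" using that p by (simp add: \<beta>_def)
      then show ?thesis
        using anti[of "Inl i" k] by (simp add: Z BY ab diag flip: p_def)
    qed (simp add: Z BY ab diag)
    have 2: "?Z $ Inr i $ k = 0" if "k \<noteq> Inl i" for k
    proof (cases "k = Inr i")
      case False
      then have "\<alpha> k * p = - (Y $ k $ Inr i)" using that p by (simp add: \<alpha>_def)
      then show ?thesis
        using anti[of "Inr i" k] by (simp add: Z BY ab diag p')
    qed (simp add: Z BY ab diag)
    show ?thesis unfolding True decoupled_def using 1 2 by blast
  next
    case False
    then have jT: "j \<in> T" using j by auto
    have Yj: "Y $ Inl j $ k = 0" if "k \<noteq> Inr j" for k using T[OF jT] that by (simp add: decoupled_def)
    have Yj': "Y $ Inr j $ k = 0" if "k \<noteq> Inl j" for k using T[OF jT] that by (simp add: decoupled_def)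
    have ab: "\<alpha> (Inl j) = 0" "\<alpha> (Inr j) = 0" "\<beta> (Inl j) = 0" "\<beta> (Inr j) = 0"
      using False Yj[of "Inl i"] Yj[of "Inr i"] Yj'[of "Inl i"] Yj'[of "Inr i"] by (auto simp: \<alpha>_def \<beta>_def)
    show ?thesis
      unfolding decoupled_def using False
      by (auto simp: Z BY ab Yj Yj')
  qed
  with B that show ?thesis by blast
qed

lemma mixed_pf_continuous: "continuous_on UNIV (\<lambda>t::complex. unnormalized_pf (\<chi> a b. Y $ a $ b + t * W $ a $ b))"
  unfolding mixed_pf_def by (simp, intro continuous_intros)

lemma det_continuous: "continuous_on UNIV (\<lambda>t::complex. det (\<chi> a b. Y $ a $ b + t * W $ a $ b))"
  unfolding det_def by (simp, intro continuous_intros)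

text \<open>Elimination of one pair of indices at a time. If the pivot vanishes, perturb it and use
  continuity.\<close>

lemma square_root_at_antisymmetric:
  fixes Y :: "complex^('m::finite + 'm)^('m + 'm)"
  assumes "transpose Y = - Y"
  shows "square_root_at Y"
proof -
  have "square_root_at Y" if "transpose Y = - Y" "\<And>j. j \<notin> S \<Longrightarrow> decoupled j Y" for S and Y :: "complex^('m + 'm)^('m + 'm)"
    using that
  proof (induction S arbitrary: Y rule: finite_induct[OF finite])
    case (1 Y)
    have anti: "Y $ k $ l = - (Y $ l $ k)" for k l
      using arg_cong[OF 1(1), of "\<lambda>M. M $ l $ k"] by (simp add: Finite_Cartesian_Product.transpose_def)
    have d: "decoupled j Y" for j using 1 by simp
    \<comment> \<open>With all pairs decoupled, Y is J with its edges rescaled; putting the whole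
      scale on the \<open>Inl\<close> side avoids square roots.\<close>
    define D :: "complex^('m + 'm)^('m + 'm)" where "D = (\<chi> k l. if k = l then (case k of Inl i \<Rightarrow> Y $ Inl i $ Inr i | Inr _ \<Rightarrow> 1) else (0::complex))"
    have "(D ** J_mat ** transpose D) $ k $ l = D $ k $ k * J_mat $ k $ l * D $ l $ l" for k l
      by (simp add: D_def matrix_matrix_mult_def Finite_Cartesian_Product.transpose_def
          if_distrib[of "\<lambda>x. x * _"] if_distrib[of "\<lambda>x. _ * x"] cong: if_cong)
    moreover have "D $ k $ k * J_mat $ k $ l * D $ l $ l = Y $ k $ l" for k l
    proof (cases k; cases l)
      fix i j assume "k = Inl i" "l = Inr j"
      then show ?thesis using d[of i] by (auto simp: D_def J_mat_nth decoupled_def)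
    next
      fix i j assume "k = Inr i" "l = Inl j"
      then show ?thesis using d[of i] anti[of "Inr i" "Inl i"] by (auto simp: D_def J_mat_nth decoupled_def)
    next
      fix i j assume "k = Inl i" "l = Inl j"
      then show ?thesis using d[of i] by (auto simp: J_mat_nth decoupled_def)
    next
      fix i j assume "k = Inr i" "l = Inr j"
      then show ?thesis using d[of i] by (auto simp: J_mat_nth decoupled_def)
    qed
    ultimately have "D ** J_mat ** transpose D = Y" by (simp add: vec_eq_iff)
    then show ?case using square_root_at_J by metis
  next
    case (2 i S Y)
    have pivot: "square_root_at Y" if Y: "transpose Y = - Y" "\<And>j. j \<notin> insert i S \<Longrightarrow> decoupled j Y"
      and a: "Y $ Inl i $ Inr i \<noteq> 0" for Y
    proof -
      obtain B where B: "det B \<noteq> 0" "\<And>j. j \<in> insert i (- insert i S) \<Longrightarrow> decoupled j (B ** Y ** transpose B)"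
        by (rule decouple[of Y "- insert i S" i]) (use Y a in auto)
      have "transpose (B ** Y ** transpose B) = - (B ** Y ** transpose B)"
        by (simp add: matrix_transpose_mul Y(1) matrix_mult_minus_left matrix_mult_minus_right matrix_mul_assoc)
      then have "square_root_at (B ** Y ** transpose B)"
        by (rule 2(3)) (use B 2(2) in auto)
      then show ?thesis using B(1) by (rule square_root_at_congruence)
    qed
    show ?case
    proof (cases "Y $ Inl i $ Inr i = 0")
      case False
      then show ?thesis using pivot 2 by blast
    next
      case True
      \<comment> \<open>An antisymmetric perturbation living on pair i alone: it makes the pivot
        nonzero and leaves the other pairs decoupled.\<close>
      define W where "W = (\<chi> k l. if k = Inl i \<and> l = Inr i then 1 else if k = Inr i \<and> l = Inl i then -1 else (0::complex))"
      define Z where "Z t = (\<chi> a b. Y $ a $ b + t * W $ a $ b)" for t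
      have anti: "Y $ k $ l = - (Y $ l $ k)" for k l
        using arg_cong[OF 2(4), of "\<lambda>M. M $ l $ k"] by (simp add: Finite_Cartesian_Product.transpose_def)
      have "square_root_at (Z t)" if t: "t \<noteq> 0" for t
      proof (rule pivot)
        show "transpose (Z t) = - Z t"
          unfolding vec_eq_iff Finite_Cartesian_Product.transpose_def Z_def
        proof (intro allI)
          fix k l
          show "(\<chi> i j. (\<chi> a b. Y $ a $ b + t * W $ a $ b) $ j $ i) $ k $ l = (- (\<chi> a b. Y $ a $ b + t * W $ a $ b)) $ k $ l"
            using anti[of l k] by (auto simp: W_def)
        qed
        show "decoupled j (Z t)" if "j \<notin> insert i S" for j
          using 2(5)[OF that] that by (auto simp: decoupled_def Z_def W_def)
        show "Z t $ Inl i $ Inr i \<noteq> 0" using True t by (simp add: Z_def W_def)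
      qed
      then have z: "(unnormalized_pf (Z t))\<^sup>2 - (unnormalized_pf (J_mat :: complex^('m + 'm)^('m + 'm)))\<^sup>2 * det (Z t) = 0" if "t \<noteq> 0" for t
        using that by (simp add: square_root_at_def)
      have "continuous_on UNIV (\<lambda>t. (unnormalized_pf (Z t))\<^sup>2 - (unnormalized_pf (J_mat :: complex^('m + 'm)^('m + 'm)))\<^sup>2 * det (Z t))"
        unfolding Z_def by (intro continuous_intros mixed_pf_continuous det_continuous)
      then have "((\<lambda>t. (unnormalized_pf (Z t))\<^sup>2 - (unnormalized_pf (J_mat :: complex^('m + 'm)^('m + 'm)))\<^sup>2 * det (Z t))
          \<longlongrightarrow> (unnormalized_pf (Z 0))\<^sup>2 - (unnormalized_pf (J_mat :: complex^('m + 'm)^('m + 'm)))\<^sup>2 * det (Z 0)) (at 0)"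
        by (simp add: continuous_on_def)
      moreover have "((\<lambda>t. (unnormalized_pf (Z t))\<^sup>2 - (unnormalized_pf (J_mat :: complex^('m + 'm)^('m + 'm)))\<^sup>2 * det (Z t))
          \<longlongrightarrow> 0) (at 0)"
        by (rule tendsto_eventually, unfold eventually_at_filter, rule always_eventually) (use z in blast)
      ultimately have "(unnormalized_pf (Z 0))\<^sup>2 - (unnormalized_pf (J_mat :: complex^('m + 'm)^('m + 'm)))\<^sup>2 * det (Z 0) = 0"
        by (rule tendsto_unique[rotated]) simp
      moreover have "Z 0 = Y" by (simp add: Z_def vec_eq_iff)
      ultimately show ?thesis by (simp add: square_root_at_def)
    qed
  qed
  from this[of Y UNIV] assms show ?thesis by simp
qed

section \<open>Existence and uniqueness of the pfaffian\<close>

lemma entry_polynomial_sum: "finite I \<Longrightarrow> (\<And>i. i \<in> I \<Longrightarrow> entry_polynomial (f i)) \<Longrightarrow> entry_polynomial (\<lambda>Y. \<Sum>i\<in>I. f i Y)"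
  by (induction I rule: finite_induct) (auto intro: entry_polynomial.intros)

lemma entry_polynomial_prod: "finite I \<Longrightarrow> (\<And>i. i \<in> I \<Longrightarrow> entry_polynomial (f i)) \<Longrightarrow> entry_polynomial (\<lambda>Y. \<Prod>i\<in>I. f i Y)"
  by (induction I rule: finite_induct) (auto intro: entry_polynomial.intros)

definition norm_pf :: "complex^('m::finite + 'm)^('m + 'm) \<Rightarrow> complex" where
  "norm_pf Y = unnormalized_pf Y / unnormalized_pf (J_mat :: complex^('m + 'm)^('m + 'm))"

lemma is_pfaffian_norm_pf: "is_pfaffian (norm_pf :: complex^('m::finite + 'm)^('m + 'm) \<Rightarrow> complex)"
  unfolding is_pfaffian_def
proof (intro conjI allI impI)
  have "entry_polynomial (\<lambda>Y. (\<Sum>\<sigma> | \<sigma> permutes (UNIV :: ('m + 'm) set). of_int (sign \<sigma>) * (\<Prod>i\<in>UNIV. Y $ \<sigma> (Inl i) $ \<sigma> (Inr i)))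
      * (1 / unnormalized_pf (J_mat :: complex^('m + 'm)^('m + 'm))))"
    by (intro entry_polynomial.intros entry_polynomial_sum entry_polynomial_prod finite_permutations) auto
  then show "entry_polynomial (norm_pf :: complex^('m + 'm)^('m + 'm) \<Rightarrow> complex)"
    by (simp add: norm_pf_def[abs_def] mixed_pf_def)
  show "(norm_pf Y)\<^sup>2 = det Y" if "transpose Y = - Y" for Y :: "complex^('m + 'm)^('m + 'm)"
    using square_root_at_antisymmetric[OF that] unnormalized_pf_J_nonzero[where 'm = 'm]
    by (simp add: square_root_at_def norm_pf_def power_divide)
  show "norm_pf (J_mat :: complex^('m + 'm)^('m + 'm)) = 1"
    using unnormalized_pf_J_nonzero[where 'm = 'm] by (simp add: norm_pf_def)
qed

lemma entry_polynomial_line: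
  assumes "entry_polynomial p"
  shows "\<exists>q. \<forall>t. p (\<chi> a b. Y $ a $ b + t * W $ a $ b) = poly q t"
  using assms
proof (induction rule: entry_polynomial.induct)
  case (1 c)
  show ?case by (intro exI[of _ "[:c:]"]) simp
next
  case (2 i j)
  show ?case by (intro exI[of _ "[:Y $ i $ j, W $ i $ j:]"]) simp
next
  case (3 p q)
  then obtain p' q' where "\<And>t. p (\<chi> a b. Y $ a $ b + t * W $ a $ b) = poly p' t"
    "\<And>t. q (\<chi> a b. Y $ a $ b + t * W $ a $ b) = poly q' t" by blast
  then show ?case by (intro exI[of _ "p' + q'"]) simp
next
  case (4 p q)
  then obtain p' q' where "\<And>t. p (\<chi> a b. Y $ a $ b + t * W $ a $ b) = poly p' t"
    "\<And>t. q (\<chi> a b. Y $ a $ b + t * W $ a $ b) = poly q' t" by blast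
  then show ?case by (intro exI[of _ "p' * q'"]) simp
qed

text \<open>On the line from \<open>J\<close> to \<open>Y\<close> two pfaffians are polynomials with the same square, hence equal up
  to a sign, which is determined at \<open>J\<close>.\<close>

lemma is_pfaffian_unique:
  fixes Y :: "complex^('m::finite + 'm)^('m + 'm)"
  assumes p: "is_pfaffian p" and q: "is_pfaffian q" and Y: "transpose Y = - Y"
  shows "p Y = q Y"
proof -
  define Z where "Z t = (\<chi> a b. J_mat $ a $ b + t * (Y - J_mat) $ a $ b)" for t
  obtain p' where p': "\<And>t. p (Z t) = poly p' t"
    using entry_polynomial_line[of p] p unfolding Z_def is_pfaffian_def by blast
  obtain q' where q': "\<And>t. q (Z t) = poly q' t"
    using entry_polynomial_line[of q] q unfolding Z_def is_pfaffian_def by blast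
  have "transpose (Z t) = - Z t" for t
  proof -
    have 1: "Y $ a $ b = - (Y $ b $ a)" for a b
      using arg_cong[OF Y, of "\<lambda>M. M $ b $ a"] by (simp add: Finite_Cartesian_Product.transpose_def)
    have 2: "(J_mat :: complex^('m + 'm)^('m + 'm)) $ a $ b = - (J_mat $ b $ a)" for a b
      using arg_cong[OF transpose_J_mat, of "\<lambda>M. M $ b $ a"] by (simp add: Finite_Cartesian_Product.transpose_def)
    have "transpose (Z t) $ a $ b = (- Z t) $ a $ b" for a b
      using 1[of b a] 2[of b a] by (simp add: Z_def Finite_Cartesian_Product.transpose_def algebra_simps)
    then show ?thesis by (simp add: vec_eq_iff)
  qed
  then have "(p (Z t))\<^sup>2 = (q (Z t))\<^sup>2" for t using p q by (simp add: is_pfaffian_def)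
  then have "poly ((p' - q') * (p' + q')) t = poly 0 t" for t
    using p' q' by (simp add: power2_eq_square algebra_simps)
  then have "(p' - q') * (p' + q') = 0" using poly_eq_poly_eq_iff by blast
  \<comment> \<open>At t = 0, where the line passes through J, the sum is 2.\<close>
  moreover have "p' + q' \<noteq> 0"
  proof
    assume "p' + q' = 0"
    then have "p (Z 0) + q (Z 0) = 0" unfolding p' q' by (simp flip: poly_add)
    moreover have "Z 0 = J_mat" by (simp add: Z_def vec_eq_iff)
    ultimately show False using p q by (simp add: is_pfaffian_def)
  qed
  ultimately have "p' = q'" by simp
  moreover have "Z 1 = Y" by (simp add: Z_def vec_eq_iff)
  ultimately show ?thesis using p'[of 1] q'[of 1] by simp
qed

lemma pf_eq_norm_pf: "transpose Y = - Y \<Longrightarrow> pf Y = norm_pf Y"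
  unfolding pf_def
  using is_pfaffian_norm_pf is_pfaffian_unique by (intro the_equality) blast+

section \<open>The three division algebras\<close>

text \<open>The form is fixed by \<open>cj\<close>, hence real, and its real part is the inner
  product. This links the definitions of the cones to the locale.\<close>

lemma (in hermitian_matrices) hermitian_form_pos_iff:
  assumes X: "X \<in> Herm"
  shows "(\<exists>r>0. (\<Sum>i\<in>UNIV. \<Sum>j\<in>UNIV. cj (v $ i) * X $ i $ j * v $ j) = of_real r) \<longleftrightarrow> 0 < v \<bullet> (X *v v)"
proof -
  let ?F = "\<Sum>i\<in>UNIV. \<Sum>j\<in>UNIV. cj (v $ i) * X $ i $ j * v $ j"
  have X': "cj (X $ i $ j) = X $ j $ i" for i j by (rule HermD[OF X])
  have "cj ?F = (\<Sum>i\<in>UNIV. \<Sum>j\<in>UNIV. cj (v $ j) * X $ j $ i * v $ i)"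
    by (simp add: cj_sum cj_mult X' mult.assoc)
  also have "\<dots> = ?F" by (rule sum.swap)
  finally have 1: "?F = of_real (?F \<bullet> 1)" by (rule cj_fixed)
  have "?F \<bullet> 1 = v \<bullet> (X *v v)"
    by (simp add: inner_sum_left inner_cj mult.assoc inner_vec_def matrix_vector_mult_def inner_sum_right)
  with 1 have "?F = of_real (v \<bullet> (X *v v))" by simp
  then show ?thesis by simp
qed

section \<open>Complex-valued polynomials and determinants\<close>

definition complex_polynomial :: "('a::euclidean_space \<Rightarrow> complex) \<Rightarrow> bool" where
  "complex_polynomial f \<longleftrightarrow> real_polynomial_function (\<lambda>x. Re (f x)) \<and> real_polynomial_function (\<lambda>x. Im (f x))"

lemma complex_polynomial_linear:
  assumes "linear f"
  shows "complex_polynomial f"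
proof -
  have "linear (\<lambda>x. Re (f x))" "linear (\<lambda>x. Im (f x))"
    using assms by (auto intro!: linearI simp: linear_add linear_scale)
  then show ?thesis
    by (simp add: complex_polynomial_def real_polynomial_function.intros(1) linear_conv_bounded_linear)
qed

lemma complex_polynomial_const: "complex_polynomial (\<lambda>_. c)"
  by (simp add: complex_polynomial_def real_polynomial_function.intros(2))

lemma complex_polynomial_mult:
  "complex_polynomial f \<Longrightarrow> complex_polynomial g \<Longrightarrow> complex_polynomial (\<lambda>x. f x * g x)"
  unfolding complex_polynomial_def times_complex.sel
  by (intro conjI real_polynomial_function_diff real_polynomial_function.intros(3,4)) simp_all

lemma complex_polynomial_sum:
  "finite I \<Longrightarrow> (\<And>i. i \<in> I \<Longrightarrow> complex_polynomial (f i)) \<Longrightarrow> complex_polynomial (\<lambda>x. \<Sum>i\<in>I. f i x)"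
  unfolding complex_polynomial_def Re_sum Im_sum by (auto intro!: real_polynomial_function_sum)

lemma complex_polynomial_prod:
  "finite I \<Longrightarrow> (\<And>i. i \<in> I \<Longrightarrow> complex_polynomial (f i)) \<Longrightarrow> complex_polynomial (\<lambda>x. \<Prod>i\<in>I. f i x)"
  by (induction I rule: finite_induct) (auto intro: complex_polynomial_mult complex_polynomial_const)

lemma complex_polynomial_det:
  fixes F :: "'a::euclidean_space \<Rightarrow> complex^'k::finite^'k"
  assumes "\<And>a b. linear (\<lambda>x. F x $ a $ b)"
  shows "complex_polynomial (\<lambda>x. det (F x))"
  unfolding det_def
  by (intro complex_polynomial_sum complex_polynomial_prod complex_polynomial_mult
      complex_polynomial_const complex_polynomial_linear assms finite_permutations) auto

lemma complex_polynomial_Re: "complex_polynomial f \<Longrightarrow> real_polynomial_function (\<lambda>x. Re (f x))"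
  by (simp add: complex_polynomial_def)

lemma complex_polynomial_cmod_continuous:
  assumes "complex_polynomial f"
  shows "continuous_on UNIV (\<lambda>x. (cmod (f x))\<^sup>2)"
proof -
  have "real_polynomial_function (\<lambda>x. Re (f x) * Re (f x) + Im (f x) * Im (f x))"
    using assms unfolding complex_polynomial_def by (intro real_polynomial_function.intros(3,4)) auto
  then have "continuous_on UNIV (\<lambda>x. Re (f x) * Re (f x) + Im (f x) * Im (f x))"
    by (simp add: continuous_on_polymonial_function real_polynomial_function_eq)
  then show ?thesis unfolding cmod_power2 unfolding power2_eq_square .
qed

lemma det_singular:
  fixes A :: "'a::field^'k::finite^'k"
  assumes "A *v v = 0" "v \<noteq> 0"
  shows "det A = 0"
proof (rule ccontr)
  assume "det A \<noteq> 0"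
  then obtain B where "B ** A = mat 1" by (auto simp: invertible_def simp flip: invertible_det_nz)
  then show False using assms by (metis matrix_left_invertible_ker)
qed

lemma det_cnj_transpose:
  fixes A :: "complex^'k::finite^'k"
  shows "det (\<chi> i j. cnj (A $ j $ i)) = cnj (det A)"
proof -
  have "(\<chi> i j. cnj (A $ j $ i)) = transpose (\<chi> i j. cnj (A $ i $ j))"
    by (simp add: vec_eq_iff Finite_Cartesian_Product.transpose_def)
  then show ?thesis by (simp add: det_transpose) (simp add: det_def)
qed

lemma det_diag_at: "det (diag_at i s :: 'a::{real_algebra_1,comm_ring_1}^'k::finite^'k) = of_real s"
  by (subst det_diagonal) (simp_all add: diag_at_def)

lemma Re_cnj_mult_mult: "Re (cnj z * w * z) = (cmod z)\<^sup>2 * Re w"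
  unfolding cmod_power2 by (simp add: power2_eq_square algebra_simps)

lemma hermitian_matrices_real: "hermitian_matrices (\<lambda>x::real. x) (det :: real^'m::finite^'m \<Rightarrow> real) (\<lambda>g. (det g)\<^sup>2) 1"
proof (unfold_locales, goal_cases)
  \<comment> \<open>Here and in the two other instances, goals 9, 11, 12, 14 and 15 are
    \<open>nd_cont\<close>, \<open>nd_diag\<close>, \<open>Pd_poly\<close>, \<open>Pd_conj\<close>
    and \<open>Pd_singular\<close>.\<close>
  case 9
  show ?case unfolding det_def by (intro continuous_intros)
next
  case 12
  show ?case unfolding det_def
    by (intro real_polynomial_function_sum real_polynomial_function.intros(4) real_polynomial_function_prod
        real_polynomial_function.intros(1,2) finite_permutations)
      (auto intro!: linear_conv_bounded_linear[THEN iffD1] linearI)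
next
  case (14 X g)
  have "(\<chi> a b. g $ b $ a) = transpose g" by (simp add: vec_eq_iff Finite_Cartesian_Product.transpose_def)
  then show ?case by (simp add: det_mul det_transpose power2_eq_square)
next
  case (15 X v)
  then show ?case by (intro det_singular)
qed (auto simp: det_mul power_mult_distrib det_diag_at)

lemma hermitian_matrices_complex:
  "hermitian_matrices cnj (\<lambda>X :: complex^'m::finite^'m. Re (det X)) (\<lambda>g. (cmod (det g))\<^sup>2) 1"
proof (unfold_locales, goal_cases)
  case 9
  show ?case by (intro complex_polynomial_cmod_continuous complex_polynomial_det linearI) auto
next
  case 12
  show ?case by (intro complex_polynomial_Re complex_polynomial_det linearI) auto
next
  case (14 X g)
  show ?case by (simp add: det_mul det_cnj_transpose Re_cnj_mult_mult del: times_complex.sel)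
next
  case (15 X v)
  then show ?case by (simp add: det_singular)
qed (auto simp: det_mul norm_mult power_mult_distrib det_diag_at complex_eq_iff inner_complex_def
    complex_inner_1_right algebra_simps)

section \<open>Quaternionic matrices as complex matrices\<close>

lemma quat_sum [simp]:
  "qRe (sum f I) = (\<Sum>i\<in>I. qRe (f i))" "qI (sum f I) = (\<Sum>i\<in>I. qI (f i))"
  "qJ (sum f I) = (\<Sum>i\<in>I. qJ (f i))" "qK (sum f I) = (\<Sum>i\<in>I. qK (f i))"
  by (induction I rule: infinite_finite_induct; simp)+

lemma quat_times_sel [simp]:
  "qRe (p * q) = qRe p * qRe q - qI p * qI q - qJ p * qJ q - qK p * qK q"
  "qI (p * q) = qRe p * qI q + qI p * qRe q + qJ p * qK q - qK p * qJ q"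
  "qJ (p * q) = qRe p * qJ q - qI p * qK q + qJ p * qRe q + qK p * qI q"
  "qK (p * q) = qRe p * qK q + qI p * qJ q - qJ p * qI q + qK p * qRe q"
  by (simp_all add: times_quat_def)

lemma qcnj_sel [simp]:
  "qRe (qcnj q) = qRe q" "qI (qcnj q) = - qI q" "qJ (qcnj q) = - qJ q" "qK (qcnj q) = - qK q"
  by (simp_all add: qcnj_def)

lemma quat_of_real_sel [simp]:
  "qRe (of_real r) = r" "qI (of_real r) = 0" "qJ (of_real r) = 0" "qK (of_real r) = 0"
  by (simp_all add: of_real_def)

lemma DIM_quat: "DIM(quat) = 4"
  by (simp add: Basis_quat_def)

definition quat_part1 :: "quat \<Rightarrow> complex" where "quat_part1 q = Complex (qRe q) (qI q)"
definition quat_part2 :: "quat \<Rightarrow> complex" where "quat_part2 q = Complex (qJ q) (qK q)"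

lemma Psi_nth:
  "Psi M $ Inl a $ Inl b = quat_part1 (M $ a $ b)" "Psi M $ Inl a $ Inr b = quat_part2 (M $ a $ b)"
  "Psi M $ Inr a $ Inl b = - cnj (quat_part2 (M $ a $ b))" "Psi M $ Inr a $ Inr b = cnj (quat_part1 (M $ a $ b))"
  by (simp_all add: Psi_def block_matrix_def cpart1_def cpart2_def quat_part1_def quat_part2_def)

lemma quat_part_sum:
  "quat_part1 (sum f I) = (\<Sum>i\<in>I. quat_part1 (f i))" "quat_part2 (sum f I) = (\<Sum>i\<in>I. quat_part2 (f i))"
  by (simp_all add: quat_part1_def quat_part2_def complex_eq_iff)

lemma quat_part_mult:
  "quat_part1 (p * q) = quat_part1 p * quat_part1 q - quat_part2 p * cnj (quat_part2 q)"
  "quat_part2 (p * q) = quat_part1 p * quat_part2 q + quat_part2 p * cnj (quat_part1 q)"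
  by (simp_all add: quat_part1_def quat_part2_def complex_eq_iff)

lemma quat_part_linear:
  "quat_part1 0 = 0" "quat_part2 0 = 0" "quat_part1 1 = 1" "quat_part2 1 = 0"
  "quat_part1 (p + q) = quat_part1 p + quat_part1 q" "quat_part2 (p + q) = quat_part2 p + quat_part2 q"
  "quat_part1 (r *\<^sub>R p) = r *\<^sub>R quat_part1 p" "quat_part2 (r *\<^sub>R p) = r *\<^sub>R quat_part2 p"
  "quat_part1 (of_real r) = of_real r" "quat_part2 (of_real r) = 0"
  "quat_part1 (qcnj p) = cnj (quat_part1 p)" "quat_part2 (qcnj p) = - quat_part2 p"
  by (simp_all add: quat_part1_def quat_part2_def complex_eq_iff)

lemma Psi_mult: "Psi (A ** B) = Psi A ** Psi B"
proof -
  have "Psi (A ** B) $ k $ l = (Psi A ** Psi B) $ k $ l" for k l :: "'a + 'a"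
    by (cases k; cases l) (simp_all add: Psi_nth matrix_matrix_mult_def sum_UNIV_sum quat_part_sum quat_part_mult
        sum.distrib sum_subtractf sum_negf)
  then show ?thesis by (simp add: vec_eq_iff)
qed

lemma Psi_adjoint: "Psi (\<chi> a b. qcnj (M $ b $ a)) = (\<chi> k l. cnj (Psi M $ l $ k))"
proof -
  have "Psi (\<chi> a b. qcnj (M $ b $ a)) $ k $ l = cnj (Psi M $ l $ k)" for k l :: "'a + 'a"
    by (cases k; cases l) (simp_all add: Psi_nth quat_part_linear)
  then show ?thesis by (simp add: vec_eq_iff)
qed

lemma linear_Psi_nth: "linear (\<lambda>M. Psi M $ k $ l)"
  by (cases k; cases l; intro linearI) (simp_all add: Psi_nth quat_part_linear)

lemma Psi_one: "Psi (mat 1) = mat 1"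
proof -
  have "Psi (mat 1) $ k $ l = mat 1 $ k $ l" for k l :: "'a + 'a"
    by (cases k; cases l) (simp_all add: Psi_nth mat_def quat_part_linear)
  then show ?thesis by (simp add: vec_eq_iff)
qed

lemma det_Psi_diag_at: "det (Psi (diag_at i s :: quat^'m::finite^'m)) = of_real s * of_real s"
proof -
  have "Psi (diag_at i s :: quat^'m^'m) $ k $ l = 0" if "k \<noteq> l" for k l
    using that by (cases k; cases l) (auto simp: Psi_nth diag_at_def quat_part_linear)
  then have "det (Psi (diag_at i s :: quat^'m^'m)) = (\<Prod>k\<in>UNIV. Psi (diag_at i s :: quat^'m^'m) $ k $ k)"
    by (rule det_diagonal)
  also have "\<dots> = (\<Prod>a\<in>UNIV. if a = i then of_real s else 1) * (\<Prod>a\<in>UNIV. if a = i then of_real s else 1)"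
    unfolding prod_UNIV_sum
    by (intro arg_cong2[of _ _ _ _ "(*)"] prod.cong) (auto simp: Psi_nth diag_at_def quat_part_linear)
  finally show ?thesis by simp
qed

text \<open>w is the first of the two complex columns representing v, so that
  \<open>Psi M *v w\<close> is the first column representing M v.\<close>

lemma det_Psi_singular:
  assumes Mv: "M *v v = 0" and v: "v \<noteq> 0"
  shows "det (Psi M) = 0"
proof -
  define w where "w = (\<chi> k. case k of Inl a \<Rightarrow> quat_part1 (v $ a) | Inr a \<Rightarrow> - cnj (quat_part2 (v $ a)))"
  have 0: "(\<Sum>b\<in>UNIV. M $ a $ b * v $ b) = 0" for a
    using arg_cong[OF Mv, of "\<lambda>u. u $ a"] by (simp add: matrix_vector_mult_def)
  have 1: "quat_part1 (\<Sum>b\<in>UNIV. M $ a $ b * v $ b) = 0" "quat_part2 (\<Sum>b\<in>UNIV. M $ a $ b * v $ b) = 0" for a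
    unfolding 0 by (simp_all add: quat_part_linear)
  have "(Psi M *v w) $ Inl a = 0" for a
    using 1(1)[of a] by (simp add: matrix_vector_mult_def sum_UNIV_sum Psi_nth w_def quat_part_sum quat_part_mult
        sum_subtractf sum_negf)
  moreover have "(Psi M *v w) $ Inr a = 0" for a
    using arg_cong[OF 1(2)[of a], of cnj]
    by (simp add: matrix_vector_mult_def sum_UNIV_sum Psi_nth w_def quat_part_sum quat_part_mult
        sum.distrib sum_negf add.commute neg_eq_iff_add_eq_0)
  ultimately have "(Psi M *v w) $ k = 0" for k by (cases k) auto
  then have "Psi M *v w = 0" by (simp add: vec_eq_iff)
  moreover obtain a where "v $ a \<noteq> 0" using v by (auto simp: vec_eq_iff)
  then have "w $ Inl a \<noteq> 0 \<or> w $ Inr a \<noteq> 0"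
    by (auto simp: w_def quat_part1_def quat_part2_def quat_eq_iff complex_eq_iff)
  then have "w \<noteq> 0" by auto
  ultimately show ?thesis by (rule det_singular)
qed

lemma hermitian_matrices_quat:
  "hermitian_matrices qcnj (\<lambda>X :: quat^'m::finite^'m. Re (det (Psi X))) (\<lambda>g. (cmod (det (Psi g)))\<^sup>2) (1/2)"
proof (unfold_locales, goal_cases)
  case 9
  show ?case by (intro complex_polynomial_cmod_continuous complex_polynomial_det linear_Psi_nth)
next
  case (11 s i)
  then show ?case by (simp add: det_Psi_diag_at norm_mult powr_numeral power2_eq_square power4_eq_xxxx mult_ac)
next
  case 12
  show ?case by (intro complex_polynomial_Re complex_polynomial_det linear_Psi_nth)
next
  case (14 X g)
  show ?case by (simp add: Psi_mult Psi_adjoint det_mul det_cnj_transpose Re_cnj_mult_mult del: times_complex.sel)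
next
  case (15 X v)
  then show ?case by (simp add: det_Psi_singular)
qed (auto simp: det_mul norm_mult power_mult_distrib Psi_mult Psi_one quat_eq_iff inner_quat_def algebra_simps)

lemma Pi_complex_eq: "Pi_complex = {X \<in> Herm_complex. \<forall>v :: complex^'m::finite. v \<noteq> 0 \<longrightarrow> 0 < v \<bullet> (X *v v)}"
proof -
  interpret hermitian_matrices cnj "\<lambda>X :: complex^'m^'m. Re (det X)" "\<lambda>g. (cmod (det g))\<^sup>2" 1
    "\<lambda>M. \<chi> a b. cnj (M $ b $ a)" Herm_complex "{X \<in> Herm_complex. \<forall>v. v \<noteq> 0 \<longrightarrow> 0 < v \<bullet> (X *v v)}"
    unfolding Herm_complex_def by (rule hermitian_matrices_complex)
  show ?thesis
    unfolding Pi_complex_def by (intro Collect_cong conj_cong refl) (simp only: hermitian_form_pos_iff)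
qed

lemma Pi_quat_eq: "Pi_quat = {X \<in> Herm_quat. \<forall>v :: quat^'m::finite. v \<noteq> 0 \<longrightarrow> 0 < v \<bullet> (X *v v)}"
proof -
  interpret hermitian_matrices qcnj "\<lambda>X :: quat^'m^'m. Re (det (Psi X))" "\<lambda>g. (cmod (det (Psi g)))\<^sup>2" "1/2"
    "\<lambda>M. \<chi> a b. qcnj (M $ b $ a)" Herm_quat "{X \<in> Herm_quat. \<forall>v. v \<noteq> 0 \<longrightarrow> 0 < v \<bullet> (X *v v)}"
    unfolding Herm_quat_def by (rule hermitian_matrices_quat)
  show ?thesis
    unfolding Pi_quat_def by (intro Collect_cong conj_cong refl) (simp only: hermitian_form_pos_iff)
qed

lemma J_mat_mult_nth: "(J_mat ** X) $ Inl a $ k = X $ Inr a $ k" "(J_mat ** X) $ Inr a $ k = - X $ Inl a $ k"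
  by (simp_all add: matrix_matrix_mult_def sum_UNIV_sum J_mat_nth if_distrib[of "\<lambda>x. x * _"] cong: if_cong)

lemma transpose_J_Psi:
  assumes "M \<in> Herm_quat"
  shows "transpose (J_mat ** Psi M) = - (J_mat ** Psi M)"
proof -
  have M: "M $ b $ a = qcnj (M $ a $ b)" for a b
    using assms by (auto simp: Herm_quat_def vec_eq_iff)
  have anti: "(J_mat ** Psi M) $ l $ k = - (J_mat ** Psi M) $ k $ l" for k l
  proof (cases k; cases l)
    fix a b assume "k = Inl a" "l = Inl b"
    then show ?thesis using M[of a b] by (simp add: J_mat_mult_nth Psi_nth quat_part_linear)
  next
    fix a b assume "k = Inl a" "l = Inr b"
    then show ?thesis using M[of a b] by (simp add: J_mat_mult_nth Psi_nth quat_part_linear)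
  next
    fix a b assume "k = Inr a" "l = Inl b"
    then show ?thesis using M[of a b] by (simp add: J_mat_mult_nth Psi_nth quat_part_linear)
  next
    fix a b assume "k = Inr a" "l = Inr b"
    then show ?thesis using M[of a b] by (simp add: J_mat_mult_nth Psi_nth quat_part_linear)
  qed
  show ?thesis
    unfolding vec_eq_iff
  proof (intro allI)
    fix k l
    show "transpose (J_mat ** Psi M) $ k $ l = (- (J_mat ** Psi M)) $ k $ l"
      using anti[of l k] by (simp add: Finite_Cartesian_Product.transpose_def)
  qed
qed

lemma norm_pf_sq: "transpose Y = - Y \<Longrightarrow> (norm_pf Y)\<^sup>2 = det Y"
  using is_pfaffian_norm_pf unfolding is_pfaffian_def by blast

text \<open>The pfaffian has no zero on the segment from the identity to \<open>M\<close>, so it stays positive.\<close>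

lemma moore_det_eq:
  fixes M :: "quat^'m::finite^'m"
  assumes M: "M \<in> Pi_quat"
  shows "moore_det M = Re (det (Psi M)) powr (1/2)"
proof -
  interpret hermitian_matrices qcnj "\<lambda>X :: quat^'m^'m. Re (det (Psi X))" "\<lambda>g. (cmod (det (Psi g)))\<^sup>2" "1/2"
    "\<lambda>M. \<chi> a b. qcnj (M $ b $ a)" Herm_quat Pi_quat
    unfolding Pi_quat_eq Herm_quat_def by (rule hermitian_matrices_quat)
  \<comment> \<open>The square of the pfaffian is det (Psi X), which is real and positive; hence the
    pfaffian itself is real and nonzero.\<close>
  have sq: "Im (norm_pf (J_mat ** Psi X)) = 0" "(Re (norm_pf (J_mat ** Psi X)))\<^sup>2 = Re (det (Psi X))"
    "Re (det (Psi X)) > 0" if X: "X \<in> Pi_quat" for X :: "quat^'m^'m"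
  proof -
    have H: "X \<in> Herm_quat" using PosDef_Herm[OF X] .
    have "(norm_pf (J_mat ** Psi X))\<^sup>2 = det (Psi X)"
      by (simp add: norm_pf_sq transpose_J_Psi[OF H] det_mul det_J_mat)
    moreover have "cnj (det (Psi X)) = det (Psi X)"
      using H by (simp add: Herm_quat_def flip: det_cnj_transpose Psi_adjoint)
    moreover show "Re (det (Psi X)) > 0" using Pd_block_pos[OF X, of UNIV] by (simp add: block_one_UNIV)
    moreover have "0 \<le> Im (norm_pf (J_mat ** Psi X)) * Im (norm_pf (J_mat ** Psi X))" by simp
    ultimately show "Im (norm_pf (J_mat ** Psi X)) = 0" "(Re (norm_pf (J_mat ** Psi X)))\<^sup>2 = Re (det (Psi X))"
      by (auto simp: complex_eq_iff power2_eq_square simp del: zero_le_square)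
  qed
  define \<gamma> where "\<gamma> t = mat 1 + t *\<^sub>R (M - mat 1)" for t :: real
  have \<gamma>: "\<gamma> t \<in> Pi_quat" if "0 \<le> t" "t \<le> 1" for t
  proof -
    have "(1 - t) *\<^sub>R mat 1 + t *\<^sub>R M \<in> Pi_quat"
      using convexD[OF convex_PosDef mat_one_PosDef M, of "1 - t" t] that by simp
    then show ?thesis by (simp add: \<gamma>_def algebra_simps)
  qed
  let ?W = "J_mat ** Psi (M - mat 1)"
  define p where "p t = Re (norm_pf (J_mat ** Psi (\<gamma> t)))" for t
  have JP: "(J_mat ** Psi (\<gamma> t)) $ k $ l = J_mat $ k $ l + complex_of_real t * ?W $ k $ l" for t k l
  proof -
    have P: "Psi (\<gamma> t) $ a $ b = Psi (mat 1) $ a $ b + complex_of_real t * Psi (M - mat 1) $ a $ b" for a b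
      using linear_add[OF linear_Psi_nth, of "mat 1" "t *\<^sub>R (M - mat 1)" a b]
        linear_scale[OF linear_Psi_nth, of t "M - mat 1" a b]
      by (simp add: \<gamma>_def scaleR_conv_of_real)
    have J: "J_mat $ k $ l = (J_mat ** Psi (mat 1)) $ k $ l" by (simp add: Psi_one)
    show ?thesis unfolding J by (cases k) (simp_all add: J_mat_mult_nth P algebra_simps)
  qed
  have eq: "J_mat ** Psi (\<gamma> t) = (\<chi> a b. J_mat $ a $ b + complex_of_real t * ?W $ a $ b)" for t
    by (simp add: vec_eq_iff JP)
  have "continuous_on UNIV (\<lambda>t. unnormalized_pf (\<chi> a b. J_mat $ a $ b + complex_of_real t * ?W $ a $ b))"
    by (rule continuous_on_compose2[OF mixed_pf_continuous]) (auto intro: continuous_intros)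
  then have "continuous_on UNIV p"
    unfolding p_def norm_pf_def eq by (intro continuous_intros) (simp_all add: unnormalized_pf_J_nonzero)
  then have cont: "continuous_on {0..1} p" by (rule continuous_on_subset) simp
  have "J_mat ** Psi (\<gamma> 0) = J_mat" by (simp add: \<gamma>_def Psi_one)
  then have p0: "p 0 = 1" using is_pfaffian_norm_pf[where 'm = 'm] by (simp add: p_def is_pfaffian_def)
  have nz: "p t \<noteq> 0" if "0 \<le> t" "t \<le> 1" for t
    using sq(2,3)[OF \<gamma>[OF that]] by (auto simp: p_def)
  have "p 1 > 0"
  proof (rule ccontr)
    assume "\<not> p 1 > 0"
    then obtain t where "0 \<le> t" "t \<le> 1" "p t = 0"
      using IVT2'[of p 1 0 0] cont p0 by auto
    then show False using nz by blast
  qed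
  moreover have "moore_det M = p 1"
    by (simp add: moore_det_def p_def \<gamma>_def pf_eq_norm_pf transpose_J_Psi[OF PosDef_Herm[OF M]])
  moreover have "(p 1)\<^sup>2 = Re (det (Psi M))" using sq(2)[OF M] by (simp add: p_def \<gamma>_def)
  ultimately show ?thesis
    by (simp add: powr_half_sqrt flip: \<open>(p 1)\<^sup>2 = Re (det (Psi M))\<close>)
qed

section \<open>Translation of the Wallach set in the three cases\<close>

lemma power_det_real:
  fixes \<beta> :: real
  defines "f \<equiv> \<lambda>A :: real^'m::finite^'m. det A powr (- \<beta>)"
    and "W \<equiv> range (\<lambda>k::nat. real k / 2) \<union> {(real CARD('m) - 1) / 2..}"
  shows "completely_monotone Sym_real Pi_real f \<longleftrightarrow> \<beta> \<in> W"
    and "\<beta> \<notin> W \<longrightarrow> (\<forall>C. C \<noteq> {} \<and> C \<subseteq> Pi_real \<and> open_convex_cone Sym_real C \<longrightarrow>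
      \<not> completely_monotone Sym_real C f)"
proof -
  have one: "x powr b = (x powr 1) powr b" if "0 < x" for x b :: real using that by simp
  have member: "n = 0 \<or> (real n - 1) * (real DIM(real) / 2) \<le> \<beta> \<or> (\<exists>k::nat. \<beta> = real k * (real DIM(real) / 2))
    \<longleftrightarrow> \<beta> \<in> range (\<lambda>k::nat. real k / 2) \<union> {(real n - 1) / 2..}" if "n > 0" for n :: nat
    using that by (auto simp: image_iff)
  interpret hermitian_matrices "\<lambda>x. x" "det :: real^'m^'m \<Rightarrow> real" "\<lambda>g. (det g)\<^sup>2" 1
    "\<lambda>M. \<chi> a b. M $ b $ a" Sym_real Pi_real
    unfolding Pi_real_def Sym_real_def Finite_Cartesian_Product.transpose_def by (rule hermitian_matrices_real)
  have f: "f A = (det A powr 1) powr (- \<beta>)" if "A \<in> Pi_real" for A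
    unfolding f_def by (rule one) (use Pd_block_pos[OF that, of UNIV] in \<open>simp only: block_one_UNIV\<close>)
  have W: "\<beta> \<in> wallach CARD('m) \<longleftrightarrow> \<beta> \<in> W"
    unfolding wallach_def hdim_def W_def mem_Collect_eq by (rule member) (rule zero_less_card_finite)
  show "completely_monotone Sym_real Pi_real f \<longleftrightarrow> \<beta> \<in> W"
    unfolding W[symmetric] by (rule wallach_theorem(1), erule f)
  show "\<beta> \<notin> W \<longrightarrow> (\<forall>C. C \<noteq> {} \<and> C \<subseteq> Pi_real \<and> open_convex_cone Sym_real C \<longrightarrow>
      \<not> completely_monotone Sym_real C f)"
    unfolding W[symmetric] by (rule wallach_theorem(2), erule f)
qed

lemma power_det_complex:
  fixes \<beta> :: real
  defines "f \<equiv> \<lambda>A :: complex^'m::finite^'m. Re (det A) powr (- \<beta>)"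
    and "W \<equiv> range (\<lambda>k::nat. real k) \<union> {real CARD('m) - 1..}"
  shows "completely_monotone Herm_complex Pi_complex f \<longleftrightarrow> \<beta> \<in> W"
    and "\<beta> \<notin> W \<longrightarrow> (\<forall>C. C \<noteq> {} \<and> C \<subseteq> Pi_complex \<and> open_convex_cone Herm_complex C \<longrightarrow>
      \<not> completely_monotone Herm_complex C f)"
proof -
  interpret hermitian_matrices cnj "\<lambda>X :: complex^'m^'m. Re (det X)" "\<lambda>g. (cmod (det g))\<^sup>2" 1
    "\<lambda>M. \<chi> a b. cnj (M $ b $ a)" Herm_complex Pi_complex
    unfolding Pi_complex_eq Herm_complex_def by (rule hermitian_matrices_complex)
  have f: "f A = (Re (det A) powr 1) powr (- \<beta>)" if "A \<in> Pi_complex" for A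
    using Pd_block_pos[OF that, of UNIV] by (simp add: f_def block_one_UNIV)
  have W: "\<beta> \<in> wallach CARD('m) \<longleftrightarrow> \<beta> \<in> W"
    by (auto simp: wallach_def hdim_def W_def)
  show "completely_monotone Herm_complex Pi_complex f \<longleftrightarrow> \<beta> \<in> W"
    unfolding W[symmetric] by (rule wallach_theorem(1), erule f)
  show "\<beta> \<notin> W \<longrightarrow> (\<forall>C. C \<noteq> {} \<and> C \<subseteq> Pi_complex \<and> open_convex_cone Herm_complex C \<longrightarrow>
      \<not> completely_monotone Herm_complex C f)"
    unfolding W[symmetric] by (rule wallach_theorem(2), erule f)
qed

lemma power_moore_det:
  fixes \<beta> :: real
  defines "f \<equiv> \<lambda>A :: quat^'m::finite^'m. moore_det A powr (- \<beta>)"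
    and "W \<equiv> range (\<lambda>k::nat. 2 * real k) \<union> {2 * real CARD('m) - 2..}"
  shows "completely_monotone Herm_quat Pi_quat f \<longleftrightarrow> \<beta> \<in> W"
    and "\<beta> \<notin> W \<longrightarrow> (\<forall>C. C \<noteq> {} \<and> C \<subseteq> Pi_quat \<and> open_convex_cone Herm_quat C \<longrightarrow>
      \<not> completely_monotone Herm_quat C f)"
proof -
  interpret hermitian_matrices qcnj "\<lambda>X :: quat^'m^'m. Re (det (Psi X))" "\<lambda>g. (cmod (det (Psi g)))\<^sup>2" "1/2"
    "\<lambda>M. \<chi> a b. qcnj (M $ b $ a)" Herm_quat Pi_quat
    unfolding Pi_quat_eq Herm_quat_def by (rule hermitian_matrices_quat)
  have f: "f A = (Re (det (Psi A)) powr (1/2)) powr (- \<beta>)" if "A \<in> Pi_quat" for A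
    by (simp add: f_def moore_det_eq[OF that])
  have W: "\<beta> \<in> wallach CARD('m) \<longleftrightarrow> \<beta> \<in> W"
    by (auto simp: wallach_def hdim_def W_def DIM_quat algebra_simps)
  show "completely_monotone Herm_quat Pi_quat f \<longleftrightarrow> \<beta> \<in> W"
    unfolding W[symmetric] by (rule wallach_theorem(1), erule f)
  show "\<beta> \<notin> W \<longrightarrow> (\<forall>C. C \<noteq> {} \<and> C \<subseteq> Pi_quat \<and> open_convex_cone Herm_quat C \<longrightarrow>
      \<not> completely_monotone Herm_quat C f)"
    unfolding W[symmetric] by (rule wallach_theorem(2), erule f)
qed

theorem theorem1p3:
  fixes \<beta> :: real
  shows
    "(completely_monotone Sym_real Pi_real (\<lambda>A::real^'m::finite^'m. det A powr (- \<beta>)) \<longleftrightarrow>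
        \<beta> \<in> range (\<lambda>k::nat. real k / 2) \<union> {(real CARD('m) - 1) / 2..}) \<and>
     (\<beta> \<notin> range (\<lambda>k::nat. real k / 2) \<union> {(real CARD('m) - 1) / 2..} \<longrightarrow>
        (\<forall>C'. C' \<noteq> {} \<and> C' \<subseteq> Pi_real \<and> open_convex_cone Sym_real C' \<longrightarrow>
           \<not> completely_monotone Sym_real C' (\<lambda>A::real^'m^'m. det A powr (- \<beta>)))) \<and>
     (completely_monotone Herm_complex Pi_complex (\<lambda>A::complex^'m^'m. Re (det A) powr (- \<beta>)) \<longleftrightarrow>
        \<beta> \<in> range (\<lambda>k::nat. real k) \<union> {real CARD('m) - 1..}) \<and>
     (\<beta> \<notin> range (\<lambda>k::nat. real k) \<union> {real CARD('m) - 1..} \<longrightarrow>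
        (\<forall>C'. C' \<noteq> {} \<and> C' \<subseteq> Pi_complex \<and> open_convex_cone Herm_complex C' \<longrightarrow>
           \<not> completely_monotone Herm_complex C' (\<lambda>A::complex^'m^'m. Re (det A) powr (- \<beta>)))) \<and>
     (completely_monotone Herm_quat Pi_quat (\<lambda>A::quat^'m^'m. moore_det A powr (- \<beta>)) \<longleftrightarrow>
        \<beta> \<in> range (\<lambda>k::nat. 2 * real k) \<union> {2 * real CARD('m) - 2..}) \<and>
     (\<beta> \<notin> range (\<lambda>k::nat. 2 * real k) \<union> {2 * real CARD('m) - 2..} \<longrightarrow>
        (\<forall>C'. C' \<noteq> {} \<and> C' \<subseteq> Pi_quat \<and> open_convex_cone Herm_quat C' \<longrightarrow>
           \<not> completely_monotone Herm_quat C' (\<lambda>A::quat^'m^'m. moore_det A powr (- \<beta>))))"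
  using power_det_real[of \<beta>, where 'm = 'm] power_det_complex[of \<beta>, where 'm = 'm]
    power_moore_det[of \<beta>, where 'm = 'm]
  by (intro conjI)

end
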